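(* Let $\alpha\geq0$. For $q\in(0,1)$ let $$s_\alpha(q)=\sum_{l=0}^\infty(2l+1)^\alpha\frac{(1-q)q^l}{1-q^{2l+1}},$$ and let $r_0(\alpha)\in(0,1)$ be the unique solution to the equation $s_\alpha(q)=2$. Let $$\mathtt{T}_0=\left\{\{q_n\}_{n=1}^\infty\in(0,1)^\infty:\ \sup_nq_n<r_0(\alpha)\right\}.$$ Then, for every sequence of moduli $\{\mu_n\}_{n=1}^\infty\in(0,1)^\infty$ whose associated sequence of nomes $\{q_n\}$ belongs to $\mathtt{T}_0$, the set of eigenfunctions $\{u_n(\cdot,\mu_n)\}_{n=1}^\infty$ of the Gross–Pitaevskii eigenvalue problem $$u''-u^3+\eta u=0,\qquad u(0)=u(1)=0,$$ is a basis of $\mathrm{H}^\alpha$.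
   Context: For $n\in\mathbb{N}$ and modulus $\mu\in(0,1)$, the eigenfunctions are $$u_n(x,\mu)=2^{3/2}n\mu K(\mu)\operatorname{sn}\big(2K(\mu)nx,\mu\big),$$ with eigenvalue $\eta=4n^2(1+\mu^2)K(\mu)^2$. Here $K(\mu)=\int_0^1(1-t^2)^{-1/2}(1-\mu^2t^2)^{-1/2}\,dt$ and $\operatorname{sn}(\cdot,\mu)$ is the Jacobi elliptic function of modulus $\mu$, i.e. the odd $4K(\mu)$-periodic (smooth) extension of the inverse of $z\mapsto\int_0^z(1-t^2)^{-1/2}(1-\mu^2t^2)^{-1/2}\,dt$. The nome associated to $\mu$ is $q=\exp\left[-\pi K(\sqrt{1-\mu^2})/K(\mu)\right]\in(0,1)$. For $\alpha\geq0$, $\mathrm{H}^\alpha=\mathrm{H}^\alpha(0,1)$ denotes the complex Hilbert space of functions $f\in L^2(0,1)$ with $\sum_{n=1}^\infty n^{2\alpha}|\hat f(n)|^2<\infty$, where $\hat f(n)=\sqrt2\int_0^1f(x)\sin(n\pi x)\,dx$, with inner product $\langle f,g\rangle_\alpha=\sum_{n=1}^\infty n^{2\alpha}\hat f(n)\overline{\hat g(n)}$. Basis means Schauder basis. For a set $J$, $J^\infty$ denotes the set of sequences with entries in $J$. *)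

theory Defs
  imports "HOL-Analysis.Analysis"
begin

definition ellipF :: "real \<Rightarrow> real \<Rightarrow> real" where
  "ellipF \<mu> z = (LBINT t=0..ereal z. 1 / (sqrt (1 - t\<^sup>2) * sqrt (1 - \<mu>\<^sup>2 * t\<^sup>2)))"

definition ellipK :: "real \<Rightarrow> real" where
  "ellipK \<mu> = ellipF \<mu> 1"

text \<open>
  Oddness and periodicity with period \<open>4K\<close> do not determine an extension of the inverse of
  \<open>ellipF \<mu>\<close> beyond \<open>[-K, K]\<close>. Jacobi's function is the one that is moreover symmetric about
  \<open>K\<close>. Below, \<open>y\<close> is the representative of \<open>x\<close> modulo \<open>4K\<close> in \<open>[-K, 3K)\<close>.
\<close>
definition jacobi_sn :: "real \<Rightarrow> real \<Rightarrow> real" where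
  "jacobi_sn x \<mu> =
    (let K = ellipK \<mu>;
         y = x - 4 * K * of_int \<lfloor>(x + K) / (4 * K)\<rfloor>
     in the_inv_into {-1..1} (ellipF \<mu>) (if y \<le> K then y else 2 * K - y))"

definition nome :: "real \<Rightarrow> real" where
  "nome \<mu> = exp (- pi * ellipK (sqrt (1 - \<mu>\<^sup>2)) / ellipK \<mu>)"

definition gp_u :: "nat \<Rightarrow> real \<Rightarrow> real \<Rightarrow> real" where
  "gp_u n \<mu> x = 2 powr (3/2) * real n * \<mu> * ellipK \<mu> * jacobi_sn (2 * ellipK \<mu> * real n * x) \<mu>"

definition gp_eta :: "nat \<Rightarrow> real \<Rightarrow> real" where
  "gp_eta n \<mu> = 4 * (real n)\<^sup>2 * (1 + \<mu>\<^sup>2) * (ellipK \<mu>)\<^sup>2"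

definition gp_eigenfunction :: "real \<Rightarrow> (real \<Rightarrow> real) \<Rightarrow> bool" where
  "gp_eigenfunction \<eta> u \<longleftrightarrow>
     (\<exists>u' u''. \<forall>x\<in>{0..1}.
        (u has_real_derivative u' x) (at x within {0..1}) \<and>
        (u' has_real_derivative u'' x) (at x within {0..1}) \<and>
        u'' x - u x ^ 3 + \<eta> * u x = 0) \<and>
     u 0 = 0 \<and> u 1 = 0 \<and> (\<exists>x\<in>{0..1}. u x \<noteq> 0)"

definition sine_coeff :: "(real \<Rightarrow> complex) \<Rightarrow> nat \<Rightarrow> complex" where
  "sine_coeff f n =
     of_real (sqrt 2) * (LINT x|lebesgue_on {0<..<1}. f x * of_real (sin (real n * pi * x)))"

text \<open>
  Elements of \<open>L\<^sup>2(0,1)\<close> and \<open>H\<^sup>\<alpha>(0,1)\<close> are represented by functions on the real line of which only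
  the values on \<open>(0,1)\<close> matter; \<open>H_norm\<close> is invariant under changes on null sets, so it is a
  seminorm on representatives, inducing the norm on the quotient modulo a.e. equality.
\<close>
definition L2_01 :: "(real \<Rightarrow> complex) set" where
  "L2_01 = {f. f \<in> borel_measurable (lebesgue_on {0<..<1}) \<and>
               integrable (lebesgue_on {0<..<1}) (\<lambda>x. (norm (f x))\<^sup>2)}"

definition H_space :: "real \<Rightarrow> (real \<Rightarrow> complex) set" where
  "H_space \<alpha> = {f \<in> L2_01.
     summable (\<lambda>k. real (Suc k) powr (2 * \<alpha>) * (norm (sine_coeff f (Suc k)))\<^sup>2)}"

definition H_inner :: "real \<Rightarrow> (real \<Rightarrow> complex) \<Rightarrow> (real \<Rightarrow> complex) \<Rightarrow> complex" where
  "H_inner \<alpha> f g =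
     (\<Sum>k. of_real (real (Suc k) powr (2 * \<alpha>)) * sine_coeff f (Suc k) * cnj (sine_coeff g (Suc k)))"

definition H_norm :: "real \<Rightarrow> (real \<Rightarrow> complex) \<Rightarrow> real" where
  "H_norm \<alpha> f = sqrt (Re (H_inner \<alpha> f f))"

text \<open>
  Schauder basis of the space obtained from the complex function space \<open>V\<close> by identifying functions
  at \<open>N\<close>-distance zero, where \<open>N\<close> is a seminorm on \<open>V\<close>.
\<close>
definition schauder_basis ::
  "('a \<Rightarrow> complex) set \<Rightarrow> (('a \<Rightarrow> complex) \<Rightarrow> real) \<Rightarrow> (nat \<Rightarrow> 'a \<Rightarrow> complex) \<Rightarrow> bool" where
  "schauder_basis V N e \<longleftrightarrow>
     (\<forall>k. e k \<in> V) \<and>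
     (\<forall>f\<in>V. \<exists>!c::nat \<Rightarrow> complex.
        (\<lambda>m. N (\<lambda>x. f x - (\<Sum>k<m. c k * e k x))) \<longlonglongrightarrow> 0)"

definition s_fun :: "real \<Rightarrow> real \<Rightarrow> real" where
  "s_fun \<alpha> q = (\<Sum>l. real (2 * l + 1) powr \<alpha> * ((1 - q) * q ^ l / (1 - q ^ (2 * l + 1))))"

definition r0 :: "real \<Rightarrow> real" where
  "r0 \<alpha> = (THE q. q \<in> {0<..<1} \<and> s_fun \<alpha> q = 2)"

text \<open>Sequences are indexed from 1; the entry at index 0 is irrelevant.\<close>
definition T0 :: "real \<Rightarrow> (nat \<Rightarrow> real) set" where
  "T0 \<alpha> = {q. (\<forall>n\<ge>1. q n \<in> {0<..<1}) \<and> (SUP n\<in>{1..}. q n) < r0 \<alpha>}"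

end

theory Submission
  imports Defs "HOL-Real_Asymp.Real_Asymp"
begin

text \<open>
  The Fourier series of \<open>sn\<close> comes without contour integrals. For \<open>\<theta> > 0\<close> put
  \<open>S(z) = \<Sum> e^{inz} / sinh(n\<theta>)\<close> and \<open>C(z) = \<Sum> e^{inz} / cosh(n\<theta>)\<close> over the odd integers and
  \<open>D(z) = \<Sum> e^{inz} / cosh(n\<theta>)\<close> over the even ones. By the addition theorems of the hyperbolic functions
  the convolutions of the coefficients telescope, whence \<open>S' = iCD\<close>, \<open>C' = iSD\<close>, \<open>D' = iSC\<close> on the strip
  \<open>|Im z| < \<theta>\<close>. So on the real axis \<open>-iS\<close> is a rescaled \<open>sn\<close>, whose quarter period is \<open>\<pi>/2\<close>; on the
  imaginary axis \<open>S\<close> is real and first becomes infinite at \<open>i\<theta>\<close>. Up to the same scaling factor these two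
  numbers are \<open>K\<close> and \<open>K'\<close>, so the nome is \<open>exp(-2\<theta>)\<close>; since \<open>K\<close> is strictly increasing in the modulus,
  every modulus arises in this way from its own nome.

  Hence the normalised eigenfunctions are \<open>\<Sum> c_l(q_n) sin((2l+1)n\<pi>x)\<close> with
  \<open>c_l(q) = (1-q) q^l / (1-q^{2l+1})\<close>. In the sine coefficients they are the columns of \<open>I + P\<close>, where \<open>P\<close> is
  strictly triangular for divisibility and, by Schur's test, of norm at most \<open>s_\<alpha>(sup q_n) - 1 < 1\<close> on the
  weighted \<open>\<ell>\<^sup>2\<close> space. Triangularity solves \<open>(I + P) y = x\<close> uniquely among all sequences, and since it lets
  truncations pass through \<open>P\<close>, the norm bound puts \<open>y\<close> in \<open>\<ell>\<^sup>2\<close> whenever \<open>x\<close> is.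
\<close>

section \<open>Fourier series with exponentially decaying coefficients\<close>

text \<open>The obstacle is that \<open>jacobi_sn\<close> is the inverse of an integral, while the
  basis argument consumes Fourier coefficients expressed in the nome, and the nome involves two
  complete integrals. The series supply both: their differential system identifies the inverse
  function on the real axis, and the same system on the imaginary axis measures the complementary
  integral by the place of blow-up. The threshold 2 in \<open>r0\<close> is 1 + 1: the term l = 0 of
  \<open>s_fun\<close> is the diagonal of the matrix and equals 1 for every nome, and the remaining
  terms bound the off-diagonal part, whose norm has to stay below 1. The weight (2l+1)^\<alpha>
  arises because row and column of an entry differ by the factor 2l+1, so conjugation with the
  diagonal n^\<alpha> multiplies the entry by (2l+1)^\<alpha>. The remainder of an expansion is
  again a function with known sine coefficients, so existence and uniqueness of expansions in
  H^\<alpha> are statements about square-summable sequences.\<close>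

lemma int_sums_nat:
  fixes f :: "int \<Rightarrow> 'a::banach"
  assumes "f summable_on UNIV"
  shows "(\<lambda>n. f (int n) + f (- int n - 1)) sums infsum f UNIV"
proof -
  have P: "f summable_on range int" and N: "f summable_on range (\<lambda>n. - int n - 1)"
    using assms summable_on_subset_banach by blast+
  have U: "range int \<union> range (\<lambda>n. - int n - 1) = UNIV"
  proof -
    have "x \<in> range int \<union> range (\<lambda>n. - int n - 1)" for x
    proof (cases "x \<ge> 0")
      case True
      then show ?thesis by (metis UnI1 nonneg_int_cases rangeI)
    next
      case False
      then have "x = - int (nat (- x - 1)) - 1" by simp
      then show ?thesis by blast
    qed
    then show ?thesis by blast
  qed
  have inj: "inj (\<lambda>n. - int n - 1)" by (auto simp: inj_def)
  have "((f \<circ> int) has_sum infsum f (range int)) UNIV"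
    using has_sum_infsum[OF P] has_sum_reindex[of int UNIV f] by (simp add: inj_on_def)
  moreover have "((f \<circ> (\<lambda>n. - int n - 1)) has_sum infsum f (range (\<lambda>n. - int n - 1))) UNIV"
    using has_sum_infsum[OF N] has_sum_reindex[OF inj, of f] by simp
  ultimately have "((\<lambda>n. f (int n) + f (- int n - 1)) has_sum
      infsum f (range int) + infsum f (range (\<lambda>n. - int n - 1))) UNIV"
    using has_sum_add by (fastforce simp: o_def)
  moreover have "infsum f (range int) + infsum f (range (\<lambda>n. - int n - 1)) = infsum f UNIV"
    using infsum_Un_disjoint[OF P N] U by fastforce
  ultimately show ?thesis by (simp add: has_sum_imp_sums)
qed

lemma summable_on_int_even_nonneg:
  fixes f :: "int \<Rightarrow> real"
  assumes "\<And>n. 0 \<le> f n" "\<And>n. f (- n) = f n" "summable (\<lambda>n. f (int n))"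
  shows "f summable_on UNIV"
proof -
  have P: "(\<lambda>n. f (int n)) summable_on UNIV"
    using assms by (simp add: summable_on_UNIV_nonneg_real_iff)
  then have "f summable_on range int"
    using summable_on_reindex[of int UNIV f] by (simp add: inj_on_def o_def)
  moreover have "f summable_on range (\<lambda>n. - int n)"
    using P summable_on_reindex[of "\<lambda>n. - int n" UNIV f] by (simp add: inj_on_def o_def assms)
  ultimately have "f summable_on (range int \<union> range (\<lambda>n. - int n))"
    by (rule summable_on_union)
  moreover have "range int \<union> range (\<lambda>n. - int n) = UNIV"
  proof -
    have "n \<in> range int \<union> range (\<lambda>n. - int n)" for n
      by (cases n rule: int_cases2) auto
    then show ?thesis by blast
  qed
  ultimately show ?thesis by simp
qed

lemma summable_on_exp_abs_int:
  fixes c :: real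
  assumes "c > 0"
  shows "(\<lambda>n::int. exp (- (real_of_int \<bar>n\<bar> * c))) summable_on UNIV"
proof (rule summable_on_int_even_nonneg)
  have "(\<lambda>n. exp (- (real_of_int \<bar>int n\<bar> * c))) = (\<lambda>n. exp (- c) ^ n)"
    using exp_of_nat_mult[of _ "- c"] by (intro ext) simp
  then show "summable (\<lambda>n. exp (- (real_of_int \<bar>int n\<bar> * c)))"
    using assms by (simp add: summable_geometric)
qed auto

text \<open>Absolute convergence on every closed strip inside \<open>|Im z| < \<theta>\<close>.
  Quantifying over all \<open>y < \<theta>\<close>, instead of bounding \<open>a n\<close> by a
  multiple of \<open>exp (- |n| * \<theta>)\<close>, leaves the spare room that makes the class
  stable under differentiation.\<close>

definition exp_decay :: "real \<Rightarrow> (int \<Rightarrow> complex) \<Rightarrow> bool" where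
  "exp_decay \<theta> a \<longleftrightarrow> (\<forall>y<\<theta>. (\<lambda>n. norm (a n) * exp (real_of_int \<bar>n\<bar> * y)) summable_on UNIV)"

definition trig_ser :: "(int \<Rightarrow> complex) \<Rightarrow> complex \<Rightarrow> complex" where
  "trig_ser a z = (\<Sum>\<^sub>\<infinity>n. a n * exp (\<i> * of_int n * z))"

lemma norm_exp_int_le: "norm (exp (\<i> * of_int n * z)) \<le> exp (real_of_int \<bar>n\<bar> * \<bar>Im z\<bar>)"
proof -
  have "- (real_of_int n * Im z) \<le> \<bar>real_of_int n\<bar> * \<bar>Im z\<bar>"
    by (metis abs_ge_minus_self abs_mult)
  then show ?thesis by simp
qed

lemma exp_decayI:
  assumes "\<And>n. norm (a n) \<le> M * exp (- (real_of_int \<bar>n\<bar> * \<theta>))"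
  shows "exp_decay \<theta> a"
  unfolding exp_decay_def
proof (intro allI impI)
  fix y assume y: "y < \<theta>"
  show "(\<lambda>n. norm (a n) * exp (real_of_int \<bar>n\<bar> * y)) summable_on UNIV"
  proof (rule summable_on_comparison_test)
    show "(\<lambda>n::int. M * exp (- (real_of_int \<bar>n\<bar> * (\<theta> - y)))) summable_on UNIV"
      using y by (intro summable_on_cmult_right summable_on_exp_abs_int) simp
    fix n :: int
    have "norm (a n) * exp (real_of_int \<bar>n\<bar> * y)
        \<le> M * exp (- (real_of_int \<bar>n\<bar> * \<theta>)) * exp (real_of_int \<bar>n\<bar> * y)"
      using assms by (intro mult_right_mono) auto
    also have "\<dots> = M * exp (- (real_of_int \<bar>n\<bar> * (\<theta> - y)))"
      by (simp add: mult.assoc mult_exp_exp algebra_simps)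
    finally show "norm (a n) * exp (real_of_int \<bar>n\<bar> * y) \<le> M * exp (- (real_of_int \<bar>n\<bar> * (\<theta> - y)))" .
  qed auto
qed

text \<open>The factor \<open>|n|\<close> is at most \<open>exp (|n| * e) / e\<close>, and the gap
  between \<open>y\<close> and \<open>\<theta>\<close> leaves room to raise the exponent by
  \<open>e\<close>.\<close>

lemma exp_decay_deriv:
  assumes "exp_decay \<theta> a"
  shows "exp_decay \<theta> (\<lambda>n. \<i> * of_int n * a n)"
  unfolding exp_decay_def
proof (intro allI impI)
  fix y assume y: "y < \<theta>"
  define e where "e = (\<theta> - y) / 2"
  have e: "e > 0" "y + e < \<theta>" using y by (auto simp: e_def field_simps)
  show "(\<lambda>n. norm (\<i> * of_int n * a n) * exp (real_of_int \<bar>n\<bar> * y)) summable_on UNIV"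
  proof (rule summable_on_comparison_test)
    show "(\<lambda>n. (1 / e) * (norm (a n) * exp (real_of_int \<bar>n\<bar> * (y + e)))) summable_on UNIV"
      using assms e(2) unfolding exp_decay_def by (intro summable_on_cmult_right) blast
    fix n :: int
    have "1 + \<bar>real_of_int n\<bar> * e \<le> exp (\<bar>real_of_int n\<bar> * e)" by simp
    then have "\<bar>real_of_int n\<bar> * e \<le> exp (\<bar>real_of_int n\<bar> * e)" by linarith
    then have "\<bar>real_of_int n\<bar> \<le> (1 / e) * exp (\<bar>real_of_int n\<bar> * e)"
      using e by (simp add: field_simps)
    then have "\<bar>real_of_int n\<bar> * (norm (a n) * exp (real_of_int \<bar>n\<bar> * y))
      \<le> (1 / e) * exp (\<bar>real_of_int n\<bar> * e) * (norm (a n) * exp (real_of_int \<bar>n\<bar> * y))"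
      by (intro mult_right_mono) auto
    also have "\<dots> = (1 / e) * (norm (a n) * exp (real_of_int \<bar>n\<bar> * (y + e)))"
      by (simp add: distrib_left exp_add)
    finally show "norm (\<i> * of_int n * a n) * exp (real_of_int \<bar>n\<bar> * y)
        \<le> (1 / e) * (norm (a n) * exp (real_of_int \<bar>n\<bar> * (y + e)))"
      by (simp add: norm_mult mult_ac)
  qed auto
qed

lemma trig_ser_summable:
  assumes "exp_decay \<theta> a" "\<bar>Im z\<bar> < \<theta>"
  shows "(\<lambda>n. norm (a n * exp (\<i> * of_int n * z))) summable_on UNIV"
proof (rule Infinite_Sum.abs_summable_on_comparison_test')
  show "(\<lambda>n. norm (a n) * exp (real_of_int \<bar>n\<bar> * \<bar>Im z\<bar>)) summable_on UNIV"
    using assms unfolding exp_decay_def by blast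
  fix n :: int
  show "norm (a n * exp (\<i> * of_int n * z)) \<le> norm (a n) * exp (real_of_int \<bar>n\<bar> * \<bar>Im z\<bar>)"
    unfolding norm_mult by (intro mult_left_mono norm_exp_int_le) auto
qed

text \<open>Termwise differentiation on a strip whose half-width \<open>y\<close> lies strictly
  between \<open>|Im z|\<close> and \<open>\<theta>\<close>; there the M-test applies to the derived
  series with its majorant at height \<open>y\<close>. The terms \<open>n\<close> and
  \<open>- n - 1\<close> are paired so that theorems on series over the naturals apply.\<close>

lemma trig_ser_deriv:
  assumes a: "exp_decay \<theta> a" and z: "\<bar>Im z\<bar> < \<theta>"
  shows "(trig_ser a has_field_derivative trig_ser (\<lambda>n. \<i> * of_int n * a n) z) (at z)"
proof -
  define y where "y = (\<bar>Im z\<bar> + \<theta>) / 2"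
  have y: "\<bar>Im z\<bar> < y" "y < \<theta>" using z by (auto simp: y_def)
  define S where "S = {w. Im w < y} \<inter> {w. Im w > - y}"
  have S: "convex S" "open S"
    unfolding S_def by (intro convex_Int convex_halfspace_Im_lt convex_halfspace_Im_gt
        open_Int open_halfspace_Im_lt open_halfspace_Im_gt)+
  have zS: "z \<in> S" using y by (auto simp: S_def)
  define t where "t = (\<lambda>b w n. b n * exp (\<i> * of_int n * w) :: complex)"
  define p where "p = (\<lambda>b (k::nat) w. t b w (int k) + t b w (- int k - 1))"
  define b where "b = (\<lambda>n. \<i> * of_int n * a n)"
  have b: "exp_decay \<theta> b" unfolding b_def by (rule exp_decay_deriv[OF a])
  have sums: "(\<lambda>k. p c k w) sums trig_ser c w" if "exp_decay \<theta> c" "w \<in> S" for c w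
  proof -
    have "\<bar>Im w\<bar> < \<theta>" using that y by (auto simp: S_def)
    then show ?thesis
      unfolding p_def trig_ser_def t_def
      using int_sums_nat[OF abs_summable_summable[OF trig_ser_summable[OF that(1)]]] by blast
  qed
  define m where "m = (\<lambda>n. norm (b n) * exp (real_of_int \<bar>n\<bar> * y))"
  have msum: "summable (\<lambda>k. m (int k) + m (- int k - 1))"
    using int_sums_nat[of m] b y(2) unfolding exp_decay_def m_def by (auto simp: sums_iff)
  have tm: "norm (t b w n) \<le> m n" if "w \<in> S" for w n
  proof -
    have "\<bar>Im w\<bar> \<le> y" using that by (auto simp: S_def)
    then have "real_of_int \<bar>n\<bar> * \<bar>Im w\<bar> \<le> real_of_int \<bar>n\<bar> * y"
      by (intro mult_left_mono) auto
    then have "norm (exp (\<i> * of_int n * w)) \<le> exp (real_of_int \<bar>n\<bar> * y)"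
      using norm_exp_int_le[of n w] by (meson exp_le_cancel_iff order_trans)
    then show ?thesis unfolding t_def m_def norm_mult by (intro mult_left_mono) auto
  qed
  have "uniformly_convergent_on S (\<lambda>n w. \<Sum>i<n. p b i w)"
  proof (rule Weierstrass_m_test'[OF _ msum])
    fix k w assume "w \<in> S"
    then show "norm (p b k w) \<le> m (int k) + m (- int k - 1)"
      unfolding p_def by (intro norm_triangle_mono tm)
  qed
  moreover have "(p a k has_field_derivative p b k w) (at w within S)" for k w
    unfolding p_def t_def b_def by (auto intro!: derivative_eq_intros simp: algebra_simps)
  ultimately have "((\<lambda>w. \<Sum>k. p a k w) has_field_derivative (\<Sum>k. p b k z)) (at z)"
    using has_field_derivative_series'(2)[OF S(1), of "p a" "p b" z z] sums[OF a zS] zS S(2)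
    by (auto simp: sums_iff interior_open)
  moreover have "(\<Sum>k. p b k z) = trig_ser b z" using sums[OF b zS] by (simp add: sums_iff)
  moreover have "\<forall>\<^sub>F w in nhds z. (\<Sum>k. p a k w) = trig_ser a w"
    using eventually_nhds_in_open[OF S(2) zS]
    by eventually_elim (use sums[OF a] in \<open>simp add: sums_iff\<close>)
  ultimately show ?thesis
    unfolding b_def by (simp add: DERIV_cong_ev)
qed

text \<open>Fubini, applied twice to the absolutely summable double family \<open>f j * g k\<close>:
  once as it stands and once reindexed by \<open>n = j + k\<close>.\<close>

lemma infsum_int_convolution:
  fixes f g :: "int \<Rightarrow> complex"
  assumes f: "(\<lambda>j. norm (f j)) summable_on UNIV" and g: "(\<lambda>j. norm (g j)) summable_on UNIV"
  shows "infsum f UNIV * infsum g UNIV = (\<Sum>\<^sub>\<infinity>n. \<Sum>\<^sub>\<infinity>j. f j * g (n - j))"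
    and "(\<lambda>j. f j * g (n - j)) summable_on UNIV"
proof -
  define F where "F = (\<lambda>(j, k). f j * g k)"
  have "(\<lambda>p. norm (F p)) summable_on UNIV \<times> UNIV"
    using f g unfolding F_def
    by (intro summable_on_SigmaI[where g = "\<lambda>j. norm (f j) * (\<Sum>\<^sub>\<infinity>k. norm (g k))"])
      (auto simp: norm_mult intro!: has_sum_cmult_right summable_on_cmult_left)
  then have F: "F summable_on UNIV \<times> UNIV" by (rule abs_summable_summable)
  have H: "(\<lambda>(n, j). f j * g (n - j)) summable_on UNIV \<times> UNIV"
      "(\<Sum>\<^sub>\<infinity>(n, j)\<in>UNIV \<times> UNIV. f j * g (n - j)) = infsum F (UNIV \<times> UNIV)"
    using F
      summable_on_reindex_bij_witness[of "UNIV \<times> UNIV" "\<lambda>(j, k). (j + k, j)"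
        "\<lambda>(n, j). (j, n - j)" "UNIV \<times> UNIV" F "\<lambda>(n, j). f j * g (n - j)"]
      infsum_reindex_bij_witness[of "UNIV \<times> UNIV" "\<lambda>(j, k). (j + k, j)"
        "\<lambda>(n, j). (j, n - j)" "UNIV \<times> UNIV" F "\<lambda>(n, j). f j * g (n - j)"]
    by (auto simp: F_def)
  have "(\<Sum>\<^sub>\<infinity>n. \<Sum>\<^sub>\<infinity>j. f j * g (n - j)) = infsum F (UNIV \<times> UNIV)"
    using infsum_Sigma_banach[OF H(1)] H(2) by simp
  also have "\<dots> = (\<Sum>\<^sub>\<infinity>j. \<Sum>\<^sub>\<infinity>k. f j * g k)"
    using infsum_Sigma_banach[OF F] by (simp add: F_def)
  also have "\<dots> = infsum f UNIV * infsum g UNIV"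
    by (simp add: infsum_cmult_right' infsum_cmult_left')
  finally show "infsum f UNIV * infsum g UNIV = (\<Sum>\<^sub>\<infinity>n. \<Sum>\<^sub>\<infinity>j. f j * g (n - j))" ..
  show "(\<lambda>j. f j * g (n - j)) summable_on UNIV"
    using summable_on_SigmaD1[OF H(1), of n] by simp
qed

lemma trig_ser_mult:
  assumes a: "exp_decay \<theta> a" and b: "exp_decay \<theta> b" and z: "\<bar>Im z\<bar> < \<theta>"
  shows "trig_ser a z * trig_ser b z = trig_ser (\<lambda>n. \<Sum>\<^sub>\<infinity>j. a j * b (n - j)) z"
proof -
  have "a j * exp (\<i> * of_int j * z) * (b (n - j) * exp (\<i> * of_int (n - j) * z))
      = a j * b (n - j) * exp (\<i> * of_int n * z)" for j n
  proof -
    have "exp (\<i> * of_int j * z) * exp (\<i> * of_int (n - j) * z) = exp (\<i> * of_int n * z)"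
      unfolding mult_exp_exp by (simp add: algebra_simps)
    then show ?thesis by (metis (no_types, lifting) mult.assoc mult.left_commute)
  qed
  then show ?thesis
    using infsum_int_convolution(1)[OF trig_ser_summable[OF a z] trig_ser_summable[OF b z]]
    by (simp only: trig_ser_def infsum_cmult_left')
qed

lemma trig_ser_convolution_summable:
  assumes a: "exp_decay \<theta> a" and b: "exp_decay \<theta> b" and "0 < \<theta>"
  shows "(\<lambda>j. a j * b (n - j)) summable_on UNIV"
  using infsum_int_convolution(2)[OF trig_ser_summable[OF a, of 0] trig_ser_summable[OF b, of 0], of n]
    assms(3) by simp

lemma has_sum_telescope_int:
  fixes h :: "int \<Rightarrow> real"
  assumes s: "(\<lambda>p. h (p + 1) - h p) summable_on UNIV"
    and P: "(\<lambda>n. h (int n)) \<longlonglongrightarrow> L" and N: "(\<lambda>n. h (- int n)) \<longlonglongrightarrow> M"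
  shows "(\<Sum>\<^sub>\<infinity>p. h (p + 1) - h p) = L - M"
proof -
  have "(\<Sum>n<k. h (int n + 1) - h (int n) + (h (- int n - 1 + 1) - h (- int n - 1)))
      = h (int k) - h (- int k)" for k
  proof (induction k)
    case (Suc k)
    have "h (- int k - 1) = h (- int (Suc k))" "h (int k + 1) = h (int (Suc k))"
      by (auto intro!: arg_cong[where f = h])
    then show ?case using Suc by (simp del: of_nat_Suc)
  qed simp
  then have "(\<lambda>k. h (int k) - h (- int k)) \<longlonglongrightarrow> (\<Sum>\<^sub>\<infinity>p. h (p + 1) - h p)"
    using int_sums_nat[OF s] by (simp add: sums_def)
  moreover have "(\<lambda>k. h (int k) - h (- int k)) \<longlonglongrightarrow> L - M"
    by (intro tendsto_intros P N)
  ultimately show ?thesis by (rule LIMSEQ_unique)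
qed

lemma infsum_odd_int:
  fixes f :: "int \<Rightarrow> 'a::banach"
  assumes "\<And>j. even j \<Longrightarrow> f j = 0"
  shows "infsum f UNIV = (\<Sum>\<^sub>\<infinity>p. f (2 * p + 1))"
    and "f summable_on UNIV \<longleftrightarrow> (\<lambda>p. f (2 * p + 1)) summable_on UNIV"
proof -
  have inj: "inj (\<lambda>p::int. 2 * p + 1)" by (auto simp: inj_def)
  have z: "f j = 0" if "j \<notin> range (\<lambda>p. 2 * p + 1)" for j
    using that assms by (metis oddE rangeI)
  have "infsum f UNIV = infsum f (range (\<lambda>p. 2 * p + 1))"
    by (rule infsum_cong_neutral) (use z in auto)
  then show "infsum f UNIV = (\<Sum>\<^sub>\<infinity>p. f (2 * p + 1))"
    using infsum_reindex[OF inj, of f] by (simp add: o_def)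
  have "f summable_on UNIV \<longleftrightarrow> f summable_on (range (\<lambda>p. 2 * p + 1))"
    by (rule summable_on_cong_neutral) (use z in auto)
  then show "f summable_on UNIV \<longleftrightarrow> (\<lambda>p. f (2 * p + 1)) summable_on UNIV"
    using summable_on_reindex[OF inj, of f] by (simp add: o_def)
qed

text \<open>Calling the left-hand side \<open>T(2m + e)\<close>, telescoping gives \<open>T(n + 2) - T(n) = 2\<close>, and \<open>T\<close> is odd.\<close>
lemma infsum_addition_tanh:
  fixes A :: "int \<Rightarrow> real"
  assumes \<theta>: "0 < \<theta>" and A: "\<And>j. A (- j) = - A j" and e: "e = 0 \<or> e = 1"
    and sum: "\<And>m. (\<lambda>p. A (2 * p + 1) + tanh (real_of_int (2 * m + e - (2 * p + 1)) * \<theta>)) summable_on UNIV"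
  shows "(\<Sum>\<^sub>\<infinity>p. A (2 * p + 1) + tanh (real_of_int (2 * m + e - (2 * p + 1)) * \<theta>)) = of_int (2 * m + e)"
proof -
  define T where "T = (\<lambda>n. \<Sum>\<^sub>\<infinity>p. A (2 * p + 1) + tanh (real_of_int (n - (2 * p + 1)) * \<theta>))"
  have neg: "T (- n) = - T n" for n
  proof -
    have "T (- n) = (\<Sum>\<^sub>\<infinity>p. - (A (2 * p + 1) + tanh (real_of_int (n - (2 * p + 1)) * \<theta>)))"
      unfolding T_def
    proof (rule infsum_reindex_bij_witness[of UNIV "\<lambda>p. - p - 1" "\<lambda>p. - p - 1"])
      fix p :: int
      have "A (2 * (- p - 1) + 1) = - A (2 * p + 1)"
        using A[of "2 * p + 1"] by (simp add: algebra_simps)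
      moreover have "tanh (real_of_int (n - (2 * (- p - 1) + 1)) * \<theta>)
          = - tanh (real_of_int (- n - (2 * p + 1)) * \<theta>)"
        unfolding tanh_minus[symmetric] by (simp add: algebra_simps)
      ultimately show "- (A (2 * (- p - 1) + 1) + tanh (real_of_int (n - (2 * (- p - 1) + 1)) * \<theta>))
          = A (2 * p + 1) + tanh (real_of_int (- n - (2 * p + 1)) * \<theta>)" by simp
    qed auto
    then show ?thesis unfolding T_def by (simp only: infsum_uminus)
  qed
  have step: "T (2 * m + e + 2) = T (2 * m + e) + 2" for m
  proof -
    define n where "n = 2 * m + e"
    \<comment> \<open>In \<open>T (n + 2) - T n\<close> the terms with \<open>A\<close> cancel.
      After the substitution of \<open>- p\<close> for \<open>p\<close>, what remains are the
      increments of \<open>h\<close>, which tends to 1 and - 1 at the two ends.\<close>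
    define h where "h = (\<lambda>p. tanh (real_of_int (n - 1 + 2 * p) * \<theta>))"
    let ?f = "\<lambda>n p. A (2 * p + 1) + tanh (real_of_int (n - (2 * p + 1)) * \<theta>)"
    have s: "?f (n + 2) summable_on UNIV" "?f n summable_on UNIV"
      using sum[of "m + 1"] sum[of m] by (simp_all add: n_def algebra_simps)
    have "T (n + 2) - T n = (\<Sum>\<^sub>\<infinity>p. ?f (n + 2) p - ?f n p)"
      unfolding T_def using infsum_add[OF s(1) summable_on_uminus[THEN iffD2, OF s(2)]]
      by (simp only: infsum_uminus diff_conv_add_uminus)
    also have "\<dots> = (\<Sum>\<^sub>\<infinity>p. h (p + 1) - h p)"
      by (rule infsum_reindex_bij_witness[of UNIV "\<lambda>p. - p" "\<lambda>p. - p"])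
        (auto simp: h_def algebra_simps)
    also have "\<dots> = 1 - (- 1)"
    proof (rule has_sum_telescope_int)
      have "(\<lambda>p. ?f (n + 2) p - ?f n p) summable_on UNIV"
        using summable_on_add[OF s(1) summable_on_uminus[THEN iffD2, OF s(2)]] by simp
      also have "?this \<longleftrightarrow> (\<lambda>p. h (p + 1) - h p) summable_on UNIV"
        by (rule summable_on_reindex_bij_witness[of UNIV "\<lambda>p. - p" "\<lambda>p. - p"])
          (auto simp: h_def algebra_simps)
      finally show "(\<lambda>p. h (p + 1) - h p) summable_on UNIV" .
      have "filterlim (\<lambda>k. \<theta> * of_int (n - 1) + (2 * \<theta>) * real k) at_top sequentially"
        using \<theta> by (intro filterlim_tendsto_add_at_top[OF tendsto_const]
            filterlim_tendsto_pos_mult_at_top[OF tendsto_const _ filterlim_real_sequentially]) auto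
      then show "(\<lambda>k. h (int k)) \<longlonglongrightarrow> 1"
        unfolding h_def by (intro filterlim_compose[OF tanh_real_at_top])
          (simp add: algebra_simps)
      have "filterlim (\<lambda>k. - \<theta> * of_int (n - 1) + (2 * \<theta>) * real k) at_top sequentially"
        using \<theta> by (intro filterlim_tendsto_add_at_top[OF tendsto_const]
            filterlim_tendsto_pos_mult_at_top[OF tendsto_const _ filterlim_real_sequentially]) auto
      then have "filterlim (\<lambda>k. real_of_int (n - 1 + 2 * - int k) * \<theta>) at_bot sequentially"
        unfolding filterlim_uminus_at_bot by (simp add: algebra_simps)
      then show "(\<lambda>k. h (- int k)) \<longlonglongrightarrow> - 1"
        unfolding h_def by (intro filterlim_compose[OF tanh_real_at_bot])
    qed
    finally show ?thesis by (simp add: n_def)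
  qed
  \<comment> \<open>Oddness gives \<open>T 0 = 0\<close>, and together with one step
    \<open>T 1 = T (- 1) + 2 = 2 - T 1\<close>, so \<open>T 1 = 1\<close>.\<close>
  have T0: "T e = of_int e"
    using e neg[of 0] neg[of 1] step[of "- 1"] by auto
  have nonneg: "T (2 * int k + e) = of_int (2 * int k + e)" for k
  proof (induction k)
    case 0
    then show ?case using T0 by simp
  next
    case (Suc k)
    then show ?case using step[of "int k"] by (simp add: algebra_simps)
  qed
  have "T (2 * m + e) = of_int (2 * m + e)"
  proof (cases "m \<ge> 0")
    case True
    then show ?thesis using nonneg[of "nat m"] by simp
  next
    case False
    \<comment> \<open>Here \<open>- (2 * m + e) = 2 * (- m - e) + e\<close> with
      \<open>- m - e \<ge> 0\<close>, so the parity class is kept and oddness finishes the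
      argument.\<close>
    then have "T (- (2 * m + e)) = of_int (- (2 * m + e))"
      using nonneg[of "nat (- m - e)"] e by (auto simp: algebra_simps)
    then show ?thesis using neg[of "2 * m + e"] by simp
  qed
  then show ?thesis by (simp add: T_def)
qed

section \<open>The series of sn, cn and dn\<close>

definition sn_coeff :: "real \<Rightarrow> int \<Rightarrow> real" where
  "sn_coeff \<theta> n = (if odd n then 1 / sinh (real_of_int n * \<theta>) else 0)"

definition cn_coeff :: "real \<Rightarrow> int \<Rightarrow> real" where
  "cn_coeff \<theta> n = (if odd n then 1 / cosh (real_of_int n * \<theta>) else 0)"

definition dn_coeff :: "real \<Rightarrow> int \<Rightarrow> real" where
  "dn_coeff \<theta> n = (if even n then 1 / cosh (real_of_int n * \<theta>) else 0)"

lemma cosh_ge_exp_abs: "exp \<bar>x\<bar> \<le> 2 * cosh (x::real)"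
  by (cases "x \<ge> 0") (auto simp: cosh_def)

lemma exp_decay_cosh_coeff:
  shows "exp_decay \<theta> (\<lambda>n. of_real (cn_coeff \<theta> n))" and "exp_decay \<theta> (\<lambda>n. of_real (dn_coeff \<theta> n))"
proof -
  have "1 / cosh (real_of_int n * \<theta>) \<le> 2 * exp (- (real_of_int \<bar>n\<bar> * \<theta>))" for n
  proof -
    have "exp (real_of_int \<bar>n\<bar> * \<theta>) \<le> 2 * cosh (real_of_int n * \<theta>)"
      by (rule order_trans[OF _ cosh_ge_exp_abs])
        (auto simp: abs_mult intro!: mult_left_mono)
    then show ?thesis by (simp add: exp_minus field_simps)
  qed
  then show "exp_decay \<theta> (\<lambda>n. of_real (cn_coeff \<theta> n))" "exp_decay \<theta> (\<lambda>n. of_real (dn_coeff \<theta> n))"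
    by (auto intro!: exp_decayI[where M = 2] simp: cn_coeff_def dn_coeff_def)
qed

text \<open>Away from 0, \<open>sinh\<close> is comparable with the exponential. It is used with
  \<open>c = \<theta>\<close>, the distance of the points \<open>n * \<theta>\<close>,
  \<open>n\<close> odd, from 0.\<close>

lemma abs_sinh_ge:
  fixes x :: real
  assumes "0 < c" "c \<le> \<bar>x\<bar>"
  shows "exp \<bar>x\<bar> * (1 - exp (- 2 * c)) \<le> 2 * \<bar>sinh x\<bar>"
proof -
  have "2 * \<bar>sinh x\<bar> = exp \<bar>x\<bar> - exp (- \<bar>x\<bar>)"
    using sinh_real_abs[of x] by (simp add: sinh_def)
  moreover have "exp (- \<bar>x\<bar>) \<le> exp \<bar>x\<bar> * exp (- 2 * c)"
    using assms unfolding mult_exp_exp by simp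
  ultimately show ?thesis by (simp add: algebra_simps)
qed

lemma exp_decay_sinh_coeff:
  assumes "0 < \<theta>"
  shows "exp_decay \<theta> (\<lambda>n. of_real (sn_coeff \<theta> n))"
proof (rule exp_decayI)
  fix n :: int
  define d where "d = 1 - exp (- 2 * \<theta>)"
  have d: "d > 0" using assms by (simp add: d_def)
  show "norm (complex_of_real (sn_coeff \<theta> n)) \<le> 2 / d * exp (- (real_of_int \<bar>n\<bar> * \<theta>))"
  proof (cases "odd n")
    case True
    then have "1 \<le> \<bar>n\<bar>" by presburger
    then have "1 \<le> \<bar>real_of_int n\<bar>" by linarith
    then have "\<theta> \<le> \<bar>real_of_int n * \<theta>\<bar>"
      using assms by (simp add: abs_mult mult_le_cancel_right1)
    from abs_sinh_ge[OF assms this]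
    have "exp (real_of_int \<bar>n\<bar> * \<theta>) * d \<le> 2 * \<bar>sinh (real_of_int n * \<theta>)\<bar>"
      using assms by (simp add: d_def abs_mult)
    moreover have "0 < exp (real_of_int \<bar>n\<bar> * \<theta>) * d" using d by simp
    moreover have "1 / x \<le> 2 / y" if "y \<le> 2 * x" "0 < y" for x y :: real
      using that by (simp add: field_simps)
    ultimately have "1 / \<bar>sinh (real_of_int n * \<theta>)\<bar> \<le> 2 / (exp (real_of_int \<bar>n\<bar> * \<theta>) * d)"
      by blast
    then show ?thesis using True
      by (simp add: sn_coeff_def exp_minus field_simps norm_divide)
  qed (use d in \<open>simp add: sn_coeff_def\<close>)
qed

lemma convolution_of_real:
  fixes a b :: "int \<Rightarrow> real"
  assumes "(\<lambda>j. complex_of_real (a j) * of_real (b (n - j))) summable_on UNIV"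
  shows "(\<lambda>j. a j * b (n - j)) summable_on UNIV"
    and "(\<Sum>\<^sub>\<infinity>j. complex_of_real (a j) * of_real (b (n - j))) = of_real (\<Sum>\<^sub>\<infinity>j. a j * b (n - j))"
proof -
  have "(\<lambda>j. Re (complex_of_real (a j) * of_real (b (n - j)))) summable_on UNIV"
    using assms by (rule summable_on_Re)
  then show s: "(\<lambda>j. a j * b (n - j)) summable_on UNIV" by simp
  show "(\<Sum>\<^sub>\<infinity>j. complex_of_real (a j) * of_real (b (n - j))) = of_real (\<Sum>\<^sub>\<infinity>j. a j * b (n - j))"
    using has_sum_of_real[OF has_sum_infsum[OF s], where 'a = complex]
    by (simp add: infsumI)
qed

text \<open>The addition theorems of \<open>sinh\<close> and \<open>cosh\<close> turn each convolution into a telescoping sum.\<close>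
lemma coeff_convolution:
  fixes a b :: "int \<Rightarrow> real"
  assumes \<theta>: "0 < \<theta>" and e: "e = 0 \<or> e = 1" and A: "\<And>j. A (- j) = - A j"
    and da: "exp_decay \<theta> (\<lambda>n. of_real (a n))" and db: "exp_decay \<theta> (\<lambda>n. of_real (b n))"
    and ev: "\<And>j. even j \<Longrightarrow> a j = 0"
    and E: "\<And>m. E (2 * m + e) \<noteq> 0"
    and add: "\<And>p m. a (2 * p + 1) * b (2 * m + e - (2 * p + 1)) * E (2 * m + e)
       = A (2 * p + 1) + tanh (real_of_int (2 * m + e - (2 * p + 1)) * \<theta>)"
  shows "(\<Sum>\<^sub>\<infinity>j. complex_of_real (a j) * of_real (b (2 * m + e - j)))
     = of_real (of_int (2 * m + e) / E (2 * m + e))"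
proof -
  have c: "(\<lambda>p. a (2 * p + 1) * b (n - (2 * p + 1))) summable_on UNIV"
     "(\<Sum>\<^sub>\<infinity>j. complex_of_real (a j) * of_real (b (n - j)))
       = of_real (\<Sum>\<^sub>\<infinity>p. a (2 * p + 1) * b (n - (2 * p + 1)))" for n
    using convolution_of_real[OF trig_ser_convolution_summable[OF da db \<theta>], of n]
      infsum_odd_int[of "\<lambda>j. a j * b (n - j)"] ev by auto
  have "(\<Sum>\<^sub>\<infinity>p. A (2 * p + 1) + tanh (real_of_int (2 * m + e - (2 * p + 1)) * \<theta>)) = of_int (2 * m + e)"
  proof (rule infsum_addition_tanh[where A = A, OF \<theta> A e])
    fix m
    show "(\<lambda>p. A (2 * p + 1) + tanh (real_of_int (2 * m + e - (2 * p + 1)) * \<theta>)) summable_on UNIV"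
      unfolding add[symmetric] by (intro summable_on_cmult_left c)
  qed
  then have "(\<Sum>\<^sub>\<infinity>p. a (2 * p + 1) * b (2 * m + e - (2 * p + 1))) * E (2 * m + e) = of_int (2 * m + e)"
    unfolding add[symmetric] by (simp add: infsum_cmult_left')
  then have "(\<Sum>\<^sub>\<infinity>p. a (2 * p + 1) * b (2 * m + e - (2 * p + 1))) = of_int (2 * m + e) / E (2 * m + e)"
    using E[of m] by (simp add: eq_divide_eq)
  then show ?thesis unfolding c(2) by (rule arg_cong)
qed

lemma of_int_odd_nz: "2 * real_of_int p + 1 \<noteq> 0"
proof -
  have "2 * p + 1 \<noteq> 0" by presburger
  then have "real_of_int (2 * p + 1) \<noteq> 0" by (simp only: of_int_eq_0_iff not_False_eq_True)
  then show ?thesis by simp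
qed

text \<open>With \<open>x = j * \<theta>\<close> and \<open>y = (n - j) * \<theta>\<close> the
  identity behind the sum is cosh (x + y) / (sinh x cosh y) = coth x + tanh y, so the odd function
  \<open>A\<close> is coth. For odd \<open>n\<close> the indices \<open>j\<close> and
  \<open>n - j\<close> are never both odd, and every product vanishes.\<close>

lemma sn_cn_convolution:
  assumes "0 < \<theta>"
  shows "(\<Sum>\<^sub>\<infinity>j. complex_of_real (sn_coeff \<theta> j) * of_real (cn_coeff \<theta> (n - j)))
     = of_int n * of_real (dn_coeff \<theta> n)"
proof (cases "even n")
  case True
  then obtain m where m: "n = 2 * m + 0" by auto
  show ?thesis unfolding m
  proof (subst coeff_convolution[OF assms, of 0 "\<lambda>j. 1 / tanh (real_of_int j * \<theta>)" _ _
        "\<lambda>n. cosh (real_of_int n * \<theta>)"])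
    fix p m :: int
    define x y where "x = real_of_int (2 * p + 1) * \<theta>" and "y = real_of_int (2 * m + 0 - (2 * p + 1)) * \<theta>"
    have "x \<noteq> 0" using assms of_int_odd_nz[of p] by (simp add: x_def)
    then have *: "sinh x \<noteq> 0" by simp
    have "real_of_int (2 * m + 0) * \<theta> = x + y" by (simp add: x_def y_def algebra_simps)
    then show "sn_coeff \<theta> (2 * p + 1) * cn_coeff \<theta> (2 * m + 0 - (2 * p + 1)) * cosh (real_of_int (2 * m + 0) * \<theta>)
       = 1 / tanh (real_of_int (2 * p + 1) * \<theta>) + tanh (real_of_int (2 * m + 0 - (2 * p + 1)) * \<theta>)"
      unfolding x_def[symmetric] y_def[symmetric] sn_coeff_def cn_coeff_def 
      using * by (simp add: x_def[symmetric] y_def[symmetric] cosh_add tanh_def field_simps)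
  qed (use exp_decay_sinh_coeff[OF assms] exp_decay_cosh_coeff[of \<theta>] in
      \<open>auto simp: assms dn_coeff_def sn_coeff_def\<close>)
next
  case False
  then have "complex_of_real (sn_coeff \<theta> j) * of_real (cn_coeff \<theta> (n - j)) = 0" for j
    by (auto simp: sn_coeff_def cn_coeff_def)
  then show ?thesis using False by (simp only: infsum_0_simp) (simp add: dn_coeff_def)
qed

lemma sn_dn_convolution:
  assumes "0 < \<theta>"
  shows "(\<Sum>\<^sub>\<infinity>j. complex_of_real (sn_coeff \<theta> j) * of_real (dn_coeff \<theta> (n - j)))
     = of_int n * of_real (cn_coeff \<theta> n)"
proof (cases "odd n")
  case True
  then obtain m where m: "n = 2 * m + 1" by (auto elim: oddE)
  show ?thesis unfolding m
  proof (subst coeff_convolution[OF assms, of 1 "\<lambda>j. 1 / tanh (real_of_int j * \<theta>)" _ _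
        "\<lambda>n. cosh (real_of_int n * \<theta>)"])
    fix p m :: int
    define x y where "x = real_of_int (2 * p + 1) * \<theta>" and "y = real_of_int (2 * m + 1 - (2 * p + 1)) * \<theta>"
    have "x \<noteq> 0" using assms of_int_odd_nz[of p] by (simp add: x_def)
    then have *: "sinh x \<noteq> 0" by simp
    have "real_of_int (2 * m + 1) * \<theta> = x + y" by (simp add: x_def y_def algebra_simps)
    then show "sn_coeff \<theta> (2 * p + 1) * dn_coeff \<theta> (2 * m + 1 - (2 * p + 1)) * cosh (real_of_int (2 * m + 1) * \<theta>)
       = 1 / tanh (real_of_int (2 * p + 1) * \<theta>) + tanh (real_of_int (2 * m + 1 - (2 * p + 1)) * \<theta>)"
      unfolding x_def[symmetric] y_def[symmetric] sn_coeff_def dn_coeff_def 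
      using * by (simp add: x_def[symmetric] y_def[symmetric] cosh_add tanh_def field_simps)
  qed (use exp_decay_sinh_coeff[OF assms] exp_decay_cosh_coeff[of \<theta>] in
      \<open>auto simp: assms cn_coeff_def sn_coeff_def\<close>)
next
  case False
  then have "complex_of_real (sn_coeff \<theta> j) * of_real (dn_coeff \<theta> (n - j)) = 0" for j
    by (auto simp: sn_coeff_def dn_coeff_def)
  then show ?thesis using False by (simp only: infsum_0_simp) (simp add: cn_coeff_def)
qed

text \<open>Now sinh (x + y) / (cosh x cosh y) = tanh x + tanh y. The multiplier
  \<open>sinh (n * \<theta>)\<close> can be divided out because \<open>n\<close> is odd, hence not
  0.\<close>

lemma cn_dn_convolution:
  assumes "0 < \<theta>"
  shows "(\<Sum>\<^sub>\<infinity>j. complex_of_real (cn_coeff \<theta> j) * of_real (dn_coeff \<theta> (n - j)))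
     = of_int n * of_real (sn_coeff \<theta> n)"
proof (cases "odd n")
  case True
  then obtain m where m: "n = 2 * m + 1" by (auto elim: oddE)
  show ?thesis unfolding m
  proof (subst coeff_convolution[OF assms, of 1 "\<lambda>j. tanh (real_of_int j * \<theta>)" _ _
        "\<lambda>n. sinh (real_of_int n * \<theta>)"])
    fix p m :: int
    show "sinh (real_of_int (2 * m + 1) * \<theta>) \<noteq> 0"
      using assms of_int_odd_nz[of m] by simp
    define x y where "x = real_of_int (2 * p + 1) * \<theta>" and "y = real_of_int (2 * m + 1 - (2 * p + 1)) * \<theta>"
    have "real_of_int (2 * m + 1) * \<theta> = x + y" by (simp add: x_def y_def algebra_simps)
    then show "cn_coeff \<theta> (2 * p + 1) * dn_coeff \<theta> (2 * m + 1 - (2 * p + 1)) * sinh (real_of_int (2 * m + 1) * \<theta>)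
       = tanh (real_of_int (2 * p + 1) * \<theta>) + tanh (real_of_int (2 * m + 1 - (2 * p + 1)) * \<theta>)"
      unfolding x_def[symmetric] y_def[symmetric] cn_coeff_def dn_coeff_def 
      by (simp add: x_def[symmetric] y_def[symmetric] sinh_add tanh_def field_simps)
  qed (use exp_decay_cosh_coeff[of \<theta>] in \<open>auto simp: assms sn_coeff_def cn_coeff_def\<close>)
next
  case False
  then have "complex_of_real (cn_coeff \<theta> j) * of_real (dn_coeff \<theta> (n - j)) = 0" for j
    by (auto simp: cn_coeff_def dn_coeff_def)
  then show ?thesis using False by (simp only: infsum_0_simp) (simp add: sn_coeff_def)
qed

section \<open>The differential system on the strip and its first integrals\<close>

definition sn_ser :: "real \<Rightarrow> complex \<Rightarrow> complex" where
  "sn_ser \<theta> = trig_ser (\<lambda>n. of_real (sn_coeff \<theta> n))"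

definition cn_ser :: "real \<Rightarrow> complex \<Rightarrow> complex" where
  "cn_ser \<theta> = trig_ser (\<lambda>n. of_real (cn_coeff \<theta> n))"

definition dn_ser :: "real \<Rightarrow> complex \<Rightarrow> complex" where
  "dn_ser \<theta> = trig_ser (\<lambda>n. of_real (dn_coeff \<theta> n))"

lemma trig_ser_cmult: "trig_ser (\<lambda>n. c * a n) z = c * trig_ser a z"
  by (simp add: trig_ser_def mult.assoc infsum_cmult_right')

text \<open>The factor \<open>n\<close> in each convolution identity is the one that differentiation
  produces: \<open>\<i> * n\<close> times the coefficients of one series is \<open>\<i>\<close>
  times the convolution of the other two.\<close>

lemma ser_derivs:
  assumes "0 < \<theta>" "\<bar>Im z\<bar> < \<theta>"
  shows "(sn_ser \<theta> has_field_derivative \<i> * (cn_ser \<theta> z * dn_ser \<theta> z)) (at z)"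
    and "(cn_ser \<theta> has_field_derivative \<i> * (sn_ser \<theta> z * dn_ser \<theta> z)) (at z)"
    and "(dn_ser \<theta> has_field_derivative \<i> * (sn_ser \<theta> z * cn_ser \<theta> z)) (at z)"
  using trig_ser_deriv[OF exp_decay_sinh_coeff[OF assms(1)] assms(2)]
    trig_ser_deriv[OF exp_decay_cosh_coeff(1) assms(2)]
    trig_ser_deriv[OF exp_decay_cosh_coeff(2) assms(2)]
    trig_ser_mult[OF exp_decay_cosh_coeff assms(2)]
    trig_ser_mult[OF exp_decay_sinh_coeff[OF assms(1)] exp_decay_cosh_coeff(1) assms(2)]
    trig_ser_mult[OF exp_decay_sinh_coeff[OF assms(1)] exp_decay_cosh_coeff(2) assms(2)]
  by (simp_all add: sn_ser_def cn_ser_def dn_ser_def mult.assoc trig_ser_cmult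
      sn_cn_convolution[OF assms(1)] sn_dn_convolution[OF assms(1)] cn_dn_convolution[OF assms(1)])

lemma trig_ser_minus: "trig_ser a (- z) = trig_ser (\<lambda>n. a (- n)) z"
  unfolding trig_ser_def
  by (rule infsum_reindex_bij_witness[of UNIV uminus uminus]) auto

lemma trig_ser_uminus: "trig_ser (\<lambda>n. - a n) z = - trig_ser a z"
  by (simp add: trig_ser_def infsum_uminus)

lemma trig_ser_cnj: "cnj (trig_ser a z) = trig_ser (\<lambda>n. cnj (a n)) (- cnj z)"
  unfolding trig_ser_def infsum_cnj[symmetric] by (simp add: exp_cnj)

lemma exp_int_pi: "exp (\<i> * of_int n * of_real pi) = (if even n then 1 else - 1)"
proof -
  have "exp (\<i> * of_int n * of_real pi) = cis (of_int n * pi)"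
    by (simp add: cis_conv_exp mult.assoc)
  also have "\<dots> = (if even n then 1 else - 1)"
    unfolding mult.commute[of "of_int n" pi] by (simp add: complex_eq_iff)
  finally show ?thesis .
qed

lemma trig_ser_add_pi:
  assumes "\<And>n. a n \<noteq> 0 \<Longrightarrow> even n \<longleftrightarrow> e"
  shows "trig_ser a (z + of_real pi) = (if e then trig_ser a z else - trig_ser a z)"
proof -
  have "a n * exp (\<i> * of_int n * (z + of_real pi)) =
      (if e then a n * exp (\<i> * of_int n * z) else - (a n * exp (\<i> * of_int n * z)))" for n
    unfolding distrib_left exp_add exp_int_pi using assms[of n] by auto
  then show ?thesis unfolding trig_ser_def by (simp add: infsum_uminus)
qed

text \<open>The three groups come, in this order, from the parity of the coefficients as functions
  of \<open>n\<close>, from their being real, and from the parity of the frequencies that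
  occur.\<close>

lemma ser_symmetries:
  shows "sn_ser \<theta> (- z) = - sn_ser \<theta> z" "cn_ser \<theta> (- z) = cn_ser \<theta> z" "dn_ser \<theta> (- z) = dn_ser \<theta> z"
    and "cnj (sn_ser \<theta> z) = - sn_ser \<theta> (cnj z)" "cnj (cn_ser \<theta> z) = cn_ser \<theta> (cnj z)"
        "cnj (dn_ser \<theta> z) = dn_ser \<theta> (cnj z)"
    and "sn_ser \<theta> (z + of_real pi) = - sn_ser \<theta> z" "cn_ser \<theta> (z + of_real pi) = - cn_ser \<theta> z"
        "dn_ser \<theta> (z + of_real pi) = dn_ser \<theta> z"
proof -
  have c: "sn_coeff \<theta> (- n) = - sn_coeff \<theta> n" "cn_coeff \<theta> (- n) = cn_coeff \<theta> n"
    "dn_coeff \<theta> (- n) = dn_coeff \<theta> n" for n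
    by (simp_all add: sn_coeff_def cn_coeff_def dn_coeff_def)
  have odd: "complex_of_real (sn_coeff \<theta> n) \<noteq> 0 \<Longrightarrow> even n \<longleftrightarrow> False"
    "complex_of_real (cn_coeff \<theta> n) \<noteq> 0 \<Longrightarrow> even n \<longleftrightarrow> False"
    "complex_of_real (dn_coeff \<theta> n) \<noteq> 0 \<Longrightarrow> even n \<longleftrightarrow> True" for n
    by (auto simp: sn_coeff_def cn_coeff_def dn_coeff_def split: if_splits)
  show m: "sn_ser \<theta> (- z) = - sn_ser \<theta> z" "cn_ser \<theta> (- z) = cn_ser \<theta> z"
    "dn_ser \<theta> (- z) = dn_ser \<theta> z" for z
    by (simp_all add: sn_ser_def cn_ser_def dn_ser_def trig_ser_minus c trig_ser_uminus)
  show "cnj (sn_ser \<theta> z) = - sn_ser \<theta> (cnj z)" "cnj (cn_ser \<theta> z) = cn_ser \<theta> (cnj z)"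
        "cnj (dn_ser \<theta> z) = dn_ser \<theta> (cnj z)"
    using m[of "cnj z"] by (simp_all add: sn_ser_def cn_ser_def dn_ser_def trig_ser_cnj)
  show "sn_ser \<theta> (z + of_real pi) = - sn_ser \<theta> z"
    unfolding sn_ser_def by (subst trig_ser_add_pi[where e = False]) (use odd in auto)
  show "cn_ser \<theta> (z + of_real pi) = - cn_ser \<theta> z"
    unfolding cn_ser_def by (subst trig_ser_add_pi[where e = False]) (use odd in auto)
  show "dn_ser \<theta> (z + of_real pi) = dn_ser \<theta> z"
    unfolding dn_ser_def by (subst trig_ser_add_pi[where e = True]) (use odd in auto)
qed

lemma sn_ser_0: "sn_ser \<theta> 0 = 0"
  using ser_symmetries(1)[of \<theta> 0] by simp

text \<open>By the differential system the squares of all three series have the same derivative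
  2iSCD, so their differences are constant on the convex strip. Since S vanishes at 0, the constants
  are the values of the other two squares there.\<close>

lemma ser_first_integrals:
  assumes "0 < \<theta>" "\<bar>Im z\<bar> < \<theta>"
  shows "(cn_ser \<theta> z)\<^sup>2 = (sn_ser \<theta> z)\<^sup>2 + (cn_ser \<theta> 0)\<^sup>2"
    and "(dn_ser \<theta> z)\<^sup>2 = (sn_ser \<theta> z)\<^sup>2 + (dn_ser \<theta> 0)\<^sup>2"
proof -
  define S where "S = {w. Im w < \<theta>} \<inter> {w. Im w > - \<theta>}"
  have S: "convex S" unfolding S_def by (intro convex_Int convex_halfspace_Im_lt convex_halfspace_Im_gt)
  have zS: "z \<in> S" "0 \<in> S" using assms by (auto simp: S_def)
  have im: "\<bar>Im w\<bar> < \<theta>" if "w \<in> S" for w using that by (auto simp: S_def)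
  note d = ser_derivs[OF assms(1) im, THEN has_field_derivative_at_within]
  have "((\<lambda>w. (cn_ser \<theta> w)\<^sup>2 - (sn_ser \<theta> w)\<^sup>2) has_field_derivative 0) (at w within S)" if "w \<in> S" for w
    using that by (auto intro!: derivative_eq_intros d)
  from has_field_derivative_zero_constant[OF S this] zS
  have "(cn_ser \<theta> z)\<^sup>2 - (sn_ser \<theta> z)\<^sup>2 = (cn_ser \<theta> 0)\<^sup>2 - (sn_ser \<theta> 0)\<^sup>2" by metis
  then show "(cn_ser \<theta> z)\<^sup>2 = (sn_ser \<theta> z)\<^sup>2 + (cn_ser \<theta> 0)\<^sup>2"
    by (simp add: sn_ser_0 algebra_simps)
  have "((\<lambda>w. (dn_ser \<theta> w)\<^sup>2 - (sn_ser \<theta> w)\<^sup>2) has_field_derivative 0) (at w within S)" if "w \<in> S" for w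
    using that by (auto intro!: derivative_eq_intros d)
  from has_field_derivative_zero_constant[OF S this] zS
  have "(dn_ser \<theta> z)\<^sup>2 - (sn_ser \<theta> z)\<^sup>2 = (dn_ser \<theta> 0)\<^sup>2 - (sn_ser \<theta> 0)\<^sup>2" by metis
  then show "(dn_ser \<theta> z)\<^sup>2 = (sn_ser \<theta> z)\<^sup>2 + (dn_ser \<theta> 0)\<^sup>2"
    by (simp add: sn_ser_0 algebra_simps)
qed

text \<open>With \<open>A = cn_re \<theta> 0\<close> and \<open>B = dn_re \<theta> 0\<close>, the functions \<open>sn_re\<close>, \<open>cn_re\<close>, \<open>dn_re\<close> turn out to be
  \<open>A sn(B x)\<close>, \<open>A cn(B x)\<close>, \<open>B dn(B x)\<close> of modulus \<open>A / B\<close>.\<close>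

definition sn_re :: "real \<Rightarrow> real \<Rightarrow> real" where "sn_re \<theta> x = Im (sn_ser \<theta> (of_real x))"
definition cn_re :: "real \<Rightarrow> real \<Rightarrow> real" where "cn_re \<theta> x = Re (cn_ser \<theta> (of_real x))"
definition dn_re :: "real \<Rightarrow> real \<Rightarrow> real" where "dn_re \<theta> x = Re (dn_ser \<theta> (of_real x))"

lemma ser_of_real:
  "sn_ser \<theta> (of_real x) = \<i> * of_real (sn_re \<theta> x)"
  "cn_ser \<theta> (of_real x) = of_real (cn_re \<theta> x)"
  "dn_ser \<theta> (of_real x) = of_real (dn_re \<theta> x)"
proof -
  have "Re w = 0" if "cnj w = - w" for w using arg_cong[OF that, of Re] by simp
  moreover have "Im w = 0" if "cnj w = w" for w using arg_cong[OF that, of Im] by simp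
  ultimately have "Re (sn_ser \<theta> (of_real x)) = 0" "Im (cn_ser \<theta> (of_real x)) = 0"
    "Im (dn_ser \<theta> (of_real x)) = 0"
    using ser_symmetries(4-6)[of \<theta> "of_real x"] unfolding complex_cnj_complex_of_real by blast+
  then show "sn_ser \<theta> (of_real x) = \<i> * of_real (sn_re \<theta> x)"
    "cn_ser \<theta> (of_real x) = of_real (cn_re \<theta> x)" "dn_ser \<theta> (of_real x) = of_real (dn_re \<theta> x)"
    by (simp_all add: sn_re_def cn_re_def dn_re_def complex_eq_iff)
qed

lemma real_axis_derivs:
  assumes "0 < \<theta>"
  shows "(sn_re \<theta> has_real_derivative cn_re \<theta> x * dn_re \<theta> x) (at x within X)"
    and "(cn_re \<theta> has_real_derivative - (sn_re \<theta> x * dn_re \<theta> x)) (at x within X)"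
    and "(dn_re \<theta> has_real_derivative - (sn_re \<theta> x * cn_re \<theta> x)) (at x within X)"
proof -
  have im: "\<bar>Im (of_real x)\<bar> < \<theta>" using assms by simp
  note d = ser_derivs[OF assms im, THEN has_vector_derivative_real_field, of X]
  have RI: "((\<lambda>x. Re (f x)) has_real_derivative Re f') (at x within X)"
    "((\<lambda>x. Im (f x)) has_real_derivative Im f') (at x within X)"
    if "(f has_vector_derivative f') (at x within X)" for f f'
    using bounded_linear.has_vector_derivative[OF bounded_linear_Re that]
      bounded_linear.has_vector_derivative[OF bounded_linear_Im that]
    by (simp_all add: has_real_derivative_iff_has_vector_derivative)
  have e: "(\<lambda>x. Im (sn_ser \<theta> (of_real x))) = sn_re \<theta>" "(\<lambda>x. Re (cn_ser \<theta> (of_real x))) = cn_re \<theta>"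
    "(\<lambda>x. Re (dn_ser \<theta> (of_real x))) = dn_re \<theta>"
    by (simp_all add: sn_re_def cn_re_def dn_re_def fun_eq_iff)
  show "(sn_re \<theta> has_real_derivative cn_re \<theta> x * dn_re \<theta> x) (at x within X)"
    using RI(2)[OF d(1)] unfolding e ser_of_real by simp
  show "(cn_re \<theta> has_real_derivative - (sn_re \<theta> x * dn_re \<theta> x)) (at x within X)"
    using RI(1)[OF d(2)] unfolding e ser_of_real by simp
  show "(dn_re \<theta> has_real_derivative - (sn_re \<theta> x * cn_re \<theta> x)) (at x within X)"
    using RI(1)[OF d(3)] unfolding e ser_of_real by simp
qed

lemma real_axis_first_integrals:
  assumes "0 < \<theta>"
  shows "(cn_re \<theta> x)\<^sup>2 = (cn_re \<theta> 0)\<^sup>2 - (sn_re \<theta> x)\<^sup>2" and "(dn_re \<theta> x)\<^sup>2 = (dn_re \<theta> 0)\<^sup>2 - (sn_re \<theta> x)\<^sup>2"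
proof -
  have im: "\<bar>Im (of_real x)\<bar> < \<theta>" using assms by simp
  have "complex_of_real ((cn_re \<theta> x)\<^sup>2) = of_real ((cn_re \<theta> 0)\<^sup>2 - (sn_re \<theta> x)\<^sup>2)"
    "complex_of_real ((dn_re \<theta> x)\<^sup>2) = of_real ((dn_re \<theta> 0)\<^sup>2 - (sn_re \<theta> x)\<^sup>2)"
    using ser_first_integrals[OF assms im] ser_of_real[of \<theta> x] ser_of_real[of \<theta> 0]
    by (simp_all add: power_mult_distrib)
  then show "(cn_re \<theta> x)\<^sup>2 = (cn_re \<theta> 0)\<^sup>2 - (sn_re \<theta> x)\<^sup>2" "(dn_re \<theta> x)\<^sup>2 = (dn_re \<theta> 0)\<^sup>2 - (sn_re \<theta> x)\<^sup>2"
    by (simp_all only: of_real_eq_iff)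
qed

lemma real_axis_symmetries:
  "sn_re \<theta> 0 = 0" "sn_re \<theta> (- x) = - sn_re \<theta> x" "sn_re \<theta> (x + pi) = - sn_re \<theta> x"
  "cn_re \<theta> (x + pi) = - cn_re \<theta> x" "dn_re \<theta> (x + pi) = dn_re \<theta> x"
  using ser_symmetries(1,7-9)[of \<theta> "of_real x"] sn_ser_0[of \<theta>]
  by (simp_all add: sn_re_def cn_re_def dn_re_def)

text \<open>On the imaginary axis the exponentials are positive and no coefficient is negative, so a
  single positive term bounds the sum from below. The signs decide which square roots occur in
  \<open>sn_im_deriv\<close>; the point 0 gives the positivity of \<open>cn_re \<theta> 0\<close>
  and \<open>dn_re \<theta> 0\<close>.\<close>

lemma imag_axis_pos:
  assumes "0 < \<theta>" "\<bar>y\<bar> < \<theta>"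
  shows "0 < Re (cn_ser \<theta> (\<i> * of_real y))" "0 < Re (dn_ser \<theta> (\<i> * of_real y))"
proof -
  have im: "\<bar>Im (\<i> * of_real y)\<bar> < \<theta>" using assms by simp
  have pos: "0 < Re (trig_ser (\<lambda>n. of_real (a n)) (\<i> * of_real y))"
    if d: "exp_decay \<theta> (\<lambda>n. of_real (a n))" and nn: "\<And>n. 0 \<le> a n" and m: "0 < a m" for a :: "int \<Rightarrow> real" and m
  proof -
    define f where "f = (\<lambda>n. complex_of_real (a n) * exp (\<i> * of_int n * (\<i> * of_real y)))"
    have f: "f n = of_real (a n * exp (- (of_int n * y)))" for n
      by (simp add: f_def exp_of_real[symmetric] algebra_simps)
    have s: "f summable_on UNIV"
      unfolding f_def by (rule abs_summable_summable[OF trig_ser_summable[OF d im]])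
    have "0 < a m * exp (- (of_int m * y))" using m by simp
    also have "\<dots> = (\<Sum>n\<in>{m}. Re (f n))" by (simp add: f)
    also have "\<dots> \<le> (\<Sum>\<^sub>\<infinity>n. Re (f n))"
      by (rule finite_sum_le_infsum) (use summable_on_Re[OF s] nn in \<open>auto simp: f\<close>)
    also have "\<dots> = Re (infsum f UNIV)" by (rule infsum_Re[OF s])
    finally show ?thesis by (simp add: trig_ser_def f_def)
  qed
  show "0 < Re (cn_ser \<theta> (\<i> * of_real y))"
    unfolding cn_ser_def by (rule pos[OF exp_decay_cosh_coeff(1), where m = 1]) (auto simp: cn_coeff_def)
  show "0 < Re (dn_ser \<theta> (\<i> * of_real y))"
    unfolding dn_ser_def by (rule pos[OF exp_decay_cosh_coeff(2), where m = 0]) (auto simp: dn_coeff_def)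
qed

text \<open>With an antiderivative \<open>h\<close> of \<open>g\<close> the product
  \<open>f x * exp (- h x)\<close> is constant, so the sign at \<open>b\<close> is the sign at
  \<open>a\<close>.\<close>

lemma linear_ode_sign:
  fixes f g :: "real \<Rightarrow> real"
  assumes "a \<le> b" and g: "continuous_on {a..b} g"
    and f: "\<And>x. x \<in> {a..b} \<Longrightarrow> (f has_real_derivative g x * f x) (at x within {a..b})"
    and "0 < f b"
  shows "0 < f a"
proof -
  obtain h where h: "\<And>x. x \<in> {a..b} \<Longrightarrow> (h has_real_derivative g x) (at x within {a..b})"
    using antiderivative_continuous[OF g] by (auto simp: has_real_derivative_iff_has_vector_derivative)
  have "((\<lambda>x. f x * exp (- h x)) has_real_derivative 0) (at x within {a..b})" if "x \<in> {a..b}" for x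
    by (rule derivative_eq_intros f h that refl | simp add: that)+
  from has_field_derivative_zero_constant[OF convex_real_interval(5) this]
  obtain c where "\<And>x. x \<in> {a..b} \<Longrightarrow> f x * exp (- h x) = c" by blast
  from this[of a] this[of b] have "f a * exp (- h a) = f b * exp (- h b)"
    using \<open>a \<le> b\<close> by simp
  moreover have "0 < f b * exp (- h b)" using \<open>0 < f b\<close> by simp
  ultimately have "0 < f a * exp (- h a)" by simp
  then show ?thesis by (simp add: zero_less_mult_iff)
qed

text \<open>This places the modulus \<open>cn_re \<theta> 0 / dn_re \<theta> 0\<close> in the open
  unit interval.\<close>

lemma cn_re_dn_re_0:
  assumes "0 < \<theta>"
  shows "0 < cn_re \<theta> 0" "cn_re \<theta> 0 < dn_re \<theta> 0"
proof -
  show c: "0 < cn_re \<theta> 0" using imag_axis_pos(1)[OF assms, of 0] assms by (simp add: cn_re_def)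
  have d: "0 < dn_re \<theta> 0" using imag_axis_pos(2)[OF assms, of 0] assms by (simp add: dn_re_def)
  \<comment> \<open>\<open>D - C\<close> solves \<open>y' = sn_re y\<close>, hence keeps its sign, and at \<open>pi\<close> it equals \<open>D(0) + C(0) > 0\<close>.\<close>
  have "0 < (\<lambda>x. dn_re \<theta> x - cn_re \<theta> x) 0"
  proof (rule linear_ode_sign[of 0 pi "sn_re \<theta>"])
    show "continuous_on {0..pi} (sn_re \<theta>)"
      using real_axis_derivs(1)[OF assms] by (rule DERIV_continuous_on)
    show "0 < dn_re \<theta> pi - cn_re \<theta> pi"
      using real_axis_symmetries(4,5)[of \<theta> 0] c d by simp
  qed (auto intro!: derivative_eq_intros real_axis_derivs[OF assms] simp: algebra_simps)
  then show "cn_re \<theta> 0 < dn_re \<theta> 0" by simp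
qed

text \<open>At a zero of \<open>dn_re\<close> the first integrals would make
  \<open>(cn_re \<theta> y)\<^sup>2\<close> equal to A^2 - B^2 < 0, where A and B are the values of
  \<open>cn_re\<close> and \<open>dn_re\<close> at 0.\<close>

lemma dn_re_pos:
  assumes "0 < \<theta>"
  shows "0 < dn_re \<theta> x"
proof (rule ccontr)
  assume "\<not> 0 < dn_re \<theta> x"
  moreover have "0 < dn_re \<theta> 0" using cn_re_dn_re_0[OF assms] by simp
  moreover have "connected (range (dn_re \<theta>))"
    using real_axis_derivs(3)[OF assms] by (intro connected_continuous_image connected_UNIV DERIV_continuous_on)
  ultimately have "0 \<in> range (dn_re \<theta>)"
    by (meson connectedD_interval linorder_not_le order_less_imp_le rangeI)
  then obtain y where "dn_re \<theta> y = 0" by auto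
  moreover have "(cn_re \<theta> 0)\<^sup>2 < (dn_re \<theta> 0)\<^sup>2"
    using cn_re_dn_re_0[OF assms] by (intro power_strict_mono) auto
  ultimately show False
    using real_axis_first_integrals[OF assms, of y] zero_le_power2[of "cn_re \<theta> y"] by simp
qed

text \<open>Coefficients of the oscillating part of Jacobi's amplitude, the antiderivative of
  \<open>dn_re\<close> that vanishes at 0. The zero mode of \<open>dn_re\<close> is 1 / cosh 0 = 1
  and integrates to \<open>x\<close>; each other mode is divided by \<open>\<i> * n\<close>.\<close>

definition amp_coeff :: "real \<Rightarrow> int \<Rightarrow> complex" where
  "amp_coeff \<theta> n = (if n = 0 then 0 else of_real (dn_coeff \<theta> n) / (\<i> * of_int n))"

definition amp :: "real \<Rightarrow> real \<Rightarrow> real" where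
  "amp \<theta> x = x + Re (trig_ser (amp_coeff \<theta>) (of_real x))"

text \<open>The oscillating part is odd and has period \<pi>, so it vanishes at 0 and at \<pi> / 2.
  The second value is what fixes the quarter period.\<close>

lemma amp_0: "amp \<theta> 0 = 0" and amp_half_pi: "amp \<theta> (pi / 2) = pi / 2"
proof -
  have odd: "trig_ser (amp_coeff \<theta>) (- z) = - trig_ser (amp_coeff \<theta>) z" for z
  proof -
    have "(\<lambda>n. amp_coeff \<theta> (- n)) = (\<lambda>n. - amp_coeff \<theta> n)"
      by (auto simp: amp_coeff_def dn_coeff_def)
    then show ?thesis by (simp add: trig_ser_minus trig_ser_uminus)
  qed
  show "amp \<theta> 0 = 0" using odd[of 0] by (simp add: amp_def)
  have "trig_ser (amp_coeff \<theta>) (of_real (- pi / 2) + of_real pi) = trig_ser (amp_coeff \<theta>) (of_real (- pi / 2))"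
    by (subst trig_ser_add_pi[where e = True]) (auto simp: amp_coeff_def dn_coeff_def split: if_splits)
  also have "complex_of_real (- pi / 2) + of_real pi = of_real (pi / 2)" by simp
  also have "complex_of_real (- pi / 2) = - of_real (pi / 2)" by simp
  finally show "amp \<theta> (pi / 2) = pi / 2" unfolding odd amp_def by (simp add: eq_neg_iff_add_eq_0)
qed

lemma amp_deriv:
  assumes "0 < \<theta>"
  shows "(amp \<theta> has_real_derivative dn_re \<theta> x) (at x within X)"
proof -
  have im: "\<bar>Im (of_real x)\<bar> < \<theta>" using assms by simp
  have "exp_decay \<theta> (amp_coeff \<theta>)"
    unfolding exp_decay_def
  proof (intro allI impI)
    fix y assume "y < \<theta>"
    show "(\<lambda>n. norm (amp_coeff \<theta> n) * exp (real_of_int \<bar>n\<bar> * y)) summable_on UNIV"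
    proof (rule summable_on_comparison_test)
      show "(\<lambda>n. norm (complex_of_real (dn_coeff \<theta> n)) * exp (real_of_int \<bar>n\<bar> * y)) summable_on UNIV"
        using exp_decay_cosh_coeff(2)[of \<theta>] \<open>y < \<theta>\<close> unfolding exp_decay_def by blast
      fix n :: int
      have "norm (amp_coeff \<theta> n) \<le> norm (complex_of_real (dn_coeff \<theta> n))"
      proof (cases "n = 0")
        case False
        then have "1 \<le> \<bar>real_of_int n\<bar>" by linarith
        then show ?thesis using False
          by (simp add: amp_coeff_def norm_divide norm_mult divide_le_eq mult_le_cancel_left1)
      qed (simp add: amp_coeff_def)
      then show "norm (amp_coeff \<theta> n) * exp (real_of_int \<bar>n\<bar> * y)
        \<le> norm (complex_of_real (dn_coeff \<theta> n)) * exp (real_of_int \<bar>n\<bar> * y)"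
        by (intro mult_right_mono) auto
    qed auto
  qed
  note d = trig_ser_deriv[OF this im, THEN has_vector_derivative_real_field, of X]
  let ?f = "\<lambda>n. complex_of_real (dn_coeff \<theta> n) * exp (\<i> * of_int n * of_real x)"
  have "?f summable_on UNIV"
    by (rule abs_summable_summable[OF trig_ser_summable[OF exp_decay_cosh_coeff(2) im]])
  then have "(?f has_sum dn_ser \<theta> (of_real x)) UNIV"
    unfolding dn_ser_def trig_ser_def by (rule has_sum_infsum)
  \<comment> \<open>The differentiated series of \<open>amp_coeff\<close> lacks the zero mode 1 of
    \<open>dn_ser\<close>; the summand \<open>x\<close> of \<open>amp\<close> restores it at the
    end.\<close>
  moreover have "((\<lambda>n. if n = 0 then - 1 else 0 :: complex) has_sum - 1) (UNIV :: int set)"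
    by (rule has_sum_finite_neutralI[of "{0}"]) auto
  ultimately have "((\<lambda>n. ?f n + (if n = 0 then - 1 else 0)) has_sum dn_ser \<theta> (of_real x) + - 1) UNIV"
    by (rule has_sum_add)
  also have "(\<lambda>n. ?f n + (if n = 0 then - 1 else 0))
      = (\<lambda>n. \<i> * of_int n * amp_coeff \<theta> n * exp (\<i> * of_int n * of_real x))"
    by (auto simp: amp_coeff_def dn_coeff_def)
  finally have "trig_ser (\<lambda>n. \<i> * of_int n * amp_coeff \<theta> n) (of_real x) = dn_ser \<theta> (of_real x) - 1"
    unfolding trig_ser_def by (simp add: infsumI)
  then have "((\<lambda>x. Re (trig_ser (amp_coeff \<theta>) (of_real x))) has_real_derivative dn_re \<theta> x - 1) (at x within X)"
    using bounded_linear.has_vector_derivative[OF bounded_linear_Re d]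
    by (simp add: has_real_derivative_iff_has_vector_derivative dn_re_def)
  from DERIV_add[OF DERIV_ident this] show ?thesis unfolding amp_def[abs_def] by simp
qed

text \<open>The vector (\<open>cn_re\<close>, \<open>sn_re\<close>) rotates with angular velocity
  \<open>dn_re\<close>, the derivative of \<open>amp\<close>. In the frame turned by the angle
  \<open>amp\<close> it is at rest; \<open>u\<close> and \<open>v\<close> are its coordinates
  there.\<close>

lemma sn_cn_amp:
  assumes "0 < \<theta>"
  shows "sn_re \<theta> x = cn_re \<theta> 0 * sin (amp \<theta> x)" and "cn_re \<theta> x = cn_re \<theta> 0 * cos (amp \<theta> x)"
proof -
  define u where "u = (\<lambda>x. cn_re \<theta> x * cos (amp \<theta> x) + sn_re \<theta> x * sin (amp \<theta> x))"
  define v where "v = (\<lambda>x. sn_re \<theta> x * cos (amp \<theta> x) - cn_re \<theta> x * sin (amp \<theta> x))"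
  have "(u has_real_derivative 0) (at x within UNIV)" for x
    unfolding u_def by (auto intro!: derivative_eq_intros real_axis_derivs amp_deriv assms simp: algebra_simps)
  from has_field_derivative_zero_constant[OF convex_UNIV this]
  have u: "u x = cn_re \<theta> 0" by (metis UNIV_I u_def amp_0 cos_zero sin_zero mult_1_right mult_zero_right add.right_neutral)
  have "(v has_real_derivative 0) (at x within UNIV)" for x
    unfolding v_def by (auto intro!: derivative_eq_intros real_axis_derivs amp_deriv assms simp: algebra_simps)
  from has_field_derivative_zero_constant[OF convex_UNIV this]
  have v: "v x = 0" by (metis UNIV_I v_def amp_0 cos_zero sin_zero mult_1_right mult_zero_right diff_zero real_axis_symmetries(1))
  let ?c = "cos (amp \<theta> x)" and ?s = "sin (amp \<theta> x)"
  have "S * (s\<^sup>2 + c\<^sup>2) = (C * c + S * s) * s + (S * c - C * s) * c"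
    "C * (s\<^sup>2 + c\<^sup>2) = (C * c + S * s) * c - (S * c - C * s) * s" for S C s c :: real
    by (simp_all add: algebra_simps power2_eq_square)
  then have "sn_re \<theta> x * (?s\<^sup>2 + ?c\<^sup>2) = u x * ?s + v x * ?c" "cn_re \<theta> x * (?s\<^sup>2 + ?c\<^sup>2) = u x * ?c - v x * ?s"
    unfolding u_def v_def by blast+
  then show "sn_re \<theta> x = cn_re \<theta> 0 * sin (amp \<theta> x)" "cn_re \<theta> x = cn_re \<theta> 0 * cos (amp \<theta> x)"
    by (simp_all add: u v)
qed

lemma sn_re_sums:
  assumes "0 < \<theta>"
  shows "(\<lambda>l. 2 * sin (real (2 * l + 1) * x) / sinh (real (2 * l + 1) * \<theta>)) sums sn_re \<theta> x"
proof -
  have im: "\<bar>Im (of_real x)\<bar> < \<theta>" using assms by simp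
  let ?f = "\<lambda>n. complex_of_real (sn_coeff \<theta> n) * exp (\<i> * of_int n * of_real x)"
  have s: "?f summable_on UNIV"
    by (rule abs_summable_summable[OF trig_ser_summable[OF exp_decay_sinh_coeff[OF assms] im]])
  have o: "infsum ?f UNIV = (\<Sum>\<^sub>\<infinity>p. ?f (2 * p + 1))" "(\<lambda>p. ?f (2 * p + 1)) summable_on UNIV"
    using infsum_odd_int[of ?f] s by (auto simp: sn_coeff_def)
  have "(\<lambda>l. ?f (2 * int l + 1) + ?f (2 * (- int l - 1) + 1)) sums sn_ser \<theta> (of_real x)"
    using int_sums_nat[OF o(2)] o(1) by (simp add: sn_ser_def trig_ser_def)
  also have "(\<lambda>l. ?f (2 * int l + 1) + ?f (2 * (- int l - 1) + 1))
      = (\<lambda>l. \<i> * of_real (2 * sin (real (2 * l + 1) * x) / sinh (real (2 * l + 1) * \<theta>)))"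
  proof
    fix l
    define t where "t = real (2 * l + 1)"
    have *: "real_of_int (2 * (- int l - 1) + 1) = - t" "real_of_int (2 * int l + 1) = t"
      by (simp_all add: t_def)
    have "exp (\<i> * of_int n * of_real x) = cis (real_of_int n * x)" for n
      by (simp add: cis_conv_exp mult.assoc)
    then have e: "?f n = of_real (1 / sinh (of_int n * \<theta>)) * cis (real_of_int n * x)" if "odd n" for n
      using that by (simp add: sn_coeff_def)
    show "?f (2 * int l + 1) + ?f (2 * (- int l - 1) + 1)
        = \<i> * of_real (2 * sin (real (2 * l + 1) * x) / sinh (real (2 * l + 1) * \<theta>))"
      by (subst e, simp, subst e, simp, unfold * t_def[symmetric]) (simp add: complex_eq_iff)
  qed
  finally have "(\<lambda>l. Im (\<i> * of_real (2 * sin (real (2 * l + 1) * x) / sinh (real (2 * l + 1) * \<theta>))))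
      sums Im (sn_ser \<theta> (of_real x))"
    by (rule sums_Im)
  then show ?thesis by (simp add: sn_re_def)
qed

text \<open>By Jacobi's imaginary transformation this is A sn / cn at B y for the complementary
  modulus, with A and B the values of \<open>cn_re\<close> and \<open>dn_re\<close> at 0. The minus
  sign makes it increasing.\<close>

definition sn_im :: "real \<Rightarrow> real \<Rightarrow> real" where "sn_im \<theta> y = - Re (sn_ser \<theta> (\<i> * of_real y))"

lemma sn_im_0: "sn_im \<theta> 0 = 0"
  by (simp add: sn_im_def sn_ser_0)

text \<open>On the imaginary axis all three series are real, and the two factors
  \<open>\<i>\<close>, from the system and from the chain rule, turn the derivative of
  \<open>sn_im\<close> into the product of the other two. The first integrals express these as
  square roots, positive by \<open>imag_axis_pos\<close>.\<close>

lemma sn_im_deriv: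
  assumes "0 < \<theta>" "\<bar>y\<bar> < \<theta>"
  shows "(sn_im \<theta> has_real_derivative
      sqrt ((sn_im \<theta> y)\<^sup>2 + (cn_re \<theta> 0)\<^sup>2) * sqrt ((sn_im \<theta> y)\<^sup>2 + (dn_re \<theta> 0)\<^sup>2)) (at y within X)"
proof -
  define z where "z = \<i> * of_real y"
  have im: "\<bar>Im z\<bar> < \<theta>" using assms by (simp add: z_def)
  have r: "Im (sn_ser \<theta> z) = 0" "Im (cn_ser \<theta> z) = 0" "Im (dn_ser \<theta> z) = 0"
  proof -
    have "cnj z = - z" by (simp add: z_def)
    then have "cnj (sn_ser \<theta> z) = sn_ser \<theta> z" "cnj (cn_ser \<theta> z) = cn_ser \<theta> z" "cnj (dn_ser \<theta> z) = dn_ser \<theta> z"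
      using ser_symmetries(1-6)[of \<theta> z] by simp_all
    then show "Im (sn_ser \<theta> z) = 0" "Im (cn_ser \<theta> z) = 0" "Im (dn_ser \<theta> z) = 0"
      by (simp_all add: complex_eq_iff)
  qed
  then have c: "sn_ser \<theta> z = of_real (- sn_im \<theta> y)" "cn_ser \<theta> z = of_real (Re (cn_ser \<theta> z))"
      "dn_ser \<theta> z = of_real (Re (dn_ser \<theta> z))"
    by (simp_all add: complex_eq_iff sn_im_def z_def)
  have z0: "cn_ser \<theta> 0 = of_real (cn_re \<theta> 0)" "dn_ser \<theta> 0 = of_real (dn_re \<theta> 0)"
    using ser_of_real[of \<theta> 0] by simp_all
  have "complex_of_real ((Re (cn_ser \<theta> z))\<^sup>2) = of_real ((sn_im \<theta> y)\<^sup>2 + (cn_re \<theta> 0)\<^sup>2)"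
    "complex_of_real ((Re (dn_ser \<theta> z))\<^sup>2) = of_real ((sn_im \<theta> y)\<^sup>2 + (dn_re \<theta> 0)\<^sup>2)"
    using ser_first_integrals[OF assms(1) im] c z0 by (metis of_real_add of_real_power power2_minus)+
  then have "(Re (cn_ser \<theta> z))\<^sup>2 = (sn_im \<theta> y)\<^sup>2 + (cn_re \<theta> 0)\<^sup>2" "(Re (dn_ser \<theta> z))\<^sup>2 = (sn_im \<theta> y)\<^sup>2 + (dn_re \<theta> 0)\<^sup>2"
    by (simp_all only: of_real_eq_iff)
  then have cd: "sqrt ((sn_im \<theta> y)\<^sup>2 + (cn_re \<theta> 0)\<^sup>2) = Re (cn_ser \<theta> z)" "sqrt ((sn_im \<theta> y)\<^sup>2 + (dn_re \<theta> 0)\<^sup>2) = Re (dn_ser \<theta> z)"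
    using imag_axis_pos[OF assms] by (auto simp: z_def real_sqrt_unique)
  have "((\<lambda>w. sn_ser \<theta> (\<i> * w)) has_field_derivative - (cn_ser \<theta> z * dn_ser \<theta> z)) (at (of_real y))"
  proof -
    have "((\<lambda>w. sn_ser \<theta> (\<i> * w)) has_field_derivative
        \<i> * (cn_ser \<theta> z * dn_ser \<theta> z) * \<i>) (at (of_real y))"
      using ser_derivs(1)[OF assms(1) im]
      by (intro DERIV_chain2[of "sn_ser \<theta>" _ "\<lambda>w. \<i> * w"]) (auto intro!: derivative_eq_intros simp: z_def)
    then show ?thesis by (simp add: algebra_simps)
  qed
  from bounded_linear.has_vector_derivative[OF bounded_linear_Re has_vector_derivative_real_field[OF this, of X]]
  have "((\<lambda>y. Re (sn_ser \<theta> (\<i> * of_real y))) has_real_derivative - (Re (cn_ser \<theta> z) * Re (dn_ser \<theta> z))) (at y within X)"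
    using r by (simp add: has_real_derivative_iff_has_vector_derivative)
  moreover have "sn_im \<theta> = (\<lambda>y. - Re (sn_ser \<theta> (\<i> * of_real y)))" by (simp add: sn_im_def fun_eq_iff)
  ultimately show ?thesis unfolding cd using DERIV_minus by fastforce
qed

text \<open>For \<open>0 < y < \<theta>\<close> the value is the sum of the positive terms 2 sinh (t
  y) / sinh (t \<theta>) over odd t > 0. Each of them tends to 2 at \<theta>, so already the first
  \<open>N\<close> come close to \<open>2 * N\<close> there.\<close>

lemma sn_im_at_top:
  assumes "0 < \<theta>"
  shows "filterlim (sn_im \<theta>) at_top (at_left \<theta>)"
  unfolding filterlim_at_top
proof
  fix Z :: real
  obtain N where N: "Z < real N" using reals_Archimedean2 by blast
  define F where "F = (\<lambda>y. \<Sum>l<N. 2 * sinh (real (2 * l + 1) * y) / sinh (real (2 * l + 1) * \<theta>))"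
  have "isCont F \<theta>" unfolding F_def using assms by (intro continuous_intros) auto
  moreover have "F \<theta> = 2 * real N" unfolding F_def using assms by (simp add: add_nonneg_eq_0_iff)
  ultimately have "(F \<longlongrightarrow> 2 * real N) (at_left \<theta>)"
    by (metis continuous_within filterlim_at_split isCont_def)
  then have "\<forall>\<^sub>F y in at_left \<theta>. Z < F y"
    using order_tendstoD(1)[of F _ _ Z] N by auto
  moreover have "\<forall>\<^sub>F y in at_left \<theta>. y \<in> {0<..<\<theta>}"
    using assms eventually_at_left_real by blast
  ultimately show "\<forall>\<^sub>F y in at_left \<theta>. Z \<le> sn_im \<theta> y"
  proof eventually_elim
    case (elim y)
    then have im: "\<bar>Im (\<i> * of_real y)\<bar> < \<theta>" by simp
    let ?f = "\<lambda>n. complex_of_real (sn_coeff \<theta> n) * exp (\<i> * of_int n * (\<i> * of_real y))"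
    let ?t = "\<lambda>l. 2 * sinh (real (2 * l + 1) * y) / sinh (real (2 * l + 1) * \<theta>)"
    have s: "?f summable_on UNIV"
      by (rule abs_summable_summable[OF trig_ser_summable[OF exp_decay_sinh_coeff[OF assms] im]])
    have o: "infsum ?f UNIV = (\<Sum>\<^sub>\<infinity>p. ?f (2 * p + 1))" "(\<lambda>p. ?f (2 * p + 1)) summable_on UNIV"
      using infsum_odd_int[of ?f] s by (auto simp: sn_coeff_def)
    have "(\<lambda>l. ?f (2 * int l + 1) + ?f (2 * (- int l - 1) + 1)) sums sn_ser \<theta> (\<i> * of_real y)"
      using int_sums_nat[OF o(2)] o(1) by (simp add: sn_ser_def trig_ser_def)
    also have "(\<lambda>l. ?f (2 * int l + 1) + ?f (2 * (- int l - 1) + 1)) = (\<lambda>l. of_real (- ?t l))"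
    proof
      fix l
      define t where "t = real (2 * l + 1)"
      have *: "real_of_int (2 * (- int l - 1) + 1) = - t" "real_of_int (2 * int l + 1) = t"
        by (simp_all add: t_def)
      have e: "?f n = of_real (1 / sinh (of_int n * \<theta>) * exp (- (real_of_int n * y)))" if "odd n" for n
        using that by (simp add: sn_coeff_def exp_of_real[symmetric] algebra_simps)
      show "?f (2 * int l + 1) + ?f (2 * (- int l - 1) + 1) = of_real (- ?t l)"
      proof (subst e, simp, subst e, simp, unfold * t_def[symmetric])
        have "1 / sinh (t * \<theta>) * exp (- (t * y)) + 1 / sinh (- t * \<theta>) * exp (- (- t * y))
            = - (2 * sinh (t * y) / sinh (t * \<theta>))"
          unfolding sinh_field_def[of "t * y"] by (simp add: diff_divide_distrib)
        then show "of_real (1 / sinh (t * \<theta>) * exp (- (t * y))) + of_real (1 / sinh (- t * \<theta>) * exp (- (- t * y)))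
            = complex_of_real (- (2 * sinh (t * y) / sinh (t * \<theta>)))"
          by (simp only: of_real_add[symmetric])
      qed
    qed
    finally have "(\<lambda>l. - ?t l) sums Re (sn_ser \<theta> (\<i> * of_real y))"
      using sums_Re by fastforce
    from sums_minus[OF this] have t: "?t sums sn_im \<theta> y" by (simp add: sn_im_def)
    have "F y \<le> sn_im \<theta> y"
      unfolding F_def sums_unique[OF t]
      by (rule sum_le_suminf) (use t elim assms in \<open>auto simp: sums_iff\<close>)
    then show ?case using elim by simp
  qed
qed

section \<open>Elliptic integrals and the nome\<close>

lemma set_integrable_inverse_sqrt:
  "set_integrable lborel {-1<..<1} (\<lambda>t::real. inverse (sqrt (1 - t\<^sup>2)))"
proof -
  have sq: "x\<^sup>2 < 1" if "- 1 < x" "x < 1" for x :: real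
    using that by (simp add: abs_square_less_1)
  have cont: "continuous_on {-1..1} arcsin" by (intro continuous_intros) auto
  have "set_integrable lborel (einterval (ereal (- 1)) (ereal 1)) (\<lambda>t. inverse (sqrt (1 - t\<^sup>2)))"
  proof (rule interval_integral_FTC_nonneg(1)[where F = arcsin])
    show "((arcsin \<circ> real_of_ereal) \<longlongrightarrow> arcsin (- 1)) (at_right (ereal (- 1)))"
      using continuous_on_Icc_at_rightD[OF cont] unfolding ereal_tendsto_simps by simp
    show "((arcsin \<circ> real_of_ereal) \<longlongrightarrow> arcsin 1) (at_left (ereal 1))"
      using continuous_on_Icc_at_leftD[OF cont] unfolding ereal_tendsto_simps by simp
    show "AE x in lborel. ereal (- 1) < ereal x \<longrightarrow> ereal x < ereal 1 \<longrightarrow> 0 \<le> inverse (sqrt (1 - x\<^sup>2))"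
      using sq by (auto intro!: AE_I2 simp: less_imp_le)
    fix x assume "ereal (- 1) < ereal x" "ereal x < ereal 1"
    then have x: "- 1 < x" "x < 1" by auto
    then show "DERIV arcsin x :> inverse (sqrt (1 - x\<^sup>2))" by (rule DERIV_arcsin)
    show "isCont (\<lambda>t. inverse (sqrt (1 - t\<^sup>2))) x"
      using sq[OF x] by (intro continuous_intros) auto
  qed auto
  moreover have "einterval (ereal (- 1)) (ereal 1) = {-1<..<1}" by (simp add: einterval_eq_Icc)
  ultimately show ?thesis by simp
qed

definition ellip_integrand :: "real \<Rightarrow> real \<Rightarrow> real" where
  "ellip_integrand k t = 1 / (sqrt (1 - t\<^sup>2) * sqrt (1 - k\<^sup>2 * t\<^sup>2))"

lemma modulus_bounds:
  fixes k t :: real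
  assumes "0 \<le> k" "k < 1" "\<bar>t\<bar> < 1"
  shows "0 < 1 - t\<^sup>2" "0 < 1 - k\<^sup>2 * t\<^sup>2" "0 < 1 - k\<^sup>2" "1 - k\<^sup>2 \<le> 1 - k\<^sup>2 * t\<^sup>2"
proof -
  have k: "k\<^sup>2 < 1" and t: "t\<^sup>2 < 1" using assms by (simp_all add: abs_square_less_1)
  then show "0 < 1 - t\<^sup>2" "0 < 1 - k\<^sup>2" by auto
  have "k\<^sup>2 * t\<^sup>2 \<le> k\<^sup>2" using t by (simp add: mult_left_le)
  then show "1 - k\<^sup>2 \<le> 1 - k\<^sup>2 * t\<^sup>2" "0 < 1 - k\<^sup>2 * t\<^sup>2" using k by auto
qed

text \<open>The singularity is that of the arcsine, because the second root stays above
  \<open>sqrt (1 - k\<^sup>2)\<close>.\<close>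

lemma ellip_integrand_integrable:
  assumes "0 \<le> k" "k < 1"
  shows "set_integrable lborel {-1..1} (ellip_integrand k)"
proof -
  have "set_integrable lborel {-1<..<1} (ellip_integrand k)"
  proof (rule set_integrable_bound)
    show "set_integrable lborel {-1<..<1} (\<lambda>t. 1 / sqrt (1 - k\<^sup>2) * inverse (sqrt (1 - t\<^sup>2)))"
      using set_integrable_inverse_sqrt by simp
    show "set_borel_measurable lborel {-1<..<1} (ellip_integrand k)"
      unfolding set_borel_measurable_def ellip_integrand_def by measurable
    show "AE t in lborel. t \<in> {-1<..<1} \<longrightarrow>
        norm (ellip_integrand k t) \<le> norm (1 / sqrt (1 - k\<^sup>2) * inverse (sqrt (1 - t\<^sup>2)))"
    proof (intro AE_I2 impI)
      fix t :: real assume "t \<in> {-1<..<1}"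
      then have "\<bar>t\<bar> < 1" by auto
      note b = modulus_bounds[OF assms this]
      have "1 / (sqrt (1 - t\<^sup>2) * sqrt (1 - k\<^sup>2 * t\<^sup>2)) \<le> 1 / (sqrt (1 - t\<^sup>2) * sqrt (1 - k\<^sup>2))"
        using b by (intro divide_left_mono mult_left_mono mult_pos_pos) auto
      then show "norm (ellip_integrand k t) \<le> norm (1 / sqrt (1 - k\<^sup>2) * inverse (sqrt (1 - t\<^sup>2)))"
        using b by (simp add: ellip_integrand_def field_simps)
    qed
  qed
  \<comment> \<open>At the two endpoints the integrand is \<open>1 / 0 = 0\<close>, so opening or
    closing the interval changes nothing, not even pointwise.\<close>
  moreover have "(\<lambda>t. indicator {-1<..<1} t *\<^sub>R ellip_integrand k t) = (\<lambda>t. indicator {-1..1} t *\<^sub>R ellip_integrand k t)"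
  proof
    fix t :: real
    show "indicator {-1<..<1} t *\<^sub>R ellip_integrand k t = indicator {-1..1} t *\<^sub>R ellip_integrand k t"
      by (cases "t = 1 \<or> t = - 1") (auto simp: indicator_def ellip_integrand_def)
  qed
  ultimately show ?thesis unfolding set_integrable_def by metis
qed

lemma ellipF_eq_integral:
  assumes "0 \<le> k" "k < 1" "0 \<le> z" "z \<le> 1"
  shows "ellipF k z = integral {0..z} (ellip_integrand k)"
proof -
  have "set_integrable lborel {0..z} (ellip_integrand k)"
    by (rule set_integrable_subset[OF ellip_integrand_integrable]) (use assms in auto)
  from interval_integral_eq_integral[OF assms(3) this] show ?thesis
    by (simp add: ellipF_def ellip_integrand_def zero_ereal_def)
qed

lemma ellipF_minus: "ellipF k (- z) = - ellipF k z"
proof -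
  have "ellipF k (- z) = (LBINT t=ereal z..0. 1 / (sqrt (1 - t\<^sup>2) * sqrt (1 - k\<^sup>2 * t\<^sup>2)))"
    unfolding ellipF_def by (subst interval_integral_reflect) simp
  also have "\<dots> = - ellipF k z"
    unfolding ellipF_def by (rule interval_integral_endpoints_reverse)
  finally show ?thesis .
qed

lemma ellipF_0: "ellipF k 0 = 0"
  using ellipF_minus[of k 0] by simp

lemma continuous_on_ellipF:
  assumes "0 \<le> k" "k < 1"
  shows "continuous_on {0..1} (ellipF k)"
proof -
  have "set_integrable lborel {0..1} (ellip_integrand k)"
    by (rule set_integrable_subset[OF ellip_integrand_integrable[OF assms]]) auto
  then have "ellip_integrand k integrable_on {0..1}" by (rule set_borel_integral_eq_integral)
  from indefinite_integral_continuous_1[OF this] show ?thesis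
    by (rule continuous_on_eq) (simp add: ellipF_eq_integral[OF assms])
qed

lemma DERIV_ellipF:
  assumes "0 \<le> k" "k < 1" "0 < z" "z < 1"
  shows "(ellipF k has_real_derivative ellip_integrand k z) (at z)"
proof -
  \<comment> \<open>The point \<open>c\<close> between \<open>z\<close> and 1 keeps the interval
    away from the singularity, so that the integrand is continuous on it.\<close>
  define c where "c = (z + 1) / 2"
  have c: "z < c" "c < 1" using assms by (auto simp: c_def)
  have "continuous_on {0..c} (ellip_integrand k)"
    unfolding ellip_integrand_def
  proof (intro continuous_intros ballI)
    fix t assume "t \<in> {0..c}"
    then have "\<bar>t\<bar> < 1" using c by auto
    from modulus_bounds[OF assms(1,2) this] show "sqrt (1 - t\<^sup>2) * sqrt (1 - k\<^sup>2 * t\<^sup>2) \<noteq> 0" by simp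
  qed
  from integral_has_real_derivative[OF this, of z]
  have "((\<lambda>x. integral {0..x} (ellip_integrand k)) has_real_derivative ellip_integrand k z) (at z within {0..c})"
    using assms c by simp
  moreover have "at z within {0..c} = at z" by (rule at_within_interior) (use assms c in auto)
  moreover have "\<forall>\<^sub>F x in nhds z. ellipF k x = integral {0..x} (ellip_integrand k)"
    using eventually_nhds_in_open[of "{0<..<1}" z] assms
    by (auto elim!: eventually_mono simp: ellipF_eq_integral)
  ultimately show ?thesis by (simp add: DERIV_cong_ev)
qed

lemma ellip_integrand_pos:
  assumes "0 \<le> k" "k < 1" "0 < z" "z < 1"
  shows "0 < ellip_integrand k z"
  using modulus_bounds[of k z] assms by (simp add: ellip_integrand_def)

lemma ellipF_strict_mono:
  assumes "0 \<le> k" "k < 1" "0 \<le> y" "y < z" "z \<le> 1"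
  shows "ellipF k y < ellipF k z"
proof (rule DERIV_pos_imp_increasing_open[OF assms(4)])
  show "continuous_on {y..z} (ellipF k)"
    by (rule continuous_on_subset[OF continuous_on_ellipF[OF assms(1,2)]]) (use assms in auto)
  fix x assume "y < x" "x < z"
  then have "0 < x" "x < 1" using assms by auto
  then show "\<exists>d. DERIV (ellipF k) x :> d \<and> d > 0"
    using DERIV_ellipF ellip_integrand_pos assms(1,2) by blast
qed

lemma inj_on_ellipF:
  assumes "0 \<le> k" "k < 1"
  shows "inj_on (ellipF k) {-1..1}"
proof -
  have pos: "0 < ellipF k y" if "0 < y" "y \<le> 1" for y
    using ellipF_strict_mono[OF assms, of 0 y] that by (simp add: ellipF_0)
  have "strict_mono_on {-1..1} (ellipF k)"
  proof (rule strict_mono_onI)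
    fix r s :: real assume rs: "r \<in> {-1..1}" "s \<in> {-1..1}" "r < s"
    consider "0 \<le> r" | "s \<le> 0" | "r < 0" "0 < s" by linarith
    then show "ellipF k r < ellipF k s"
    proof cases
      case 1 then show ?thesis using ellipF_strict_mono[OF assms] rs by auto
    next
      case 2 then show ?thesis using ellipF_strict_mono[OF assms, of "- s" "- r"] rs by (auto simp: ellipF_minus)
    next
      case 3 then show ?thesis using pos[of s] pos[of "- r"] rs by (auto simp: ellipF_minus)
    qed
  qed
  then show ?thesis by (rule strict_mono_on_imp_inj_on)
qed

lemma ellipK_pos:
  assumes "0 \<le> k" "k < 1"
  shows "0 < ellipK k"
  using ellipF_strict_mono[OF assms, of 0 1] by (simp add: ellipK_def ellipF_0)

text \<open>The integrand increases with the modulus, so the difference of the two incomplete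
  integrals, 0 at the lower limit, grows strictly with the upper limit.\<close>

lemma ellipK_strict_mono:
  assumes "0 \<le> k" "k < k'" "k' < 1"
  shows "ellipK k < ellipK k'"
proof -
  let ?d = "\<lambda>z. ellipF k' z - ellipF k z"
  have "?d 0 < ?d 1"
  proof (rule DERIV_pos_imp_increasing_open[where f = ?d])
    show "continuous_on {0..1} ?d"
      using assms by (intro continuous_intros continuous_on_ellipF) auto
    fix x :: real assume x: "0 < x" "x < 1"
    have "k\<^sup>2 < k'\<^sup>2" using assms by (intro power_strict_mono) auto
    then have "k\<^sup>2 * x\<^sup>2 < k'\<^sup>2 * x\<^sup>2" using x by simp
    moreover have b: "0 < 1 - x\<^sup>2" "0 < 1 - k\<^sup>2 * x\<^sup>2" "0 < 1 - k'\<^sup>2 * x\<^sup>2"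
      using modulus_bounds[of k x] modulus_bounds[of k' x] x assms by auto
    ultimately have "sqrt (1 - x\<^sup>2) * sqrt (1 - k'\<^sup>2 * x\<^sup>2) < sqrt (1 - x\<^sup>2) * sqrt (1 - k\<^sup>2 * x\<^sup>2)"
      by (intro mult_strict_left_mono) auto
    moreover have "0 < sqrt (1 - x\<^sup>2) * sqrt (1 - k'\<^sup>2 * x\<^sup>2)" using b by simp
    ultimately have "ellip_integrand k x < ellip_integrand k' x"
      unfolding ellip_integrand_def using b by (intro divide_strict_left_mono) auto
    then show "\<exists>y. DERIV ?d x :> y \<and> y > 0"
      using assms x DERIV_ellipF[of k' x] DERIV_ellipF[of k x]
      by (intro exI[of _ "ellip_integrand k' x - ellip_integrand k x"]) (auto intro!: derivative_intros)
  qed simp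
  then show ?thesis by (simp add: ellipK_def ellipF_0)
qed

text \<open>As \<open>k\<close> grows, \<open>ellipK k\<close> grows and the integral for the
  complementary modulus shrinks; the quotient in the exponent falls and the nome rises
  strictly.\<close>

lemma nome_inj:
  assumes k: "k \<in> {0<..<1}" and k': "k' \<in> {0<..<1}" and eq: "nome k = nome k'"
  shows "k = k'"
proof -
  have less: "nome k < nome k'" if "k \<in> {0<..<1}" "k' \<in> {0<..<1}" "k < k'" for k k'
  proof -
    have sq: "0 < k\<^sup>2" "k\<^sup>2 < k'\<^sup>2" "k'\<^sup>2 < 1"
      using that by (auto intro!: power_strict_mono simp: power_less_one_iff abs_square_less_1)
    have K: "ellipK (sqrt (1 - k'\<^sup>2)) < ellipK (sqrt (1 - k\<^sup>2))" "0 < ellipK (sqrt (1 - k'\<^sup>2))"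
      using sq by (auto intro!: ellipK_strict_mono ellipK_pos)
    have "ellipK k < ellipK k'" "0 < ellipK k" using that by (auto intro!: ellipK_strict_mono ellipK_pos)
    then have "ellipK (sqrt (1 - k'\<^sup>2)) / ellipK k' < ellipK (sqrt (1 - k\<^sup>2)) / ellipK k"
      using K by (intro frac_less) auto
    then have "pi * (ellipK (sqrt (1 - k'\<^sup>2)) / ellipK k') < pi * (ellipK (sqrt (1 - k\<^sup>2)) / ellipK k)"
      by (intro mult_strict_left_mono) auto
    then show ?thesis by (simp add: nome_def)
  qed
  show ?thesis using less[OF k k'] less[OF k' k] eq by linarith
qed

text \<open>By the chain rule \<open>ellipF k (s x) - C * x\<close> has derivative 0 inside the
  interval, and continuity carries the equation to the ends. The differential equation is assumed
  only where \<open>s\<close> lies strictly between 0 and 1, because \<open>ellip_integrand\<close>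
  is singular at 1. It serves both axes.\<close>

lemma ellipF_inverse:
  assumes k: "0 \<le> k" "k < 1" and s: "continuous_on {0..c} s" "s 0 = 0" "s ` {0..c} \<subseteq> {0..1}"
    and int: "\<And>x. 0 < x \<Longrightarrow> x < c \<Longrightarrow> 0 < s x \<and> s x < 1"
    and d: "\<And>x. 0 < x \<Longrightarrow> x < c \<Longrightarrow>
       (s has_real_derivative C * (sqrt (1 - (s x)\<^sup>2) * sqrt (1 - k\<^sup>2 * (s x)\<^sup>2))) (at x)"
    and x: "x \<in> {0..c}"
  shows "ellipF k (s x) = C * x"
proof (cases "0 < c")
  case True
  let ?h = "\<lambda>x. ellipF k (s x) - C * x"
  have "?h x = ?h 0"
  proof (rule DERIV_isconst2[OF True])
    show "continuous_on {0..c} ?h"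
      by (intro continuous_intros continuous_on_compose2[OF continuous_on_ellipF[OF k] s(1,3)])
    fix x assume x: "0 < x" "x < c"
    have sx: "0 < s x" "s x < 1" using int[OF x] by auto
    have "((\<lambda>x. ellipF k (s x)) has_real_derivative
        ellip_integrand k (s x) * (C * (sqrt (1 - (s x)\<^sup>2) * sqrt (1 - k\<^sup>2 * (s x)\<^sup>2)))) (at x)"
      by (rule DERIV_chain2[OF DERIV_ellipF[OF k sx] d[OF x]])
    also have "ellip_integrand k (s x) * (C * (sqrt (1 - (s x)\<^sup>2) * sqrt (1 - k\<^sup>2 * (s x)\<^sup>2))) = C"
      using modulus_bounds[OF k, of "s x"] sx by (simp add: ellip_integrand_def)
    finally show "DERIV ?h x :> 0" by (auto intro!: derivative_eq_intros)
  qed (use x in auto)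
  then show ?thesis by (simp add: s(2) ellipF_0)
next
  case False
  then have "x = 0" using x by auto
  then show ?thesis by (simp add: s(2) ellipF_0)
qed

text \<open>The increasing amplitude maps the interval from 0 to \<pi> / 2 into itself, so its sine
  and cosine have the signs that make the square roots in \<open>ellipF_inverse\<close> equal to
  \<open>cn_re \<theta> x / A\<close> and \<open>dn_re \<theta> x / B\<close>.\<close>

lemma ellipF_sn_re:
  assumes \<theta>: "0 < \<theta>" and x: "x \<in> {0..pi / 2}"
  shows "ellipF (cn_re \<theta> 0 / dn_re \<theta> 0) (sn_re \<theta> x / cn_re \<theta> 0) = dn_re \<theta> 0 * x"
proof -
  define A B where "A = cn_re \<theta> 0" and "B = dn_re \<theta> 0"
  have AB: "0 < A" "A < B" using cn_re_dn_re_0[OF \<theta>] by (auto simp: A_def B_def)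
  have mono: "amp \<theta> y < amp \<theta> z" if "y < z" for y z
    using DERIV_pos_imp_increasing[OF that] amp_deriv[OF \<theta>] dn_re_pos[OF \<theta>] by blast
  have s: "sn_re \<theta> x / A = sin (amp \<theta> x)" for x
    using sn_cn_amp(1)[OF \<theta>, of x] AB by (simp add: A_def)
  have sq: "1 - (sn_re \<theta> x / A)\<^sup>2 = (cn_re \<theta> x / A)\<^sup>2" "1 - (A / B)\<^sup>2 * (sn_re \<theta> x / A)\<^sup>2 = (dn_re \<theta> x / B)\<^sup>2" for x
    using AB real_axis_first_integrals[OF \<theta>, of x]
    by (simp_all add: A_def[symmetric] B_def[symmetric] field_simps)
  have "ellipF (A / B) (sn_re \<theta> x / A) = B * x"
  proof (rule ellipF_inverse[where c = "pi / 2" and s = "\<lambda>x. sn_re \<theta> x / A"])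
    show "continuous_on {0..pi / 2} (\<lambda>x. sn_re \<theta> x / A)"
      using AB by (intro continuous_intros DERIV_continuous_on[OF real_axis_derivs(1)[OF \<theta>]]) auto
    have "amp \<theta> x \<in> {0..pi / 2}" if x: "x \<in> {0..pi / 2}" for x
    proof -
      consider "x = 0" | "x = pi / 2" | "0 < x" "x < pi / 2"
        using x by fastforce
      then show ?thesis
      proof cases
        case 2
        then show ?thesis unfolding \<open>x = pi / 2\<close> amp_half_pi by simp
      qed (use mono[of 0 x] mono[of x "pi / 2"] in \<open>auto simp: amp_0 amp_half_pi\<close>)
    qed
    then have "0 \<le> sin (amp \<theta> x)" if "x \<in> {0..pi / 2}" for x
      using that by (intro sin_ge_zero) fastforce+
    then show "(\<lambda>x. sn_re \<theta> x / A) ` {0..pi / 2} \<subseteq> {0..1}"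
      unfolding s by auto
    fix x assume x: "0 < x" "x < pi / 2"
    then have a: "0 < amp \<theta> x" "amp \<theta> x < pi / 2"
      using mono[of 0 x] mono[of x "pi / 2"] unfolding amp_0 amp_half_pi by auto
    then have "sin (amp \<theta> x) < sin (pi / 2)" by (intro sin_monotone_2pi) auto
    then show "0 < sn_re \<theta> x / A \<and> sn_re \<theta> x / A < 1"
      unfolding s using a by (auto intro!: sin_gt_zero)
    have "0 < cn_re \<theta> x"
      using sn_cn_amp(2)[OF \<theta>, of x] a AB by (auto simp: A_def intro!: mult_pos_pos cos_gt_zero)
    then have "sqrt (1 - (sn_re \<theta> x / A)\<^sup>2) = cn_re \<theta> x / A" "sqrt (1 - (A / B)\<^sup>2 * (sn_re \<theta> x / A)\<^sup>2) = dn_re \<theta> x / B"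
      unfolding sq using AB dn_re_pos[OF \<theta>, of x] by (simp_all del: power_divide)
    then show "((\<lambda>x. sn_re \<theta> x / A) has_real_derivative
        B * (sqrt (1 - (sn_re \<theta> x / A)\<^sup>2) * sqrt (1 - (A / B)\<^sup>2 * (sn_re \<theta> x / A)\<^sup>2))) (at x)"
      using AB by (auto intro!: derivative_eq_intros real_axis_derivs(1)[OF \<theta>])
  qed (use AB x real_axis_symmetries(1) in auto)
  then show ?thesis by (simp add: A_def B_def)
qed

lemma ellipK_modulus:
  assumes \<theta>: "0 < \<theta>"
  shows "ellipK (cn_re \<theta> 0 / dn_re \<theta> 0) = dn_re \<theta> 0 * pi / 2"
proof -
  have "sn_re \<theta> (pi / 2) = cn_re \<theta> 0" using sn_cn_amp(1)[OF \<theta>, of "pi / 2"] unfolding amp_half_pi by simp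
  then show ?thesis using ellipF_sn_re[OF \<theta>, of "pi / 2"] cn_re_dn_re_0[OF \<theta>] by (simp add: ellipK_def)
qed

text \<open>The substitution t = r / sqrt (r^2 + A^2) with r = \<open>sn_im \<theta> y\<close> turns
  A sn / cn back into sn. The result solves the equation of \<open>ellipF_inverse\<close> for the
  complementary modulus with \<open>C = B\<close>, and it reaches 1 exactly when r becomes infinite,
  that is at y = \<theta>.\<close>

lemma ellipK_complementary_modulus:
  assumes \<theta>: "0 < \<theta>"
  shows "ellipK (sqrt (1 - (cn_re \<theta> 0 / dn_re \<theta> 0)\<^sup>2)) = dn_re \<theta> 0 * \<theta>"
proof -
  define A B where "A = cn_re \<theta> 0" and "B = dn_re \<theta> 0"
  have AB: "0 < A" "A < B" using cn_re_dn_re_0[OF \<theta>] by (auto simp: A_def B_def)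
  define k where "k = sqrt (1 - (A / B)\<^sup>2)"
  have "(A / B)\<^sup>2 < 1" using AB by (simp add: power_less_one_iff)
  moreover have "0 < (A / B)\<^sup>2" using AB by simp
  ultimately have k: "0 \<le> k" "k < 1" "k\<^sup>2 = 1 - (A / B)\<^sup>2" by (auto simp: k_def)
  define g where "g = (\<lambda>r. r / sqrt (r\<^sup>2 + A\<^sup>2))"
  \<comment> \<open>The value 1 at \<theta> is the limit of \<open>g\<close> at infinity; with it
    \<open>t\<close> is continuous on the closed interval.\<close>
  define t where "t = (\<lambda>y. if y = \<theta> then 1 else g (sn_im \<theta> y))"
  have Apos: "0 < r\<^sup>2 + A\<^sup>2" for r :: real using AB by (simp add: add_nonneg_pos)
  have Bpos: "0 < r\<^sup>2 + B\<^sup>2" for r :: real using AB by (simp add: add_nonneg_pos)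
  have pos: "0 < sn_im \<theta> y" if "0 < y" "y < \<theta>" for y
  proof -
    have "sn_im \<theta> 0 < sn_im \<theta> y"
    proof (rule DERIV_pos_imp_increasing[OF \<open>0 < y\<close>])
      fix x assume "0 \<le> x" "x \<le> y"
      then have "\<bar>x\<bar> < \<theta>" using that by auto
      from sn_im_deriv[OF \<theta> this] show "\<exists>d. DERIV (sn_im \<theta>) x :> d \<and> d > 0"
        using Apos Bpos unfolding A_def B_def by (meson mult_pos_pos real_sqrt_gt_zero)
    qed
    then show ?thesis by (simp add: sn_im_0)
  qed
  have g: "0 < g r \<and> g r < 1" if "0 < r" for r
  proof -
    have "sqrt (r\<^sup>2) < sqrt (r\<^sup>2 + A\<^sup>2)" using AB by (intro real_sqrt_less_mono) simp
    then show ?thesis using that Apos[of r] by (simp add: g_def)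
  qed
  have "((\<lambda>r. 1 / sqrt (1 + (A / r)\<^sup>2)) \<longlongrightarrow> 1 / sqrt (1 + 0\<^sup>2)) at_top"
    by (intro tendsto_intros tendsto_divide_0[OF tendsto_const] filterlim_at_top_imp_at_infinity filterlim_ident) auto
  moreover have "\<forall>\<^sub>F r in at_top. 1 / sqrt (1 + (A / r)\<^sup>2) = g r"
    using eventually_gt_at_top[of 0]
  proof eventually_elim
    case (elim r)
    have "r\<^sup>2 + A\<^sup>2 = r\<^sup>2 * (1 + (A / r)\<^sup>2)" using elim by (simp add: field_simps)
    then show ?case using elim by (simp add: g_def real_sqrt_mult)
  qed
  ultimately have "(g \<longlongrightarrow> 1) at_top" by (simp add: tendsto_cong)
  from filterlim_compose[OF this sn_im_at_top[OF \<theta>]]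
  have lim: "((\<lambda>y. g (sn_im \<theta> y)) \<longlongrightarrow> 1) (at_left \<theta>)" .
  have dt: "(t has_real_derivative B * (sqrt (1 - (t y)\<^sup>2) * sqrt (1 - k\<^sup>2 * (t y)\<^sup>2))) (at y)"
    if y: "0 \<le> y" "y < \<theta>" for y
  proof -
    define r where "r = sn_im \<theta> y"
    define a b where "a = sqrt (r\<^sup>2 + A\<^sup>2)" and "b = sqrt (r\<^sup>2 + B\<^sup>2)"
    have ab: "0 < a" "0 < b" "a\<^sup>2 = r\<^sup>2 + A\<^sup>2" "b\<^sup>2 = r\<^sup>2 + B\<^sup>2"
      using Apos[of r] Bpos[of r] by (auto simp: a_def b_def)
    have "\<bar>y\<bar> < \<theta>" using y by auto
    from sn_im_deriv[OF \<theta> this, of UNIV]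
    have ds: "(sn_im \<theta> has_real_derivative a * b) (at y)" by (simp add: a_def b_def r_def A_def B_def)
    have "(g has_real_derivative A\<^sup>2 / a ^ 3) (at r)"
    proof -
      have "((\<lambda>r. sqrt (r\<^sup>2 + A\<^sup>2)) has_real_derivative inverse a / 2 * (2 * r)) (at r)"
        unfolding a_def
        by (rule DERIV_chain2[OF DERIV_real_sqrt]) (use Apos in \<open>auto intro!: derivative_eq_intros\<close>)
      moreover have "sqrt (r\<^sup>2 + A\<^sup>2) \<noteq> 0" using AB by (simp add: add_nonneg_eq_0_iff)
      ultimately have "((\<lambda>r. r / sqrt (r\<^sup>2 + A\<^sup>2)) has_real_derivative
          (1 * sqrt (r\<^sup>2 + A\<^sup>2) - r * (inverse a / 2 * (2 * r))) / (sqrt (r\<^sup>2 + A\<^sup>2) * sqrt (r\<^sup>2 + A\<^sup>2))) (at r)"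
        by (rule DERIV_divide[OF DERIV_ident])
      then
      have "(g has_real_derivative (1 * a - r * (inverse a / 2 * (2 * r))) / (a * a)) (at r)"
        unfolding g_def a_def[symmetric] by blast
      also have "(1 * a - r * (inverse a / 2 * (2 * r))) / (a * a) = (a\<^sup>2 - r\<^sup>2) / a ^ 3"
        using ab(1) by (simp add: divide_simps) (simp add: power2_eq_square power3_eq_cube algebra_simps)
      also have "a\<^sup>2 - r\<^sup>2 = A\<^sup>2" using ab by simp
      finally show ?thesis .
    qed
    from DERIV_chain2[OF this[unfolded r_def] ds]
    have "((\<lambda>y. g (sn_im \<theta> y)) has_real_derivative A\<^sup>2 / a ^ 3 * (a * b)) (at y)" .
    moreover have "\<forall>\<^sub>F x in nhds y. t x = g (sn_im \<theta> x)"
    proof -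
      have "\<forall>\<^sub>F x in nhds y. x \<in> {..<\<theta>}" using y by (intro eventually_nhds_in_open) auto
      then show ?thesis by eventually_elim (simp add: t_def)
    qed
    ultimately have "(t has_real_derivative A\<^sup>2 / a ^ 3 * (a * b)) (at y)"
      by (simp add: DERIV_cong_ev)
    \<comment> \<open>The derivative is split so that its two factors after \<open>B\<close> are the
      square roots of 1 - t^2 and 1 - k^2 t^2.\<close>
    also have "A\<^sup>2 / a ^ 3 * (a * b) = B * ((A / a) * (A * b / (B * a)))"
      using ab(1,2) AB by (simp add: divide_simps) (simp add: power2_eq_square power3_eq_cube)
    also have "A / a = sqrt (1 - (t y)\<^sup>2)"
    proof -
      have "1 - (t y)\<^sup>2 = 1 - (r / a)\<^sup>2"
        using y by (simp add: t_def g_def r_def[symmetric] a_def[symmetric])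
      also have "\<dots> = (a\<^sup>2 - r\<^sup>2) / a\<^sup>2" using ab(1) by (simp add: field_simps)
      also have "a\<^sup>2 - r\<^sup>2 = A\<^sup>2" using ab(3) by simp
      also have "A\<^sup>2 / a\<^sup>2 = (A / a)\<^sup>2" by (simp add: power_divide)
      finally have "1 - (t y)\<^sup>2 = (A / a)\<^sup>2" .
      then show ?thesis using ab AB by (simp del: power_divide)
    qed
    also have "A * b / (B * a) = sqrt (1 - k\<^sup>2 * (t y)\<^sup>2)"
    proof -
      have "1 - k\<^sup>2 * (t y)\<^sup>2 = 1 - (1 - (A / B)\<^sup>2) * (r\<^sup>2 / a\<^sup>2)"
        using y by (simp add: t_def g_def r_def[symmetric] a_def[symmetric] k(3) power_divide)
      also have "\<dots> = (B\<^sup>2 * (a\<^sup>2 - r\<^sup>2) + A\<^sup>2 * r\<^sup>2) / (B\<^sup>2 * a\<^sup>2)"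
        using ab(1) AB by (simp add: field_simps)
      also have "B\<^sup>2 * (a\<^sup>2 - r\<^sup>2) + A\<^sup>2 * r\<^sup>2 = A\<^sup>2 * b\<^sup>2" unfolding ab by (simp add: algebra_simps)
      also have "A\<^sup>2 * b\<^sup>2 / (B\<^sup>2 * a\<^sup>2) = (A * b / (B * a))\<^sup>2" by (simp add: power_mult_distrib power_divide)
      finally show ?thesis using ab AB by (simp del: power_divide power_mult_distrib)
    qed
    finally show ?thesis .
  qed
  have "ellipF k (t \<theta>) = B * \<theta>"
  proof (rule ellipF_inverse[OF k(1,2), where c = \<theta> and s = t])
    show "continuous_on {0..\<theta>} t"
      unfolding continuous_on_eq_continuous_within
    proof
      fix y assume y: "y \<in> {0..\<theta>}"
      show "continuous (at y within {0..\<theta>}) t"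
      proof (cases "y = \<theta>")
        case True
        have "\<forall>\<^sub>F y in at_left \<theta>. g (sn_im \<theta> y) = t y"
          by (auto simp: eventually_at_filter t_def intro!: always_eventually)
        then have "(t \<longlongrightarrow> t \<theta>) (at_left \<theta>)" using lim by (simp add: tendsto_cong t_def)
        then have "(t \<longlongrightarrow> t \<theta>) (at \<theta> within {0..\<theta>})"
          using \<theta> by (simp add: at_within_Icc_at_left)
        then show ?thesis using True by (simp add: continuous_within)
      next
        case False
        then have "isCont t y" using y by (intro DERIV_isCont[OF dt]) auto
        then show ?thesis by (rule continuous_at_imp_continuous_at_within)
      qed
    qed
    have t01: "0 < t y \<and> t y < 1" if "0 < y" "y < \<theta>" for y
      using g[OF pos[OF that]] that by (auto simp: t_def)
    show t0: "t 0 = 0" using \<theta> by (simp add: t_def g_def sn_im_0)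
    show "t ` {0..\<theta>} \<subseteq> {0..1}"
    proof
      fix v assume "v \<in> t ` {0..\<theta>}"
      then obtain y where y: "v = t y" "0 \<le> y" "y \<le> \<theta>" by auto
      consider "y = 0" | "y = \<theta>" | "0 < y" "y < \<theta>" using y by linarith
      then show "v \<in> {0..1}" using t0 t01[of y] y by cases (auto simp: t_def)
    qed
    fix y assume "0 < y" "y < \<theta>"
    then show "0 < t y \<and> t y < 1" by (rule t01)
  qed (use dt \<theta> in auto)
  then show ?thesis by (simp add: ellipK_def t_def k_def A_def B_def)
qed

section \<open>Recovering the modulus from its nome\<close>

lemma nome_modulus:
  assumes "0 < \<theta>"
  shows "nome (cn_re \<theta> 0 / dn_re \<theta> 0) = exp (- 2 * \<theta>)"
  using cn_re_dn_re_0[OF assms]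
  unfolding nome_def ellipK_modulus[OF assms] ellipK_complementary_modulus[OF assms] by simp

lemma nome_less_1:
  assumes "k \<in> {0<..<1}"
  shows "nome k < 1"
proof -
  have "0 < k\<^sup>2" "k\<^sup>2 < 1" using assms by (auto simp: power_less_one_iff abs_square_less_1)
  then have "0 < ellipK (sqrt (1 - k\<^sup>2)) / ellipK k"
    using assms by (intro divide_pos_pos ellipK_pos) auto
  from mult_pos_pos[OF pi_gt_zero this] show ?thesis by (simp add: nome_def)
qed

text \<open>With this \<theta> the modulus \<open>cn_re \<theta> 0 / dn_re \<theta> 0\<close> has
  nome \<open>exp (- 2 * \<theta>) = nome k\<close>, and by \<open>nome_inj\<close> it is
  \<open>k\<close>.\<close>

lemma modulus_of_nome:
  assumes k: "k \<in> {0<..<1}" and \<theta>: "\<theta> = - ln (nome k) / 2"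
  shows "0 < \<theta>" "k = cn_re \<theta> 0 / dn_re \<theta> 0" "ellipK k = dn_re \<theta> 0 * pi / 2"
proof -
  have n: "0 < nome k" "nome k < 1" using nome_less_1[OF k] by (auto simp: nome_def)
  then show pos: "0 < \<theta>" by (simp add: \<theta>)
  have "cn_re \<theta> 0 / dn_re \<theta> 0 \<in> {0<..<1}" using cn_re_dn_re_0[OF pos] by auto
  moreover have "nome k = nome (cn_re \<theta> 0 / dn_re \<theta> 0)"
    unfolding nome_modulus[OF pos] using n by (simp add: \<theta>)
  ultimately show e: "k = cn_re \<theta> 0 / dn_re \<theta> 0" using k nome_inj by blast
  show "ellipK k = dn_re \<theta> 0 * pi / 2" using ellipK_modulus[OF pos] e by simp
qed

section \<open>Jacobi's sn and the eigenfunctions as series\<close>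

lemma sn_re_periodic: "sn_re \<theta> (x + 2 * pi * of_int m) = sn_re \<theta> x"
proof -
  have p: "sn_re \<theta> (x + 2 * pi) = sn_re \<theta> x" for x
    using real_axis_symmetries(3)[of \<theta> "x + pi"] real_axis_symmetries(3)[of \<theta> x] by (simp add: algebra_simps)
  have nat: "sn_re \<theta> (x + 2 * pi * real n) = sn_re \<theta> x" for x n
  proof (induction n)
    case (Suc n)
    then show ?case using p[of "x + 2 * pi * real n"] by (simp add: algebra_simps)
  qed simp
  show ?thesis
  proof (cases m rule: int_cases2)
    case (nonneg n)
    then show ?thesis using nat[of x n] by simp
  next
    case (nonpos n)
    then show ?thesis using nat[of "x + 2 * pi * of_int m" n] by simp
  qed
qed

text \<open>Since K = B \<pi> / 2, the period 4K becomes 2 \<pi> after division by B, and the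
  reflection of y to 2K - y becomes that of x to \<pi> - x. The series has both symmetries, so only
  the inverse of \<open>ellipF k\<close> on [-K, K] has to be compared with it.\<close>

lemma jacobi_sn_eq:
  assumes k: "k \<in> {0<..<1}" and \<theta>: "\<theta> = - ln (nome k) / 2"
  shows "jacobi_sn x k = sn_re \<theta> (x / dn_re \<theta> 0) / cn_re \<theta> 0"
proof -
  note m = modulus_of_nome[OF k \<theta>]
  define A B where "A = cn_re \<theta> 0" and "B = dn_re \<theta> 0"
  have AB: "0 < A" "A < B" using cn_re_dn_re_0[OF m(1)] by (auto simp: A_def B_def)
  define K where "K = ellipK k"
  have "K = B * pi / 2" using m(3) by (simp add: K_def B_def)
  moreover from this have "0 < K" using AB pi_gt_zero by (metis divide_pos_pos mult_pos_pos order_less_trans zero_less_numeral)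
  ultimately have K: "K = B * pi / 2" "0 < K" by blast+
  define s where "s = (\<lambda>w. sn_re \<theta> (w / B) / A)"
  have sinv: "the_inv_into {-1..1} (ellipF k) w = s w" if w: "- K \<le> w" "w \<le> K" for w
  proof (rule the_inv_into_f_eq)
    show "inj_on (ellipF k) {-1..1}" using k by (intro inj_on_ellipF) auto
    have "\<bar>sn_re \<theta> (w / B)\<bar> \<le> A"
      using sn_cn_amp(1)[OF m(1), of "w / B"] AB by (simp add: A_def abs_mult mult_left_le)
    then show "s w \<in> {-1..1}" using AB by (auto simp: s_def abs_le_iff field_simps)
    show "ellipF k (s w) = w"
    proof (cases "0 \<le> w")
      case True
      then have "w / B \<in> {0..pi / 2}" using w AB K by (auto simp: field_simps)
      from ellipF_sn_re[OF m(1) this] show ?thesis using AB m(2) by (simp add: s_def A_def B_def)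
    next
      case False
      then have "- w / B \<in> {0..pi / 2}" using w AB K by (auto simp: field_simps)
      from ellipF_sn_re[OF m(1) this] show ?thesis
        using AB m(2) real_axis_symmetries(2)[of \<theta> "w / B"] by (simp add: s_def A_def B_def ellipF_minus)
    qed
  qed
  define n where "n = \<lfloor>(x + K) / (4 * K)\<rfloor>"
  define y where "y = x - 4 * K * of_int n"
  have "of_int n \<le> (x + K) / (4 * K)" "(x + K) / (4 * K) < of_int n + 1"
    unfolding n_def by linarith+
  then have y: "- K \<le> y" "y < 3 * K" using K(2) by (auto simp: y_def field_simps)
  have sy: "s y = s x"
  proof -
    have "x / B = y / B + 2 * pi * of_int n" using AB K(1) by (simp add: y_def field_simps)
    then show ?thesis using sn_re_periodic[of \<theta> "y / B" n] by (simp add: s_def)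
  qed
  have refl: "s (2 * K - y) = s y"
  proof -
    have "(2 * K - y) / B = - (y / B) + pi" using AB K(1) by (simp add: field_simps)
    then show ?thesis using real_axis_symmetries(2)[of \<theta> "y / B"] real_axis_symmetries(3)[of \<theta> "- (y / B)"]
      by (simp add: s_def)
  qed
  have "jacobi_sn x k = the_inv_into {-1..1} (ellipF k) (if y \<le> K then y else 2 * K - y)"
    by (simp add: jacobi_sn_def Let_def K_def y_def n_def)
  also have "\<dots> = s x" using sinv[of y] sinv[of "2 * K - y"] y sy refl by auto
  finally show ?thesis by (simp add: s_def A_def B_def)
qed

text \<open>Because \<open>k * ellipK k = cn_re \<theta> 0 * pi / 2\<close>, the prefactor cancels
  the denominator in \<open>jacobi_sn_eq\<close>, and the modulus enters only through
  \<theta>.\<close>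

lemma gp_u_eq:
  assumes k: "k \<in> {0<..<1}" and \<theta>: "\<theta> = - ln (nome k) / 2"
  shows "gp_u n k x = sqrt 2 * pi * real n * sn_re \<theta> (real n * pi * x)"
proof -
  note m = modulus_of_nome[OF k \<theta>]
  note AB = cn_re_dn_re_0[OF m(1)]
  have p: "(2::real) powr (3/2) = 2 * sqrt 2"
  proof -
    have "(2::real) powr (3/2) = 2 powr (1 + 1/2)" by simp
    also have "\<dots> = 2 * sqrt 2" unfolding powr_add by (simp add: powr_half_sqrt)
    finally show ?thesis .
  qed
  have "2 * ellipK k * real n * x / dn_re \<theta> 0 = real n * pi * x"
    using AB by (simp add: m(3) field_simps)
  moreover have kK: "k * ellipK k = cn_re \<theta> 0 * pi / 2" using AB m(2,3) by (simp add: field_simps)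
  moreover have "gp_u n k x = 2 * sqrt 2 * real n * (k * ellipK k) *
      (sn_re \<theta> (2 * ellipK k * real n * x / dn_re \<theta> 0) / cn_re \<theta> 0)"
    unfolding gp_u_def jacobi_sn_eq[OF k \<theta>] p by simp
  ultimately show ?thesis unfolding kK using AB by simp
qed

text \<open>The system gives S'' = - S (C^2 + D^2), and the first integrals turn C^2 + D^2 into A^2
  + B^2 - 2 S^2. The factor \<open>sqrt 2\<close> in the eigenfunction matches the resulting cubic
  term with \<open>u x ^ 3\<close>, and A^2 + B^2 gives the eigenvalue.\<close>

lemma gp_u_eigenfunction:
  assumes k: "k \<in> {0<..<1}" and n: "n \<ge> 1"
  shows "gp_eigenfunction (gp_eta n k) (gp_u n k)"
proof -
  define \<theta> where "\<theta> = - ln (nome k) / 2"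
  note m = modulus_of_nome[OF k \<theta>_def]
  note AB = cn_re_dn_re_0[OF m(1)]
  define c where "c = real n * pi"
  have u: "gp_u n k = (\<lambda>x. sqrt 2 * c * sn_re \<theta> (c * x))"
    using gp_u_eq[OF k \<theta>_def, of n] by (simp add: c_def fun_eq_iff mult_ac)
  define u' where "u' = (\<lambda>x. sqrt 2 * c * c * (cn_re \<theta> (c * x) * dn_re \<theta> (c * x)))"
  define u'' where "u'' = (\<lambda>x. - sqrt 2 * c * c * c *
      (sn_re \<theta> (c * x) * ((cn_re \<theta> (c * x))\<^sup>2 + (dn_re \<theta> (c * x))\<^sup>2)))"
  have ch: "((\<lambda>x. f (c * x)) has_real_derivative d * c) (at x within X)"
    if "(f has_real_derivative d) (at (c * x))" for f :: "real \<Rightarrow> real" and d x X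
    by (rule DERIV_chain2[where f = f and g = "\<lambda>x. c * x", OF that]) (auto intro!: derivative_eq_intros)
  note dd = real_axis_derivs[OF m(1), THEN ch]
  have eta: "gp_eta n k = c\<^sup>2 * ((cn_re \<theta> 0)\<^sup>2 + (dn_re \<theta> 0)\<^sup>2)"
  proof -
    have "gp_eta n k = c\<^sup>2 * ((1 + k\<^sup>2) * (dn_re \<theta> 0)\<^sup>2)"
      by (simp add: gp_eta_def m(3) c_def power_mult_distrib power_divide)
    also have "(1 + k\<^sup>2) * (dn_re \<theta> 0)\<^sup>2 = (cn_re \<theta> 0)\<^sup>2 + (dn_re \<theta> 0)\<^sup>2"
    proof -
      have "k * dn_re \<theta> 0 = cn_re \<theta> 0" using AB m(2) by simp
      then have "k\<^sup>2 * (dn_re \<theta> 0)\<^sup>2 = (cn_re \<theta> 0)\<^sup>2" by (metis power_mult_distrib)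
      then show ?thesis by (simp add: algebra_simps)
    qed
    finally show ?thesis .
  qed
  show ?thesis
    unfolding gp_eigenfunction_def
  proof (intro conjI, rule exI[of _ u'], rule exI[of _ u''], intro ballI conjI)
    fix x :: real
    show "(gp_u n k has_real_derivative u' x) (at x within {0..1})"
      unfolding u u'_def by (rule derivative_eq_intros dd refl | simp)+
    show "(u' has_real_derivative u'' x) (at x within {0..1})"
      unfolding u''_def u'_def
      by (rule derivative_eq_intros dd refl | simp add: algebra_simps power2_eq_square)+
    have "- r * c * c * c * (s * (a - s\<^sup>2 + (b - s\<^sup>2))) - (r * c * s) ^ 3 + c\<^sup>2 * (a + b) * (r * c * s) = 0"
      if "r\<^sup>2 = 2" for r c s a b :: real
    proof -
      have "(r * c * s) ^ 3 = r\<^sup>2 * r * c ^ 3 * s ^ 3"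
        by (simp add: power_mult_distrib power2_eq_square power3_eq_cube)
      then show ?thesis unfolding that by (simp add: algebra_simps power2_eq_square power3_eq_cube)
    qed
    from this[of "sqrt 2" c "sn_re \<theta> (c * x)" "(cn_re \<theta> 0)\<^sup>2" "(dn_re \<theta> 0)\<^sup>2"]
    show "u'' x - gp_u n k x ^ 3 + gp_eta n k * gp_u n k x = 0"
      unfolding u''_def u eta real_axis_first_integrals[OF m(1), of "c * x"] by simp
  next
    show "gp_u n k 0 = 0" by (simp add: u real_axis_symmetries(1))
    have "sn_re \<theta> (0 + pi * real n) = 0"
    proof (induction n)
      case (Suc n)
      then show ?case using real_axis_symmetries(3)[of \<theta> "pi * real n"] by (simp add: algebra_simps)
    qed (simp add: real_axis_symmetries(1))
    then show "gp_u n k 1 = 0" by (simp add: u c_def mult.commute)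
    \<comment> \<open>A point where the amplitude is \<pi> / 2, so that \<open>sn_re\<close> takes
      its maximal value \<open>cn_re \<theta> 0\<close>.\<close>
    have "c * (1 / (2 * real n)) = pi / 2" using n by (simp add: c_def)
    then have "gp_u n k (1 / (2 * real n)) \<noteq> 0"
      using sn_cn_amp(1)[OF m(1), of "pi / 2", unfolded amp_half_pi] AB n by (simp add: u c_def)
    moreover have "1 / (2 * real n) \<in> {0..1}" using n by simp
    ultimately show "\<exists>x\<in>{0..1}. gp_u n k x \<noteq> 0" by blast
  qed
qed

section \<open>The function \<open>s_fun\<close>\<close>

definition s_quot :: "nat \<Rightarrow> real \<Rightarrow> real" where
  "s_quot l q = (1 - q) * q ^ l / (1 - q ^ (2 * l + 1))"

text \<open>The symmetric geometric sum of q^d over all integers d from - l to l.\<close>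

definition s_denom :: "nat \<Rightarrow> real \<Rightarrow> real" where
  "s_denom l q = 1 + (\<Sum>d=1..l. q ^ d + (1 / q) ^ d)"

text \<open>Unlike \<open>s_quot\<close> itself, its reciprocal is visibly monotone: \<open>q^d + q^{-d}\<close> decreases on \<open>(0,1)\<close>.\<close>
lemma s_denom_mult:
  assumes "q \<noteq> 0"
  shows "(1 - q) * q ^ l * s_denom l q = 1 - q ^ (2 * l + 1)"
proof (induction l)
  case 0
  then show ?case by (simp add: s_denom_def)
next
  case (Suc l)
  have "s_denom (Suc l) q = s_denom l q + (q ^ Suc l + (1 / q) ^ Suc l)" by (simp add: s_denom_def)
  then have "(1 - q) * q ^ Suc l * s_denom (Suc l) q
      = q * ((1 - q) * q ^ l * s_denom l q) + (1 - q) * (q ^ Suc l * q ^ Suc l + q ^ Suc l * (1 / q) ^ Suc l)"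
    by (simp add: algebra_simps)
  also have "q ^ Suc l * (1 / q) ^ Suc l = 1" using assms by (simp add: power_mult_distrib[symmetric] del: power_Suc)
  also have "q ^ Suc l * q ^ Suc l = q ^ (2 * l + 2)" by (simp add: power_add[symmetric] mult_2)
  finally show ?case unfolding Suc by (simp add: algebra_simps)
qed

lemma s_quot_eq:
  assumes "q \<in> {0<..<1}"
  shows "s_quot l q = 1 / s_denom l q" "0 < s_denom l q"
proof -
  show pos: "0 < s_denom l q" unfolding s_denom_def
    using assms by (intro add_pos_nonneg sum_nonneg) auto
  have "1 - q ^ (2 * l + 1) = (1 - q) * q ^ l * s_denom l q" using s_denom_mult[of q l] assms by simp
  then show "s_quot l q = 1 / s_denom l q" using assms pos by (simp add: s_quot_def)
qed

lemma add_inverse_strict_antimono: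
  fixes t u :: real
  assumes "0 < t" "t < u" "u < 1"
  shows "u + 1 / u < t + 1 / t"
proof -
  have "t * u < 1" using assms mult_strict_mono[of t 1 u 1] by simp
  then have "(u - t) * (t * u) < (u - t) * 1" using assms by (intro mult_strict_left_mono) auto
  then show ?thesis using assms by (simp add: field_simps)
qed

lemma s_quot_mono:
  assumes "0 < q" "q \<le> q'" "q' < 1"
  shows "s_quot l q \<le> s_quot l q'"
proof (cases "q = q'")
  case False
  have "q' ^ d + (1 / q') ^ d \<le> q ^ d + (1 / q) ^ d" if "1 \<le> d" for d
    using add_inverse_strict_antimono[of "q ^ d" "q' ^ d"] assms False that
    by (auto simp: power_strict_mono power_less_one_iff power_one_over)
  then have "s_denom l q' \<le> s_denom l q" unfolding s_denom_def by (intro add_left_mono sum_mono) auto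
  then show ?thesis using s_quot_eq[of q l] s_quot_eq[of q' l] assms by (simp add: frac_le)
qed simp

lemma s_quot_strict_mono_1:
  assumes "0 < q" "q < q'" "q' < 1"
  shows "s_quot 1 q < s_quot 1 q'"
  using s_quot_eq[of q 1] s_quot_eq[of q' 1] assms add_inverse_strict_antimono[of q q']
  by (simp add: s_denom_def divide_strict_left_mono)

lemma s_quot_0: "s_quot l 0 = (if l = 0 then 1 else 0)" "q < 1 \<Longrightarrow> s_quot 0 q = 1"
  by (auto simp: s_quot_def)

lemma s_quot_bounds:
  assumes "0 \<le> q" "q < 1"
  shows "0 \<le> s_quot l q" "s_quot l q \<le> q ^ l"
proof -
  have "q ^ (2 * l + 1) \<le> q ^ 1" using assms by (intro power_decreasing) auto
  then have le: "1 - q \<le> 1 - q ^ (2 * l + 1)" by simp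
  then show "0 \<le> s_quot l q" using assms by (simp add: s_quot_def)
  have "(1 - q) * q ^ l \<le> (1 - q ^ (2 * l + 1)) * q ^ l"
    using le assms by (intro mult_right_mono) auto
  then show "s_quot l q \<le> q ^ l"
    using le assms unfolding s_quot_def by (subst pos_divide_le_eq) (auto simp: mult.commute)
qed

definition s_term :: "real \<Rightarrow> real \<Rightarrow> nat \<Rightarrow> real" where
  "s_term \<alpha> q l = real (2 * l + 1) powr \<alpha> * s_quot l q"

lemma s_fun_eq: "s_fun \<alpha> q = (\<Sum>l. s_term \<alpha> q l)"
  by (simp add: s_fun_def s_term_def s_quot_def)

text \<open>One factor \<open>r ^ l\<close> with \<open>r = sqrt q\<close> absorbs the power of
  \<open>2 * l + 1\<close>, the other makes the series geometric.\<close>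

lemma summable_powr_geometric:
  assumes "0 \<le> q" "q < 1"
  shows "summable (\<lambda>l. real (2 * l + 1) powr \<alpha> * q ^ l)"
proof (cases "q = 0")
  case True
  then show ?thesis by (intro summable_finite[of "{0}"]) auto
next
  case False
  define r where "r = sqrt q"
  have r: "0 < r" "r < 1" "q = r * r" using assms False by (auto simp: r_def)
  have "(\<lambda>l::nat. real (2 * l + 1) powr \<alpha> * r ^ l) \<longlonglongrightarrow> 0"
    using r(1,2) by real_asymp
  then have "Bseq (\<lambda>l::nat. real (2 * l + 1) powr \<alpha> * r ^ l)"
    by (intro convergent_imp_Bseq) (auto simp: convergent_def)
  then obtain C where C: "\<And>l. norm (real (2 * l + 1) powr \<alpha> * r ^ l) \<le> C" by (auto simp: Bseq_def)
  show ?thesis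
  proof (rule summable_comparison_test'[where N = 0])
    show "summable (\<lambda>l. C * r ^ l)" using r by (intro summable_mult summable_geometric) auto
    fix l
    have "norm (real (2 * l + 1) powr \<alpha> * q ^ l) = norm (real (2 * l + 1) powr \<alpha> * r ^ l) * r ^ l"
      using r by (simp add: power_mult_distrib norm_mult)
    also have "\<dots> \<le> C * r ^ l" using C[of l] r by (intro mult_right_mono) auto
    finally show "norm (real (2 * l + 1) powr \<alpha> * q ^ l) \<le> C * r ^ l" .
  qed
qed

lemma s_term_bounds:
  assumes "0 \<le> q" "q < 1"
  shows "0 \<le> s_term \<alpha> q l" "s_term \<alpha> q l \<le> real (2 * l + 1) powr \<alpha> * q ^ l"
  using s_quot_bounds[OF assms, of l] by (auto simp: s_term_def intro!: mult_left_mono)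

lemma summable_s_term:
  assumes "0 \<le> q" "q < 1"
  shows "summable (s_term \<alpha> q)"
  using summable_comparison_test'[OF summable_powr_geometric[OF assms, of \<alpha>], of 0 "s_term \<alpha> q"]
    s_term_bounds[OF assms, of \<alpha>] by simp

lemma s_fun_strict_mono:
  assumes "0 < q" "q < q'" "q' < 1"
  shows "s_fun \<alpha> q < s_fun \<alpha> q'"
proof -
  have s: "summable (s_term \<alpha> q)" "summable (s_term \<alpha> q')" using assms by (auto intro!: summable_s_term)
  have mono: "s_term \<alpha> q l \<le> s_term \<alpha> q' l" for l
    using s_quot_mono[of q q' l] assms by (simp add: s_term_def mult_left_mono)
  \<comment> \<open>The term l = 0 is constantly 1, so strictness is taken from l = 1.\<close>
  have "0 < (\<Sum>l\<in>{1}. s_term \<alpha> q' l - s_term \<alpha> q l)"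
    using s_quot_strict_mono_1[OF assms] by (simp add: s_term_def)
  also have "\<dots> \<le> (\<Sum>l. s_term \<alpha> q' l - s_term \<alpha> q l)"
    by (rule sum_le_suminf) (use s mono in \<open>auto intro!: summable_diff\<close>)
  also have "\<dots> = s_fun \<alpha> q' - s_fun \<alpha> q" unfolding s_fun_eq by (rule suminf_diff[symmetric]) (rule s)+
  finally show ?thesis by simp
qed

lemma continuous_on_s_fun:
  assumes "b < 1"
  shows "continuous_on {0..b} (s_fun \<alpha>)"
proof -
  have "uniform_limit {0..b} (\<lambda>n q. \<Sum>l<n. s_term \<alpha> q l) (\<lambda>q. \<Sum>l. s_term \<alpha> q l) sequentially"
  proof (cases "0 \<le> b")
    case True
    show ?thesis
    proof (rule Weierstrass_m_test[OF _ summable_powr_geometric[OF True assms]])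
      fix l q assume "q \<in> {0..b}"
      then have q: "0 \<le> q" "q \<le> b" "q < 1" using assms by auto
      have "q ^ l \<le> b ^ l" using q by (intro power_mono) auto
      then have "real (2 * l + 1) powr \<alpha> * q ^ l \<le> real (2 * l + 1) powr \<alpha> * b ^ l"
        by (intro mult_left_mono) auto
      then show "norm (s_term \<alpha> q l) \<le> real (2 * l + 1) powr \<alpha> * b ^ l"
        using s_term_bounds[OF q(1,3), of \<alpha> l] unfolding real_norm_def by linarith
    qed
  qed simp
  moreover have "continuous_on {0..b} (\<lambda>q. \<Sum>l<n. s_term \<alpha> q l)" for n
    unfolding s_term_def s_quot_def
  proof (intro continuous_intros ballI)
    fix l q assume "q \<in> {0..b}"
    then have "q ^ (2 * l + 1) < 1" using assms by (intro power_less_one_iff[THEN iffD2]) auto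
    then show "1 - q ^ (2 * l + 1) \<noteq> 0" by simp
  qed
  ultimately show ?thesis unfolding s_fun_eq[abs_def]
    by (intro uniform_limit_theorem[where F = sequentially]) auto
qed

text \<open>As q tends to 1, the l-th quotient tends to 1 / (2l+1), and 1 + 1/3 + ... + 1/15 is just
  above 2; eight is the least number of terms that suffices. The form \<open>1 / s_denom l q\<close>
  is continuous at 1, where \<open>s_quot\<close> is 0 / 0. Weights with \<alpha> \<ge> 0 only
  increase the sum.\<close>

lemma s_fun_exceeds_2:
  assumes "0 \<le> \<alpha>"
  obtains b where "0 < b" "b < 1" "2 < s_fun \<alpha> b"
proof -
  let ?g = "\<lambda>q. \<Sum>l<8. 1 / s_denom l q"
  have "?g 1 = (\<Sum>l<8. 1 / (1 + 2 * real l))" by (simp add: s_denom_def mult.commute)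
  also have "\<dots> > 2" by (simp add: eval_nat_numeral)
  finally have "2 < ?g 1" .
  moreover have "isCont ?g 1"
  proof -
    have "s_denom l 1 \<noteq> 0" for l by (simp add: s_denom_def add_nonneg_eq_0_iff)
    then show ?thesis unfolding s_denom_def by (intro continuous_intros) auto
  qed
  then have "(?g \<longlongrightarrow> ?g 1) (at_left 1)" by (simp add: isCont_def filterlim_at_split)
  ultimately have "\<forall>\<^sub>F q in at_left 1. 2 < ?g q" using order_tendstoD(1) by blast
  moreover have "\<forall>\<^sub>F q in at_left (1::real). q \<in> {0<..<1}" by (rule eventually_at_left_real) simp
  ultimately have "\<forall>\<^sub>F q in at_left 1. 2 < ?g q \<and> q \<in> {0<..<1}" by (rule eventually_conj)
  then obtain b where b: "2 < ?g b" "b \<in> {0<..<1}"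
    using eventually_happens[of _ "at_left (1::real)"] by auto
  have "?g b \<le> (\<Sum>l<8. s_term \<alpha> b l)"
  proof (rule sum_mono)
    fix l :: nat
    have "1 \<le> real (2 * l + 1) powr \<alpha>" using assms by (intro ge_one_powr_ge_zero) auto
    then have "1 * s_quot l b \<le> real (2 * l + 1) powr \<alpha> * s_quot l b"
      using s_quot_bounds(1)[of b l] b by (intro mult_right_mono) auto
    then show "1 / s_denom l b \<le> s_term \<alpha> b l" using s_quot_eq(1)[OF b(2), of l] by (simp add: s_term_def)
  qed
  also have "\<dots> \<le> s_fun \<alpha> b" unfolding s_fun_eq
    by (rule sum_le_suminf) (use b s_term_bounds(1)[of b \<alpha>] in \<open>auto intro: summable_s_term\<close>)
  finally show ?thesis using that b by auto
qed

lemma s_fun_eq_2_ex1: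
  assumes "0 \<le> \<alpha>"
  shows "\<exists>!q. q \<in> {0<..<1} \<and> s_fun \<alpha> q = 2"
proof -
  obtain b where b: "0 < b" "b < 1" "2 < s_fun \<alpha> b" using s_fun_exceeds_2[OF assms] .
  \<comment> \<open>With \<open>0 ^ 0 = 1\<close> the term l = 0 survives, so the intermediate value
    theorem can start at 0.\<close>
  have "s_fun \<alpha> 0 = 1"
  proof -
    have "s_term \<alpha> 0 = (\<lambda>l. if l = 0 then 1 else 0)" by (auto simp: s_term_def s_quot_0)
    then show ?thesis unfolding s_fun_eq using suminf_finite[of "{0}" "s_term \<alpha> 0"] by simp
  qed
  then have "\<exists>q\<ge>0. q \<le> b \<and> s_fun \<alpha> q = 2"
    using IVT'[of "s_fun \<alpha>" 0 2 b] b continuous_on_s_fun[OF b(2)] by auto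
  then obtain q where q: "0 \<le> q" "q \<le> b" "s_fun \<alpha> q = 2" by blast
  then have "q \<in> {0<..<1} \<and> s_fun \<alpha> q = 2" using b \<open>s_fun \<alpha> 0 = 1\<close> by (cases "q = 0") auto
  moreover have "q = q'" if "q \<in> {0<..<1} \<and> s_fun \<alpha> q = 2" "q' \<in> {0<..<1} \<and> s_fun \<alpha> q' = 2" for q q'
    using s_fun_strict_mono[of q q' \<alpha>] s_fun_strict_mono[of q' q \<alpha>] that
    by (cases q q' rule: linorder_cases) auto
  ultimately show ?thesis by blast
qed

lemma s_fun_less_2:
  assumes "0 \<le> \<alpha>" "0 < q" "q < r0 \<alpha>"
  shows "s_fun \<alpha> q < 2" "q < 1"
proof -
  have "r0 \<alpha> \<in> {0<..<1} \<and> s_fun \<alpha> (r0 \<alpha>) = 2"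
    unfolding r0_def by (rule theI'[OF s_fun_eq_2_ex1[OF assms(1)]])
  then show "s_fun \<alpha> q < 2" "q < 1" using s_fun_strict_mono[of q "r0 \<alpha>" \<alpha>] assms by auto
qed

text \<open>The terms of \<open>s_fun\<close> listed by the quotient j = 2l+1 of row and column
  index; even quotients carry nothing because only odd harmonics occur.\<close>

definition s_weight :: "real \<Rightarrow> real \<Rightarrow> nat \<Rightarrow> real" where
  "s_weight \<alpha> q j = (if odd j then s_term \<alpha> q (j div 2) else 0)"

lemma s_weight_nonneg: "0 \<le> q \<Longrightarrow> q < 1 \<Longrightarrow> 0 \<le> s_weight \<alpha> q j"
  by (simp add: s_weight_def s_term_bounds)

text \<open>The sum starts at j = 2, so the term l = 0, which is 1, is missing.\<close>

lemma sum_s_weight: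
  assumes "0 \<le> q" "q < 1"
  shows "(\<Sum>j=2..n. s_weight \<alpha> q j) \<le> s_fun \<alpha> q - 1"
proof -
  have "(\<Sum>j=2..n. s_weight \<alpha> q j) = (\<Sum>j\<in>{j \<in> {2..n}. odd j}. s_term \<alpha> q (j div 2))"
    unfolding s_weight_def by (rule sum.inter_filter[symmetric]) simp
  also have "\<dots> = (\<Sum>l\<in>(\<lambda>j. j div 2) ` {j \<in> {2..n}. odd j}. s_term \<alpha> q l)"
    by (subst sum.reindex) (auto simp: inj_on_def elim!: oddE)
  also have "\<dots> \<le> (\<Sum>l\<in>{1..n}. s_term \<alpha> q l)"
    by (rule sum_mono2) (auto simp: s_term_bounds assms div_greater_zero_iff Suc_le_eq)
  also have "\<dots> = (\<Sum>l\<in>insert 0 {1..n}. s_term \<alpha> q l) - 1"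
    using assms by (simp add: s_term_def s_quot_0)
  also have "\<dots> \<le> s_fun \<alpha> q - 1"
    unfolding s_fun_eq using sum_le_suminf[OF summable_s_term[OF assms], of "insert 0 {1..n}" \<alpha>]
      s_term_bounds(1)[OF assms] by simp
  finally show ?thesis .
qed

section \<open>Perturbations of the identity that are triangular for divisibility\<close>

text \<open>The quotients of \<open>m\<close> by its proper divisors. Rows are indexed by the
  quotient rather than by the divisor because the bound on an entry depends on the quotient alone.
  For \<open>m = 0\<close> the set is empty.\<close>

definition proper_codivs :: "nat \<Rightarrow> nat set" where
  "proper_codivs m = {j \<in> {2..m}. j dvd m}"

lemma proper_codivs: "finite (proper_codivs m)" "j \<in> proper_codivs m \<Longrightarrow> m div j < m"
   "j \<in> proper_codivs m \<Longrightarrow> 1 \<le> m div j"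
  by (auto simp: proper_codivs_def div_greater_zero_iff Suc_leI)

definition off_diag :: "(nat \<Rightarrow> nat \<Rightarrow> real) \<Rightarrow> (nat \<Rightarrow> complex) \<Rightarrow> nat \<Rightarrow> complex" where
  "off_diag p y m = (\<Sum>j\<in>proper_codivs m. of_real (p j (m div j)) * y (m div j))"

definition trunc :: "nat \<Rightarrow> (nat \<Rightarrow> complex) \<Rightarrow> nat \<Rightarrow> complex" where
  "trunc N y k = (if k \<le> N then y k else 0)"

lemma off_diag_cong:
  assumes "\<And>k. 1 \<le> k \<Longrightarrow> k < m \<Longrightarrow> y k = z k"
  shows "off_diag p y m = off_diag p z m"
  unfolding off_diag_def using assms proper_codivs by (intro sum.cong) auto

lemma off_diag_diff: "off_diag p (\<lambda>k. y k - z k) m = off_diag p y m - off_diag p z m"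
  by (simp add: off_diag_def sum_subtractf algebra_simps)

text \<open>Forward substitution along divisibility. It solves for an arbitrary right-hand side;
  square-summability of the result is settled afterwards by \<open>L2_le_T\<close>.\<close>

function solve_unitri :: "(nat \<Rightarrow> nat \<Rightarrow> real) \<Rightarrow> (nat \<Rightarrow> complex) \<Rightarrow> nat \<Rightarrow> complex" where
  "solve_unitri p x m =
    x m - (\<Sum>j\<in>proper_codivs m. of_real (p j (m div j)) * solve_unitri p x (m div j))"
  by auto
termination
  by (relation "Wellfounded.measure (\<lambda>(p, x, m). m)") (auto intro: proper_codivs(2))

declare solve_unitri.simps [simp del]

lemma solve_unitri: "solve_unitri p x m + off_diag p (solve_unitri p x) m = x m"
  by (subst (1) solve_unitri.simps) (simp add: off_diag_def)

lemma unitri_unique: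
  assumes "\<And>m. 1 \<le> m \<Longrightarrow> y m + off_diag p y m = z m + off_diag p z m" "1 \<le> m"
  shows "y m = z m"
  using assms(2)
proof (induction m rule: less_induct)
  case (less m)
  then have "off_diag p y m = off_diag p z m" by (intro off_diag_cong) auto
  then show ?case using assms(1)[OF less.prems] by simp
qed

text \<open>Schur's test.\<close>
lemma off_diag_sum_sq_bound:
  assumes p: "\<And>j k. 2 \<le> j \<Longrightarrow> 1 \<le> k \<Longrightarrow> \<bar>p j k\<bar> \<le> W j" and W: "\<And>j. 0 \<le> W j"
    and \<rho>: "\<And>n. (\<Sum>j=2..n. W j) \<le> \<rho>"
  shows "(\<Sum>m=1..N. (cmod (off_diag p y m))\<^sup>2) \<le> \<rho>\<^sup>2 * (\<Sum>k=1..N. (cmod (y k))\<^sup>2)"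
proof -
  let ?Y = "\<lambda>k. (cmod (y k))\<^sup>2"
  have rho_nonneg: "0 \<le> \<rho>" using \<rho>[of 0] by simp
  have "(cmod (off_diag p y m))\<^sup>2 \<le> \<rho> * (\<Sum>j\<in>proper_codivs m. W j * ?Y (m div j))" for m
  proof -
    have "cmod (off_diag p y m) \<le> (\<Sum>j\<in>proper_codivs m. W j * cmod (y (m div j)))"
      unfolding off_diag_def
    proof (rule sum_norm_le)
      fix j assume j: "j \<in> proper_codivs m"
      then have "2 \<le> j" "1 \<le> m div j" using proper_codivs(3) by (auto simp: proper_codivs_def)
      from p[OF this] show "cmod (of_real (p j (m div j)) * y (m div j)) \<le> W j * cmod (y (m div j))"
        by (simp add: norm_mult mult_right_mono)
    qed
    \<comment> \<open>Each weight is split into two roots for Cauchy-Schwarz; one factor is then a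
      row sum, at most \<open>\<rho>\<close>, and the other keeps a full weight.\<close>
    also have "\<dots> = (\<Sum>j\<in>proper_codivs m. sqrt (W j) * (sqrt (W j) * cmod (y (m div j))))"
      using W by (simp add: mult.assoc[symmetric])
    finally have "(cmod (off_diag p y m))\<^sup>2
        \<le> (\<Sum>j\<in>proper_codivs m. sqrt (W j) * (sqrt (W j) * cmod (y (m div j))))\<^sup>2"
      by (intro power_mono) auto
    also have "\<dots> \<le> (\<Sum>j\<in>proper_codivs m. (sqrt (W j))\<^sup>2) *
        (\<Sum>j\<in>proper_codivs m. (sqrt (W j) * cmod (y (m div j)))\<^sup>2)"
      by (rule Cauchy_Schwarz_ineq_sum)
    also have "\<dots> = (\<Sum>j\<in>proper_codivs m. W j) * (\<Sum>j\<in>proper_codivs m. W j * ?Y (m div j))"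
      using W by (simp add: power_mult_distrib)
    also have "\<dots> \<le> \<rho> * (\<Sum>j\<in>proper_codivs m. W j * ?Y (m div j))"
    proof (rule mult_right_mono)
      have "(\<Sum>j\<in>proper_codivs m. W j) \<le> (\<Sum>j=2..m. W j)"
        using W by (intro sum_mono2) (auto simp: proper_codivs_def)
      then show "(\<Sum>j\<in>proper_codivs m. W j) \<le> \<rho>" using \<rho>[of m] by simp
    qed (use W in \<open>auto intro!: sum_nonneg\<close>)
    finally show ?thesis .
  qed
  then have "(\<Sum>m=1..N. (cmod (off_diag p y m))\<^sup>2)
      \<le> (\<Sum>m=1..N. \<rho> * (\<Sum>j\<in>proper_codivs m. W j * ?Y (m div j)))"
    by (intro sum_mono) auto
  also have "\<dots> = \<rho> * (\<Sum>m=1..N. \<Sum>j\<in>proper_codivs m. W j * ?Y (m div j))"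
    by (simp add: sum_distrib_left)
  also have "(\<Sum>m=1..N. \<Sum>j\<in>proper_codivs m. W j * ?Y (m div j))
      = (\<Sum>m=1..N. \<Sum>j\<in>{j \<in> {2..N}. j dvd m}. W j * ?Y (m div j))"
    by (intro sum.cong refl) (auto simp: proper_codivs_def dest: dvd_imp_le)
  also have "\<dots> = (\<Sum>j=2..N. \<Sum>m\<in>{m \<in> {1..N}. j dvd m}. W j * ?Y (m div j))"
    by (rule sum.swap_restrict) auto
  also have "\<dots> \<le> (\<Sum>j=2..N. W j * (\<Sum>k=1..N. ?Y k))"
  proof (rule sum_mono)
    fix j assume j: "j \<in> {2..N}"
    let ?M = "{m \<in> {1..N}. j dvd m}"
    \<comment> \<open>The column side of the test: for fixed \<open>j\<close> distinct multiples of
      \<open>j\<close> up to \<open>N\<close> have distinct quotients in 1..N, so each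
      \<open>?Y k\<close> is counted at most once. The second factor \<open>\<rho>\<close> then
      comes from summing over \<open>j\<close>.\<close>
    have "inj_on (\<lambda>m. m div j) ?M" by (rule inj_onI) (metis (no_types, lifting) dvd_mult_div_cancel mem_Collect_eq)
    then have "(\<Sum>m\<in>?M. ?Y (m div j)) = (\<Sum>k\<in>(\<lambda>m. m div j) ` ?M. ?Y k)"
      by (simp add: sum.reindex)
    also have "\<dots> \<le> (\<Sum>k=1..N. ?Y k)"
    proof (rule sum_mono2)
      show "(\<lambda>m. m div j) ` ?M \<subseteq> {1..N}"
      proof
        fix k assume "k \<in> (\<lambda>m. m div j) ` ?M"
        then obtain m where m: "k = m div j" "1 \<le> m" "m \<le> N" "j dvd m" by auto
        then have "j \<le> m" by (intro dvd_imp_le) auto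
        then have "0 < k" using j m(1) by (simp add: div_greater_zero_iff)
        moreover have "k \<le> N" using m(1,3) by (metis div_le_dividend le_trans)
        ultimately show "k \<in> {1..N}" by simp
      qed
    qed auto
    finally show "(\<Sum>m\<in>?M. W j * ?Y (m div j)) \<le> W j * (\<Sum>k=1..N. ?Y k)"
      using W by (simp add: sum_distrib_left[symmetric] mult_left_mono)
  qed
  also have "\<dots> = (\<Sum>j=2..N. W j) * (\<Sum>k=1..N. ?Y k)" by (simp add: sum_distrib_right)
  also have "\<dots> \<le> \<rho> * (\<Sum>k=1..N. ?Y k)" using \<rho> by (intro mult_right_mono sum_nonneg) auto
  finally show ?thesis using rho_nonneg by (simp add: power2_eq_square mult_left_mono mult.assoc)
qed

text \<open>\<open>p j k\<close> is the entry in row \<open>j * k\<close> and column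
  \<open>k\<close>; the bound \<open>W j\<close> is uniform in the column. Only quotients from 2 on
  are off the diagonal.\<close>

locale unitri_perturbation =
  fixes p :: "nat \<Rightarrow> nat \<Rightarrow> real" and W :: "nat \<Rightarrow> real" and \<rho> :: real
  assumes p: "\<And>j k. 2 \<le> j \<Longrightarrow> 1 \<le> k \<Longrightarrow> \<bar>p j k\<bar> \<le> W j" and W: "\<And>j. 0 \<le> W j"
    and \<rho>: "\<And>n. (\<Sum>j=2..n. W j) \<le> \<rho>" and \<rho>1: "\<rho> < 1"
begin

definition T :: "(nat \<Rightarrow> complex) \<Rightarrow> nat \<Rightarrow> complex" where
  "T y m = y m + off_diag p y m"

lemma rho_nonneg: "0 \<le> \<rho>" using \<rho>[of 0] by simp

lemma L2_off_diag: "L2_set (\<lambda>m. cmod (off_diag p y m)) {1..N} \<le> \<rho> * L2_set (\<lambda>m. cmod (y m)) {1..N}"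
proof -
  have "sqrt (\<Sum>m=1..N. (cmod (off_diag p y m))\<^sup>2) \<le> sqrt (\<rho>\<^sup>2 * (\<Sum>k=1..N. (cmod (y k))\<^sup>2))"
    using off_diag_sum_sq_bound[OF p W \<rho>] by (rule real_sqrt_le_mono)
  then show ?thesis using rho_nonneg by (simp add: L2_set_def real_sqrt_mult)
qed

lemma L2_T_le: "L2_set (\<lambda>m. cmod (T y m)) {1..N} \<le> (1 + \<rho>) * L2_set (\<lambda>m. cmod (y m)) {1..N}"
proof -
  have "L2_set (\<lambda>m. cmod (T y m)) {1..N} \<le> L2_set (\<lambda>m. cmod (y m) + cmod (off_diag p y m)) {1..N}"
    by (intro L2_set_mono) (auto simp: T_def norm_triangle_ineq)
  also have "\<dots> \<le> L2_set (\<lambda>m. cmod (y m)) {1..N} + L2_set (\<lambda>m. cmod (off_diag p y m)) {1..N}"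
    by (rule L2_set_triangle_ineq)
  also have "\<dots> \<le> (1 + \<rho>) * L2_set (\<lambda>m. cmod (y m)) {1..N}"
    using L2_off_diag[of y N] by (simp add: distrib_right)
  finally show ?thesis .
qed

text \<open>The triangle inequality for \<open>y = T y - off_diag p y\<close>. Rows up to
  \<open>N\<close> involve only entries up to \<open>N\<close>, so the estimate holds for arbitrary
  sequences with a constant independent of \<open>N\<close>.\<close>

lemma L2_le_T: "(1 - \<rho>) * L2_set (\<lambda>m. cmod (y m)) {1..N} \<le> L2_set (\<lambda>m. cmod (T y m)) {1..N}"
proof -
  have "L2_set (\<lambda>m. cmod (y m)) {1..N} \<le> L2_set (\<lambda>m. cmod (T y m) + cmod (off_diag p y m)) {1..N}"
  proof (intro L2_set_mono)
    fix m
    have "y m = T y m - off_diag p y m" by (simp add: T_def)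
    then show "cmod (y m) \<le> cmod (T y m) + cmod (off_diag p y m)"
      by (metis norm_triangle_ineq4)
  qed auto
  also have "\<dots> \<le> L2_set (\<lambda>m. cmod (T y m)) {1..N} + L2_set (\<lambda>m. cmod (off_diag p y m)) {1..N}"
    by (rule L2_set_triangle_ineq)
  finally show ?thesis using L2_off_diag[of y N] by (simp add: left_diff_distrib)
qed

lemma sum_Suc_eq: "(\<Sum>k<N. f (Suc k)) = (\<Sum>m=1..N. f m)" for f :: "nat \<Rightarrow> real"
  by (simp only: sum.atLeast1_atMost_eq One_nat_def)

lemma summable_iff_L2:
  "summable (\<lambda>k. (cmod (y (Suc k)))\<^sup>2) \<longleftrightarrow> (\<exists>C. \<forall>N. L2_set (\<lambda>m. cmod (y m)) {1..N} \<le> C)"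
proof
  assume s: "summable (\<lambda>k. (cmod (y (Suc k)))\<^sup>2)"
  have "L2_set (\<lambda>m. cmod (y m)) {1..N} \<le> sqrt (\<Sum>k. (cmod (y (Suc k)))\<^sup>2)" for N
    using sum_le_suminf[OF s, of "{..<N}"] sum_Suc_eq[of "\<lambda>m. (cmod (y m))\<^sup>2" N]
    by (simp add: L2_set_def)
  then show "\<exists>C. \<forall>N. L2_set (\<lambda>m. cmod (y m)) {1..N} \<le> C" by blast
next
  assume "\<exists>C. \<forall>N. L2_set (\<lambda>m. cmod (y m)) {1..N} \<le> C"
  then obtain C where C: "\<And>N. L2_set (\<lambda>m. cmod (y m)) {1..N} \<le> C" by blast
  show "summable (\<lambda>k. (cmod (y (Suc k)))\<^sup>2)"
  proof (rule summableI_nonneg_bounded)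
    fix N
    have "(L2_set (\<lambda>m. cmod (y m)) {1..N})\<^sup>2 \<le> C\<^sup>2"
      using C[of N] by (intro power_mono) auto
    then show "(\<Sum>k<N. (cmod (y (Suc k)))\<^sup>2) \<le> C\<^sup>2"
      using sum_Suc_eq[of "\<lambda>m. (cmod (y m))\<^sup>2" N] by (simp add: L2_set_def sum_nonneg)
  qed auto
qed

lemma summable_T:
  assumes "summable (\<lambda>k. (cmod (y (Suc k)))\<^sup>2)"
  shows "summable (\<lambda>k. (cmod (T y (Suc k)))\<^sup>2)"
    and "(\<Sum>k. (cmod (T y (Suc k)))\<^sup>2) \<le> (1 + \<rho>)\<^sup>2 * (\<Sum>k. (cmod (y (Suc k)))\<^sup>2)"
proof -
  have le: "(\<Sum>k<N. (cmod (T y (Suc k)))\<^sup>2) \<le> (1 + \<rho>)\<^sup>2 * (\<Sum>k. (cmod (y (Suc k)))\<^sup>2)" for N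
  proof -
    have "(L2_set (\<lambda>m. cmod (T y m)) {1..N})\<^sup>2 \<le> ((1 + \<rho>) * L2_set (\<lambda>m. cmod (y m)) {1..N})\<^sup>2"
      by (intro power_mono L2_T_le) auto
    then have "(\<Sum>k<N. (cmod (T y (Suc k)))\<^sup>2) \<le> (1 + \<rho>)\<^sup>2 * (\<Sum>k<N. (cmod (y (Suc k)))\<^sup>2)"
      using sum_Suc_eq[of "\<lambda>m. (cmod (y m))\<^sup>2" N] sum_Suc_eq[of "\<lambda>m. (cmod (T y m))\<^sup>2" N]
      by (simp add: L2_set_def sum_nonneg power_mult_distrib)
    also have "\<dots> \<le> (1 + \<rho>)\<^sup>2 * (\<Sum>k. (cmod (y (Suc k)))\<^sup>2)"
      using assms by (intro mult_left_mono sum_le_suminf) auto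
    finally show ?thesis .
  qed
  show s: "summable (\<lambda>k. (cmod (T y (Suc k)))\<^sup>2)"
    using le by (rule summableI_nonneg_bounded[rotated]) auto
  show "(\<Sum>k. (cmod (T y (Suc k)))\<^sup>2) \<le> (1 + \<rho>)\<^sup>2 * (\<Sum>k. (cmod (y (Suc k)))\<^sup>2)"
    using le by (intro suminf_le_const s) auto
qed

lemma summable_trunc: "summable (\<lambda>k. (cmod (trunc N y (Suc k)))\<^sup>2)"
  by (rule summable_finite[of "{..N}"]) (auto simp: trunc_def)

lemma T_diff: "T (\<lambda>k. y k - z k) m = T y m - T z m"
  by (simp add: T_def off_diag_diff)

lemma T_trunc: "1 \<le> m \<Longrightarrow> m \<le> N \<Longrightarrow> T (trunc N y) m = T y m"
  unfolding T_def by (subst off_diag_cong[of m "trunc N y" y]) (auto simp: trunc_def)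

text \<open>The normalisation \<open>p 1 m = 1\<close> lets the diagonal join the sum as the divisor
  \<open>k = m\<close>. In this form \<open>T y\<close> is visibly a combination of columns.\<close>

lemma T_eq_sum_divisors:
  assumes "1 \<le> m" and "p 1 m = 1"
  shows "T y m = (\<Sum>k | k dvd m. of_real (p (m div k) k) * y k)"
proof -
  have "off_diag p y m = (\<Sum>k\<in>{k. k dvd m} - {m}. of_real (p (m div k) k) * y k)"
    unfolding off_diag_def
  proof (rule sum.reindex_bij_witness[where i = "\<lambda>k. m div k" and j = "\<lambda>j. m div j"])
    fix j assume j: "j \<in> proper_codivs m"
    then show "m div (m div j) = j" "m div j \<in> {k. k dvd m} - {m}"
      using proper_codivs(2)[OF j] by (auto simp: proper_codivs_def div_div_eq_right)
    then show "of_real (p (m div (m div j)) (m div j)) * y (m div j) = of_real (p j (m div j)) * y (m div j)"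
      by simp
  next
    fix k assume k: "k \<in> {k. k dvd m} - {m}"
    then have "1 \<le> k" "k dvd m" "k \<noteq> m" using assms by (auto simp: Suc_le_eq dvd_pos_nat)
    then have "m div k \<noteq> 0" "m div k \<noteq> 1" using assms by (auto simp: dvd_div_eq_iff elim!: dvdE)
    then show "m div (m div k) = k" "m div k \<in> proper_codivs m"
      using \<open>k dvd m\<close> assms by (auto simp: proper_codivs_def)
  qed
  moreover have "finite {k. k dvd m}" using assms by auto
  ultimately show ?thesis
    unfolding T_def using assms by (subst sum.remove[of _ m]) auto
qed

lemma T_cong:
  assumes "\<And>k. 1 \<le> k \<Longrightarrow> y k = z k" "1 \<le> m"
  shows "T y m = T z m"
  unfolding T_def using off_diag_cong[of m y z p] assms by simp

lemma summable_cmod_diff: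
  assumes "summable (\<lambda>k. (cmod (x (Suc k)))\<^sup>2)" "summable (\<lambda>k. (cmod (y (Suc k)))\<^sup>2)"
  shows "summable (\<lambda>k. (cmod (x (Suc k) - y (Suc k)))\<^sup>2)"
proof (rule summable_comparison_test'[where N = 0])
  show "summable (\<lambda>k. 2 * ((cmod (x (Suc k)))\<^sup>2 + (cmod (y (Suc k)))\<^sup>2))"
    by (intro summable_mult summable_add assms)
  fix k
  have "(cmod (x (Suc k) - y (Suc k)))\<^sup>2 \<le> (cmod (x (Suc k)) + cmod (y (Suc k)))\<^sup>2"
    by (intro power_mono norm_triangle_ineq4) auto
  also have "\<dots> \<le> 2 * ((cmod (x (Suc k)))\<^sup>2 + (cmod (y (Suc k)))\<^sup>2)"
    using sum_squares_bound[of "cmod (x (Suc k))" "cmod (y (Suc k))"] by (simp add: power2_sum)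
  finally show "norm ((cmod (x (Suc k) - y (Suc k)))\<^sup>2) \<le> 2 * ((cmod (x (Suc k)))\<^sup>2 + (cmod (y (Suc k)))\<^sup>2)"
    by simp
qed

text \<open>The solution \<open>y\<close> of \<open>T y = x\<close> is square-summable by
  \<open>L2_le_T\<close>. The remainder is \<open>T\<close> applied to its tail, and
  \<open>T\<close> is bounded by \<open>1 + \<rho>\<close>.\<close>

lemma expansion_ex:
  assumes x: "summable (\<lambda>k. (cmod (x (Suc k)))\<^sup>2)"
  obtains y where "(\<lambda>N. \<Sum>k. (cmod (x (Suc k) - T (trunc N y) (Suc k)))\<^sup>2) \<longlonglongrightarrow> 0"
proof -
  define y where "y = solve_unitri p x"
  have Ty: "T y = x" using solve_unitri[of p x] by (simp add: y_def T_def fun_eq_iff)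
  obtain C where C: "\<And>N. L2_set (\<lambda>m. cmod (x m)) {1..N} \<le> C" using x summable_iff_L2 by blast
  have "L2_set (\<lambda>m. cmod (y m)) {1..N} \<le> C / (1 - \<rho>)" for N
    using L2_le_T[of y N] C[of N] \<rho>1 by (simp add: Ty field_simps)
  then have ys: "summable (\<lambda>k. (cmod (y (Suc k)))\<^sup>2)" using summable_iff_L2 by blast
  let ?z = "\<lambda>N k. y k - trunc N y k"
  have zs: "(\<lambda>k. (cmod (?z N (Suc k)))\<^sup>2) sums (\<Sum>k. (cmod (y (Suc (k + N))))\<^sup>2)" for N
  proof -
    have "(\<lambda>k. (cmod (?z N (Suc (k + N))))\<^sup>2) sums (\<Sum>k. (cmod (y (Suc (k + N))))\<^sup>2)"
      using summable_sums[OF summable_ignore_initial_segment[OF ys, of N]] by (simp add: trunc_def)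
    moreover have "(\<Sum>k<N. (cmod (?z N (Suc k)))\<^sup>2) = 0" by (simp add: trunc_def)
    ultimately show ?thesis
      using sums_iff_shift[of "\<lambda>k. (cmod (?z N (Suc k)))\<^sup>2" N] by simp
  qed
  have "(\<lambda>N. (1 + \<rho>)\<^sup>2 * (\<Sum>k. (cmod (y (Suc (k + N))))\<^sup>2)) \<longlonglongrightarrow> (1 + \<rho>)\<^sup>2 * 0"
    using suminf_exist_split2[OF ys] by (intro tendsto_mult_left)
  then have lim: "(\<lambda>N. (1 + \<rho>)\<^sup>2 * (\<Sum>k. (cmod (y (Suc (k + N))))\<^sup>2)) \<longlonglongrightarrow> 0" by simp
  have eq: "x (Suc k) - T (trunc N y) (Suc k) = T (?z N) (Suc k)" for N k
    unfolding T_diff Ty ..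
  have z: "summable (\<lambda>k. (cmod (?z N (Suc k)))\<^sup>2)" for N using zs[of N] by (simp only: sums_iff)
  have "(\<Sum>k. (cmod (T (?z N) (Suc k)))\<^sup>2) \<le> (1 + \<rho>)\<^sup>2 * (\<Sum>k. (cmod (y (Suc (k + N))))\<^sup>2)" for N
    using summable_T(2)[OF z[of N]] unfolding sums_unique[OF zs[of N]] .
  moreover have "0 \<le> (\<Sum>k. (cmod (T (?z N) (Suc k)))\<^sup>2)" for N
    by (intro suminf_nonneg summable_T(1) z) simp
  ultimately have "(\<lambda>N. \<Sum>k. (cmod (T (?z N) (Suc k)))\<^sup>2) \<longlonglongrightarrow> 0"
    by (intro tendsto_sandwich[OF _ _ tendsto_const lim] always_eventually allI) assumption+
  then have "(\<lambda>N. \<Sum>k. (cmod (x (Suc k) - T (trunc N y) (Suc k)))\<^sup>2) \<longlonglongrightarrow> 0"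
    unfolding eq .
  then show ?thesis by (rule that)
qed

text \<open>Convergence in norm implies convergence of each coordinate, and coordinate
  \<open>m\<close> of \<open>T (trunc N y)\<close> is already \<open>T y m\<close> for
  \<open>N \<ge> m\<close>. Hence every expansion solves the triangular system, whatever the growth
  of its coefficients.\<close>

lemma expansion_T_eq:
  assumes x: "summable (\<lambda>k. (cmod (x (Suc k)))\<^sup>2)"
    and lim: "(\<lambda>N. \<Sum>k. (cmod (x (Suc k) - T (trunc N y) (Suc k)))\<^sup>2) \<longlonglongrightarrow> 0" and "1 \<le> m"
  shows "T y m = x m"
proof -
  obtain k where m: "m = Suc k" using \<open>1 \<le> m\<close> by (cases m) auto
  have "(cmod (x m - T y m))\<^sup>2 \<le> (\<Sum>k. (cmod (x (Suc k) - T (trunc N y) (Suc k)))\<^sup>2)" if "N \<ge> m" for N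
  proof -
    have "(\<Sum>k\<in>{k}. (cmod (x (Suc k) - T (trunc N y) (Suc k)))\<^sup>2)
        \<le> (\<Sum>k. (cmod (x (Suc k) - T (trunc N y) (Suc k)))\<^sup>2)"
      by (intro sum_le_suminf summable_cmod_diff[OF x] summable_T summable_trunc) auto
    then show ?thesis using T_trunc[of m N y] that \<open>1 \<le> m\<close> by (simp add: m)
  qed
  then have "(cmod (x m - T y m))\<^sup>2 \<le> 0"
    using lim by (intro tendsto_lowerbound[OF lim]) (auto simp: eventually_sequentially)
  then show ?thesis by simp
qed

lemma expansion_unique:
  assumes "summable (\<lambda>k. (cmod (x (Suc k)))\<^sup>2)"
    and "(\<lambda>N. \<Sum>k. (cmod (x (Suc k) - T (trunc N y) (Suc k)))\<^sup>2) \<longlonglongrightarrow> 0"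
    and "(\<lambda>N. \<Sum>k. (cmod (x (Suc k) - T (trunc N z) (Suc k)))\<^sup>2) \<longlonglongrightarrow> 0" and "1 \<le> m"
  shows "y m = z m"
proof (rule unitri_unique[OF _ \<open>1 \<le> m\<close>])
  fix m :: nat assume "1 \<le> m"
  then show "y m + off_diag p y m = z m + off_diag p z m"
    using expansion_T_eq[OF assms(1,2)] expansion_T_eq[OF assms(1,3)] by (metis T_def)
qed

end

section \<open>Sine coefficients of the eigenfunctions\<close>

lemma has_integral_sin_sin:
  fixes a b :: nat
  assumes "1 \<le> a" "1 \<le> b"
  shows "((\<lambda>x. sin (real a * pi * x) * sin (real b * pi * x)) has_integral (if a = b then 1 / 2 else 0)) {0..1}"
proof (cases "a = b")
  case True
  define c where "c = real b * pi"
  define F where "F = (\<lambda>x. x / 2 - sin (2 * c * x) / (4 * c))"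
  have c: "c \<noteq> 0" using assms by (simp add: c_def)
  have "((\<lambda>x. sin (c * x) * sin (c * x)) has_integral F 1 - F 0) {0..1}"
  proof (rule fundamental_theorem_of_calculus)
    fix x :: real
    have "(F has_real_derivative 1 / 2 - cos (2 * (c * x)) / 2) (at x within {0..1})"
      unfolding F_def using c by (auto intro!: derivative_eq_intros simp: mult.assoc)
    also have "1 / 2 - cos (2 * (c * x)) / 2 = sin (c * x) * sin (c * x)"
      by (simp add: cos_double_sin power2_eq_square diff_divide_distrib)
    finally show "(F has_vector_derivative sin (c * x) * sin (c * x)) (at x within {0..1})"
      by (simp add: has_real_derivative_iff_has_vector_derivative)
  qed simp
  moreover have "F 1 - F 0 = 1 / 2"
    using sin_npi[of "2 * b"] by (simp add: F_def c_def mult.assoc)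
  ultimately show ?thesis using True by (simp add: c_def)
next
  case False
  define d s where "d = (real a - real b) * pi" and "s = (real a + real b) * pi"
  define F where "F = (\<lambda>x. sin (d * x) / (2 * d) - sin (s * x) / (2 * s))"
  have ds: "d \<noteq> 0" "s \<noteq> 0" using False assms by (auto simp: d_def s_def)
  have "((\<lambda>x. sin (real a * pi * x) * sin (real b * pi * x)) has_integral F 1 - F 0) {0..1}"
  proof (rule fundamental_theorem_of_calculus)
    fix x :: real
    have "(F has_real_derivative (cos (d * x) - cos (s * x)) / 2) (at x within {0..1})"
      unfolding F_def using ds by (auto intro!: derivative_eq_intros simp: diff_divide_distrib)
    also have "(cos (d * x) - cos (s * x)) / 2 = sin (real a * pi * x) * sin (real b * pi * x)"
      by (simp add: sin_times_sin d_def s_def algebra_simps)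
    finally show "(F has_vector_derivative sin (real a * pi * x) * sin (real b * pi * x)) (at x within {0..1})"
      by (simp add: has_real_derivative_iff_has_vector_derivative)
  qed simp
  moreover have "sin d = 0"
    using sin_npi_int[of "int a - int b"] by (simp add: d_def mult.commute)
  moreover have "sin s = 0"
    using sin_npi[of "a + b"] by (simp add: s_def)
  ultimately show ?thesis using False by (simp add: F_def)
qed

text \<open>With e = exp (- \<theta>) and q = e^2 one has sinh (j \<theta>) = (1 - e^(2j)) / (2
  e^j). The factor 1 / sinh \<theta> is independent of l; what is left is the l-th quotient in
  \<open>s_fun\<close>.\<close>

lemma inverse_sinh_eq:
  assumes "0 < \<theta>" "q = exp (- 2 * \<theta>)"
  shows "1 / sinh (real (2 * l + 1) * \<theta>) = s_quot l q / sinh \<theta>"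
proof -
  define e where "e = exp (- \<theta>)"
  have e: "0 < e" "e < 1" using assms by (auto simp: e_def)
  have q: "q = e ^ 2" using assms by (simp add: e_def power2_eq_square mult_exp_exp)
  have sh: "sinh (real j * \<theta>) = (1 - e ^ (2 * j)) / (2 * e ^ j)" for j
  proof -
    have "exp (- (real j * \<theta>)) = e ^ j" by (simp add: e_def exp_of_nat_mult[symmetric])
    moreover have "exp (real j * \<theta>) = 1 / exp (- (real j * \<theta>))" by (simp add: exp_minus field_simps)
    ultimately have "sinh (real j * \<theta>) = (1 / e ^ j - e ^ j) / 2" by (simp only: sinh_field_def)
    also have "\<dots> = (1 - e ^ j * e ^ j) / (2 * e ^ j)" using e by (simp add: field_simps)
    finally show ?thesis by (simp only: mult_2 power_add)
  qed
  have "e ^ (2 * (2 * l + 1)) < 1" "e ^ 2 < 1" using e by (intro power_less_one_iff[THEN iffD2]; simp)+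
  then have nz: "1 - e ^ (2 * (2 * l + 1)) \<noteq> 0" "1 - e ^ 2 \<noteq> 0" by simp_all
  have "1 / sinh (real (2 * l + 1) * \<theta>) = 1 / ((1 - e ^ (2 * (2 * l + 1))) / (2 * (e * e ^ (2 * l))))"
    unfolding sh by simp
  also have "\<dots> = ((1 - e ^ 2) * e ^ (2 * l) / (1 - e ^ (2 * (2 * l + 1)))) / ((1 - e ^ 2) / (2 * e))"
  proof -
    have "1 / (b / (2 * (e * E))) = (a * E / b) / (a / (2 * e))" if "a \<noteq> 0" "b \<noteq> 0" for a b E :: real
      using that e by simp
    then show ?thesis using nz by blast
  qed
  also have "\<dots> = s_quot l q / sinh \<theta>"
    using sh[of 1] unfolding s_quot_def q by (simp only: power_mult[symmetric] of_nat_1 mult_1 power_one_right mult_1_right)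
  finally show ?thesis .
qed

lemma uniform_limit_sn_re:
  assumes "0 < \<theta>"
  shows "uniform_limit X (\<lambda>N x. \<Sum>l<N. 2 / sinh (real (2 * l + 1) * \<theta>) * sin (real (2 * l + 1) * x))
     (sn_re \<theta>) sequentially"
proof -
  define q where "q = exp (- 2 * \<theta>)"
  have q: "0 \<le> q" "q < 1" using assms by (auto simp: q_def)
  have "uniform_limit X (\<lambda>N x. \<Sum>l<N. 2 / sinh (real (2 * l + 1) * \<theta>) * sin (real (2 * l + 1) * x))
     (\<lambda>x. \<Sum>l. 2 / sinh (real (2 * l + 1) * \<theta>) * sin (real (2 * l + 1) * x)) sequentially"
  proof (rule Weierstrass_m_test)
    show "summable (\<lambda>l. 2 / sinh \<theta> * q ^ l)" using q by (intro summable_mult summable_geometric) auto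
    fix l x
    have e: "2 / sinh (real (2 * l + 1) * \<theta>) = 2 / sinh \<theta> * s_quot l q"
      using inverse_sinh_eq[OF assms q_def, of l] by (simp add: field_simps)
    have "\<bar>s_quot l q * sin (real (2 * l + 1) * x)\<bar> \<le> q ^ l * 1"
      unfolding abs_mult using s_quot_bounds[OF q, of l] by (intro mult_mono) auto
    then have "2 / sinh \<theta> * \<bar>s_quot l q * sin (real (2 * l + 1) * x)\<bar> \<le> 2 / sinh \<theta> * (q ^ l * 1)"
      using assms by (intro mult_left_mono) auto
    then show "norm (2 / sinh (real (2 * l + 1) * \<theta>) * sin (real (2 * l + 1) * x)) \<le> 2 / sinh \<theta> * q ^ l"
      unfolding e using assms by (simp add: abs_mult)
  qed
  moreover have "(\<lambda>x. \<Sum>l. 2 / sinh (real (2 * l + 1) * \<theta>) * sin (real (2 * l + 1) * x)) = sn_re \<theta>"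
    using sn_re_sums[OF assms] by (intro ext) (simp add: sums_iff)
  ultimately show ?thesis by simp
qed

text \<open>Uniform convergence allows termwise integration, and orthogonality of the sines leaves
  at most the one index with \<open>(2 * l + 1) * n = m\<close>. The factor 2 of the series meets
  the value 1/2 of the integral.\<close>

lemma integral_sn_re_sin:
  fixes n m :: nat
  assumes \<theta>: "0 < \<theta>" and n: "1 \<le> n" and m: "1 \<le> m"
  shows "integral {0..1} (\<lambda>x. sn_re \<theta> (real n * pi * x) * sin (real m * pi * x))
     = (if n dvd m \<and> odd (m div n) then 1 / sinh (real (m div n) * \<theta>) else 0)"
proof -
  let ?s = "\<lambda>l. 2 / sinh (real (2 * l + 1) * \<theta>)"
  let ?f = "\<lambda>N x. \<Sum>l<N. ?s l * (sin (real ((2 * l + 1) * n) * pi * x) * sin (real m * pi * x))"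
  let ?v = "\<lambda>l. if (2 * l + 1) * n = m then 1 / sinh (real (2 * l + 1) * \<theta>) else 0"
  have "uniform_limit {0..1} (\<lambda>N x. (\<Sum>l<N. ?s l * sin (real (2 * l + 1) * (real n * pi * x))))
     (\<lambda>x. sn_re \<theta> (real n * pi * x)) sequentially"
    by (rule uniform_limit_compose'[OF uniform_limit_sn_re[OF \<theta>, of UNIV]]) auto
  then have "uniform_limit {0..1} (\<lambda>N x. (\<Sum>l<N. ?s l * sin (real (2 * l + 1) * (real n * pi * x))) * sin (real m * pi * x))
     (\<lambda>x. sn_re \<theta> (real n * pi * x) * sin (real m * pi * x)) sequentially"
  proof (rule uniform_lim_mult[OF _ uniform_limit_const])
    have "continuous_on {0..1} (\<lambda>x. sn_re \<theta> (real n * pi * x))"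
      by (rule continuous_on_compose2[of UNIV "sn_re \<theta>"])
        (auto intro!: continuous_intros DERIV_continuous_on[OF real_axis_derivs(1)[OF \<theta>]])
    then show "bounded ((\<lambda>x. sn_re \<theta> (real n * pi * x)) ` {0..1})"
      by (intro compact_imp_bounded compact_continuous_image) auto
    show "bounded ((\<lambda>x. sin (real m * pi * x)) ` {0..1})"
      by (intro compact_imp_bounded compact_continuous_image continuous_intros) auto
  qed
  moreover have "(\<lambda>N x. (\<Sum>l<N. ?s l * sin (real (2 * l + 1) * (real n * pi * x))) * sin (real m * pi * x)) = ?f"
  proof -
    have "real (2 * l + 1) * (real n * pi * x) = real ((2 * l + 1) * n) * pi * x" for l x
      by (simp add: algebra_simps)
    then show ?thesis by (simp only: sum_distrib_right mult.assoc)
  qed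
  ultimately have ul: "uniform_limit {0..1} ?f (\<lambda>x. sn_re \<theta> (real n * pi * x) * sin (real m * pi * x)) sequentially"
    by simp
  have "continuous_on {0..1} (?f N)" for N by (intro continuous_intros)
  from uniform_limit_integral[OF ul this trivial_limit_sequentially]
  obtain I J where I: "\<And>N. (?f N has_integral I N) {0..1}"
    and J: "((\<lambda>x. sn_re \<theta> (real n * pi * x) * sin (real m * pi * x)) has_integral J) {0..1}"
    and lim: "I \<longlonglongrightarrow> J" by blast
  have "(?f N has_integral (\<Sum>l<N. ?s l * (if (2 * l + 1) * n = m then 1 / 2 else 0))) {0..1}" for N
    using n m by (intro has_integral_sum has_integral_mult_right has_integral_sin_sin) auto
  then have "I N = (\<Sum>l<N. ?s l * (if (2 * l + 1) * n = m then 1 / 2 else 0))" for N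
    by (rule has_integral_unique[OF I])
  moreover have "?s l * (if (2 * l + 1) * n = m then 1 / 2 else 0) = ?v l" for l by simp
  ultimately have "I = (\<lambda>N. \<Sum>l<N. ?v l)" by (intro ext) (simp only:)
  with lim have "?v sums J" by (simp only: sums_def)
  moreover have "?v sums (if n dvd m \<and> odd (m div n) then 1 / sinh (real (m div n) * \<theta>) else 0)"
  proof (cases "n dvd m \<and> odd (m div n)")
    case True
    define k where "k = (m div n) div 2"
    have k: "2 * k + 1 = m div n" using True by (simp add: k_def)
    have "(2 * l + 1) * n = m \<longleftrightarrow> l = k" for l
    proof
      assume "(2 * l + 1) * n = m"
      then have "2 * l + 1 = m div n" using div_mult_self_is_m[of n "2 * l + 1"] n by simp
      then show "l = k" using k by simp
    next
      assume "l = k"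
      then show "(2 * l + 1) * n = m" using k True by simp
    qed
    then have "?v = (\<lambda>l. if l = k then 1 / sinh (real (2 * l + 1) * \<theta>) else 0)" by (simp only:)
    moreover have "(\<lambda>l. if l = k then 1 / sinh (real (2 * l + 1) * \<theta>) else 0) sums (1 / sinh (real (2 * k + 1) * \<theta>))"
      by (rule sums_single)
    ultimately show ?thesis unfolding k using True by (simp only: if_True simp_thms)
  next
    case False
    have "(2 * l + 1) * n \<noteq> m" for l
    proof
      assume "(2 * l + 1) * n = m"
      then have "m div n = 2 * l + 1" using div_mult_self_is_m[of n "2 * l + 1"] n by simp
      then have "odd (m div n)" by simp
      moreover have "n dvd m" using dvd_triv_right[of n "2 * l + 1"] unfolding \<open>(2 * l + 1) * n = m\<close> .
      ultimately show False using False by blast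
    qed
    then have "?v = (\<lambda>l. 0)" by simp
    moreover have "(if n dvd m \<and> odd (m div n) then 1 / sinh (real (m div n) * \<theta>) else 0) = 0"
      using False by (rule if_not_P)
    ultimately show ?thesis by (simp only: sums_zero)
  qed
  ultimately have "J = (if n dvd m \<and> odd (m div n) then 1 / sinh (real (m div n) * \<theta>) else 0)"
    by (rule sums_unique2)
  then show ?thesis using J by (simp add: integral_unique)
qed

section \<open>Square-integrable functions and their weighted sine coefficients\<close>

lemma integrable_lebesgue_on_Ioo:
  fixes f :: "real \<Rightarrow> 'a::euclidean_space"
  assumes "continuous_on {a..b} f"
  shows "integrable (lebesgue_on {a<..<b}) f"
proof -
  have "set_integrable lebesgue {a..b} f"
    using continuous_imp_integrable_real[OF assms] by (simp add: integrable_restrict_space set_integrable_def)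
  then have "set_integrable lebesgue {a<..<b} f" by (rule set_integrable_subset) auto
  then show ?thesis by (simp add: integrable_restrict_space set_integrable_def)
qed

lemma L2_01_continuous:
  assumes "continuous_on {0..1} f"
  shows "f \<in> L2_01"
proof -
  have "integrable (lebesgue_on {0<..<1}) (\<lambda>x. (norm (f x))\<^sup>2)"
    by (intro integrable_lebesgue_on_Ioo continuous_intros assms)
  then show ?thesis
    using integrable_lebesgue_on_Ioo[OF assms] by (auto simp: L2_01_def dest: borel_measurable_integrable)
qed

text \<open>The majorant \<open>1 + (norm (f x))\<^sup>2\<close> is integrable because the interval
  is bounded.\<close>

lemma L2_01_integrable_sin:
  assumes "f \<in> L2_01"
  shows "integrable (lebesgue_on {0<..<1}) (\<lambda>x. f x * of_real (sin (c * x)))"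
proof (rule Bochner_Integration.integrable_bound)
  have f: "f \<in> borel_measurable (lebesgue_on {0<..<1})" "integrable (lebesgue_on {0<..<1}) (\<lambda>x. (norm (f x))\<^sup>2)"
    using assms by (auto simp: L2_01_def)
  show "integrable (lebesgue_on {0<..<1}) (\<lambda>x. 1 + (norm (f x))\<^sup>2)"
    by (intro Bochner_Integration.integrable_add f integrable_lebesgue_on_Ioo continuous_intros)
  have "(\<lambda>x. complex_of_real (sin (c * x))) \<in> borel_measurable (lebesgue_on {0<..<1})"
    by (intro borel_measurable_integrable integrable_lebesgue_on_Ioo continuous_intros)
  then show "(\<lambda>x. f x * of_real (sin (c * x))) \<in> borel_measurable (lebesgue_on {0<..<1})"
    using f by (intro borel_measurable_times)
  have "norm (f x * of_real (sin (c * x))) \<le> 1 + (norm (f x))\<^sup>2" for x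
  proof -
    have "norm (f x * of_real (sin (c * x))) \<le> norm (f x)"
      by (simp add: norm_mult mult_left_le)
    also have "\<dots> \<le> 1 + (norm (f x))\<^sup>2"
      using sum_squares_bound[of "norm (f x)" 1] norm_ge_zero[of "f x"] unfolding one_power2 by linarith
    finally show ?thesis .
  qed
  moreover have "norm (1 + (norm (f x))\<^sup>2) = 1 + (norm (f x))\<^sup>2" for x
    by (simp add: add_nonneg_nonneg)
  ultimately show "AE x in lebesgue_on {0<..<1}. norm (f x * of_real (sin (c * x))) \<le> norm (1 + (norm (f x))\<^sup>2)"
    by (intro AE_I2) simp
qed

lemma sine_coeff_diff_sum:
  assumes "f \<in> L2_01" "\<And>k. e k \<in> L2_01"
  shows "sine_coeff (\<lambda>x. f x - (\<Sum>k<N. c k * e k x)) m = sine_coeff f m - (\<Sum>k<N. c k * sine_coeff (e k) m)"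
proof -
  let ?M = "lebesgue_on {0<..<1::real}"
  let ?s = "\<lambda>x. complex_of_real (sin (real m * pi * x))"
  note i = L2_01_integrable_sin[OF assms(1), of "real m * pi"] L2_01_integrable_sin[OF assms(2), of _ "real m * pi"]
  have "(LINT x|?M. (f x - (\<Sum>k<N. c k * e k x)) * ?s x)
      = (LINT x|?M. f x * ?s x - (\<Sum>k<N. c k * (e k x * ?s x)))"
    by (simp add: left_diff_distrib sum_distrib_right mult.assoc)
  also have "\<dots> = (LINT x|?M. f x * ?s x) - (\<Sum>k<N. c k * (LINT x|?M. e k x * ?s x))"
    using i by (subst Bochner_Integration.integral_diff) (auto intro!: Bochner_Integration.integrable_sum integrable_mult_right)
  finally show ?thesis
    by (simp add: sine_coeff_def right_diff_distrib sum_distrib_left mult_ac)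
qed

text \<open>Moving the weight into the coefficients makes the norm an unweighted l2 norm.
  Summability is assumed so that the complex series defining \<open>H_inner\<close> can be read as a
  real one.\<close>

lemma H_norm_eq:
  assumes "summable (\<lambda>k. (cmod (of_real (real (Suc k) powr \<alpha>) * sine_coeff g (Suc k)))\<^sup>2)"
  shows "H_norm \<alpha> g = sqrt (\<Sum>k. (cmod (of_real (real (Suc k) powr \<alpha>) * sine_coeff g (Suc k)))\<^sup>2)"
proof -
  let ?t = "\<lambda>k. (cmod (of_real (real (Suc k) powr \<alpha>) * sine_coeff g (Suc k)))\<^sup>2"
  have "of_real (real (Suc k) powr (2 * \<alpha>)) * sine_coeff g (Suc k) * cnj (sine_coeff g (Suc k)) = of_real (?t k)" for k
  proof -
    have "real (Suc k) powr (2 * \<alpha>) = (real (Suc k) powr \<alpha>)\<^sup>2"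
      by (simp add: powr_power mult.commute)
    then show ?thesis
      by (simp add: norm_mult power_mult_distrib mult.assoc complex_norm_square[symmetric] del: of_nat_Suc)
  qed
  then have "H_inner \<alpha> g g = (\<Sum>k. complex_of_real (?t k))" by (simp only: H_inner_def)
  also have "\<dots> = of_real (\<Sum>k. ?t k)" by (rule suminf_of_real[OF assms, symmetric])
  finally show ?thesis by (simp add: H_norm_def)
qed

lemma H_space_iff:
  "f \<in> H_space \<alpha> \<longleftrightarrow> f \<in> L2_01 \<and>
    summable (\<lambda>k. (cmod (of_real (real (Suc k) powr \<alpha>) * sine_coeff f (Suc k)))\<^sup>2)"
proof -
  have "real (Suc k) powr (2 * \<alpha>) * (norm (sine_coeff f (Suc k)))\<^sup>2
      = (cmod (of_real (real (Suc k) powr \<alpha>) * sine_coeff f (Suc k)))\<^sup>2" for k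
    by (simp add: norm_mult power_mult_distrib powr_power mult.commute del: of_nat_Suc)
  then show ?thesis by (simp only: H_space_def mem_Collect_eq)
qed

lemma continuous_on_gp_u:
  assumes k: "k \<in> {0<..<1}"
  shows "continuous_on X (gp_u n k)"
proof -
  define \<theta> where "\<theta> = - ln (nome k) / 2"
  note m = modulus_of_nome[OF k \<theta>_def]
  have "continuous_on UNIV (sn_re \<theta>)" by (rule DERIV_continuous_on[OF real_axis_derivs(1)[OF m(1)]])
  then have "continuous_on X (\<lambda>x. sn_re \<theta> (real n * pi * x))"
    by (rule continuous_on_compose2) (auto intro!: continuous_intros)
  then have "continuous_on X (\<lambda>x. sqrt 2 * pi * real n * sn_re \<theta> (real n * pi * x))"
    by (rule continuous_on_mult_left)
  moreover have "gp_u n k = (\<lambda>x. sqrt 2 * pi * real n * sn_re \<theta> (real n * pi * x))"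
    by (intro ext gp_u_eq[OF k \<theta>_def])
  ultimately show ?thesis by simp
qed

text \<open>The factor \<open>2 * pi * real n / sinh \<theta>\<close> does not depend on
  \<open>m\<close>: it merely scales the column belonging to \<open>n\<close> and is divided out in
  the basis argument.\<close>

lemma sine_coeff_gp_u:
  assumes k: "k \<in> {0<..<1}" and \<theta>: "\<theta> = - ln (nome k) / 2" and n: "1 \<le> n" and m: "1 \<le> m"
  shows "sine_coeff (\<lambda>x. of_real (gp_u n k x)) m
     = of_real (if n dvd m \<and> odd (m div n) then 2 * pi * real n / sinh \<theta> * s_quot (m div n div 2) (nome k) else 0)"
proof -
  note t = modulus_of_nome(1)[OF k \<theta>]
  let ?g = "\<lambda>x. gp_u n k x * sin (real m * pi * x)"
  have cont: "continuous_on {0..1} ?g" by (intro continuous_intros continuous_on_gp_u k)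
  have "sine_coeff (\<lambda>x. of_real (gp_u n k x)) m
      = of_real (sqrt 2) * (LINT x|lebesgue_on {0<..<1}. complex_of_real (?g x))"
    by (simp add: sine_coeff_def)
  also have "(LINT x|lebesgue_on {0<..<1}. complex_of_real (?g x))
      = of_real (LINT x|lebesgue_on {0<..<1}. ?g x)" by (rule integral_complex_of_real)
  also have "(LINT x|lebesgue_on {0<..<1}. ?g x) = integral {0..1} ?g"
    using lebesgue_integral_eq_integral[OF integrable_lebesgue_on_Ioo[OF cont]]
    by (simp add: integral_open_interval_real)
  also have "?g = (\<lambda>x. (sqrt 2 * pi * real n) * (sn_re \<theta> (real n * pi * x) * sin (real m * pi * x)))"
    by (simp add: gp_u_eq[OF k \<theta>] mult.assoc)
  also have "integral {0..1} \<dots> = (sqrt 2 * pi * real n) *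
      (if n dvd m \<and> odd (m div n) then 1 / sinh (real (m div n) * \<theta>) else 0)"
    using integral_sn_re_sin[OF t n m] by simp
  also have "(if n dvd m \<and> odd (m div n) then 1 / sinh (real (m div n) * \<theta>) else 0)
      = (if n dvd m \<and> odd (m div n) then s_quot (m div n div 2) (nome k) / sinh \<theta> else 0)"
  proof (cases "odd (m div n)")
    case True
    then have "2 * (m div n div 2) + 1 = m div n" by simp
    moreover have "nome k = exp (- 2 * \<theta>)" using \<theta> by (simp add: nome_def)
    ultimately show ?thesis using inverse_sinh_eq[OF t, of "nome k" "m div n div 2"] by simp
  qed simp
  finally have "sine_coeff (\<lambda>x. of_real (gp_u n k x)) m = of_real (sqrt 2 * (sqrt 2 * pi * real n *
      (if n dvd m \<and> odd (m div n) then s_quot (m div n div 2) (nome k) / sinh \<theta> else 0)))"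
    by (simp only: of_real_mult)
  also have "sqrt 2 * (sqrt 2 * pi * real n *
      (if n dvd m \<and> odd (m div n) then s_quot (m div n div 2) (nome k) / sinh \<theta> else 0))
    = (if n dvd m \<and> odd (m div n) then 2 * pi * real n / sinh \<theta> * s_quot (m div n div 2) (nome k) else 0)"
    by (simp add: mult.assoc[symmetric])
  finally show ?thesis .
qed

section \<open>The basis property\<close>

theorem theorem5p1:
  fixes \<alpha> :: real
  assumes "\<alpha> \<ge> 0"
  shows "(\<exists>!q. q \<in> {0<..<1} \<and> s_fun \<alpha> q = 2) \<and>
    (\<forall>\<mu> :: nat \<Rightarrow> real.
       (\<forall>n\<ge>1. \<mu> n \<in> {0<..<1}) \<and> (\<lambda>n. nome (\<mu> n)) \<in> T0 \<alpha> \<longrightarrow>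
       (\<forall>n\<ge>1. gp_eigenfunction (gp_eta n (\<mu> n)) (gp_u n (\<mu> n))) \<and>
       schauder_basis (H_space \<alpha>) (H_norm \<alpha>)
         (\<lambda>k x. complex_of_real (gp_u (Suc k) (\<mu> (Suc k)) x)))"
proof (intro conjI allI impI)
  show "\<exists>!q. q \<in> {0<..<1} \<and> s_fun \<alpha> q = 2" by (rule s_fun_eq_2_ex1[OF assms])
next
  fix \<mu> :: "nat \<Rightarrow> real" and n :: nat
  assume "(\<forall>n\<ge>1. \<mu> n \<in> {0<..<1}) \<and> (\<lambda>n. nome (\<mu> n)) \<in> T0 \<alpha>" "n \<ge> 1"
  then show "gp_eigenfunction (gp_eta n (\<mu> n)) (gp_u n (\<mu> n))" by (intro gp_u_eigenfunction) auto
next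
  fix \<mu> :: "nat \<Rightarrow> real"
  assume *: "(\<forall>n\<ge>1. \<mu> n \<in> {0<..<1}) \<and> (\<lambda>n. nome (\<mu> n)) \<in> T0 \<alpha>"
  then have \<mu>: "\<mu> n \<in> {0<..<1}" if "1 \<le> n" for n using that by blast
  define q where "q = (\<lambda>n. nome (\<mu> n))"
  define r where "r = (SUP n\<in>{1..}. q n)"
  have q01: "0 < q n" "q n < 1" if "1 \<le> n" for n
    using nome_less_1[OF \<mu>[OF that]] by (auto simp: q_def nome_def)
  have qr: "q n \<le> r" if "1 \<le> n" for n
    unfolding r_def using that q01 by (intro cSUP_upper bdd_aboveI2[of _ _ 1]) (auto simp: less_imp_le)
  have "r < r0 \<alpha>" using * by (simp add: T0_def r_def q_def)
  moreover have r0: "0 < r" using q01(1)[of 1] qr[of 1] by simp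
  ultimately have s2: "s_fun \<alpha> r < 2" "r < 1" using s_fun_less_2[OF assms] by auto
  \<comment> \<open>Entry of the normalised matrix at row \<open>j * n\<close>, column
    \<open>n\<close>: the weights of row and column leave the factor
    \<open>j powr \<alpha>\<close>.\<close>
  define p where "p = (\<lambda>j n. if odd j then real j powr \<alpha> * s_quot (j div 2) (q n) else 0)"
  have p1: "p 1 n = 1" if "1 \<le> n" for n using q01[OF that] by (simp add: p_def s_quot_0)
  interpret unitri_perturbation p "s_weight \<alpha> r" "s_fun \<alpha> r - 1"
  proof
    fix j k :: nat assume "2 \<le> j" "1 \<le> k"
    note qk = q01[OF \<open>1 \<le> k\<close>]
    have "s_quot (j div 2) (q k) \<le> s_quot (j div 2) r"
      using qk s2 by (intro s_quot_mono qr \<open>1 \<le> k\<close>) auto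
    moreover have "0 \<le> s_quot (j div 2) (q k)" using qk by (intro s_quot_bounds) auto
    ultimately show "\<bar>p j k\<bar> \<le> s_weight \<alpha> r j"
      by (auto simp: p_def s_weight_def s_term_def abs_mult intro!: mult_left_mono)
  qed (use r0 s2 sum_s_weight[of r \<alpha>] in \<open>auto intro!: s_weight_nonneg\<close>)
  define \<theta> where "\<theta> = (\<lambda>n. - ln (q n) / 2)"
  \<comment> \<open>The weighted \<open>n\<close>-th sine coefficient of the \<open>n\<close>-th
    eigenfunction. Being nonzero, it can be used to rescale coefficients to unit diagonal.\<close>
  define V where "V = (\<lambda>n. real n powr \<alpha> * (2 * pi * real n / sinh (\<theta> n)))"
  have V: "V n \<noteq> 0" if "1 \<le> n" for n
    using modulus_of_nome(1)[OF \<mu>[OF that] refl] that by (simp add: V_def \<theta>_def q_def)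
  define e where "e = (\<lambda>k x. complex_of_real (gp_u (Suc k) (\<mu> (Suc k)) x))"
  define w where "w = (\<lambda>f m. of_real (real m powr \<alpha>) * sine_coeff f m)"
  have eL2: "e k \<in> L2_01" for k
    unfolding e_def using \<mu> by (intro L2_01_continuous continuous_intros continuous_on_gp_u) simp
  have we: "w (e k) m = (if Suc k dvd m then of_real (V (Suc k) * p (m div Suc k) (Suc k)) else 0)"
    if "1 \<le> m" for k m
  proof (cases "Suc k dvd m \<and> odd (m div Suc k)")
    case True
    have "real m = real (Suc k) * real (m div Suc k)"
      using True by (metis dvd_mult_div_cancel of_nat_mult)
    then have "real m powr \<alpha> = real (Suc k) powr \<alpha> * real (m div Suc k) powr \<alpha>"
      by (simp only: powr_mult)
    then show ?thesis using True sine_coeff_gp_u[OF \<mu>[of "Suc k"] refl _ that, of "Suc k"]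
      by (simp add: w_def e_def V_def p_def \<theta>_def q_def del: of_nat_Suc)
  next
    case False
    then show ?thesis using sine_coeff_gp_u[OF \<mu>[of "Suc k"] refl _ that, of "Suc k"]
      by (auto simp: w_def e_def p_def)
  qed
  \<comment> \<open>Passes from expansion coefficients, indexed from 0, to the unknowns of the
    triangular system, indexed from 1; \<open>trunc N\<close> then keeps exactly the first
    \<open>N\<close> eigenfunctions.\<close>
  define Y where "Y = (\<lambda>c k. of_real (V k) * (c (k - 1) :: complex))"
  have T_Y: "T (trunc N (Y c)) m = (\<Sum>k<N. c k * w (e k) m)" if "1 \<le> m" for N c m
  proof -
    have "T (trunc N (Y c)) m = (\<Sum>k | k dvd m. of_real (p (m div k) k) * trunc N (Y c) k)"
      by (rule T_eq_sum_divisors[OF that p1[OF that]])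
    also have "\<dots> = (\<Sum>k\<in>{1..N}. if k dvd m then of_real (p (m div k) k) * Y c k else 0)"
      using that by (intro sum.mono_neutral_cong) (auto simp: trunc_def Suc_le_eq dvd_pos_nat)
    also have "\<dots> = (\<Sum>k<N. if Suc k dvd m then of_real (p (m div Suc k) (Suc k)) * Y c (Suc k) else 0)"
      by (simp only: sum.atLeast1_atMost_eq One_nat_def)
    also have "\<dots> = (\<Sum>k<N. c k * w (e k) m)"
      by (intro sum.cong) (auto simp: we[OF that] Y_def mult_ac)
    finally show ?thesis .
  qed
  have H: "f \<in> H_space \<alpha> \<longleftrightarrow> f \<in> L2_01 \<and> summable (\<lambda>k. (cmod (w f (Suc k)))\<^sup>2)" for f
    unfolding H_space_iff w_def ..
  have eH: "e k \<in> H_space \<alpha>" for k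
  proof -
    \<comment> \<open>A single eigenfunction is the image of a finitely supported sequence, so its
      membership follows from the boundedness of \<open>T\<close>.\<close>
    have "w (e k) m = T (trunc (Suc k) (Y (\<lambda>i. if i = k then 1 else 0))) m" if "1 \<le> m" for m
      unfolding T_Y[OF that] by (simp add: sum.delta)
    then show ?thesis unfolding H using eL2 summable_T(1)[OF summable_trunc] by simp
  qed
  have norm: "H_norm \<alpha> (\<lambda>x. f x - (\<Sum>k<N. c k * e k x))
      = sqrt (\<Sum>k. (cmod (w f (Suc k) - T (trunc N (Y c)) (Suc k)))\<^sup>2)" if "f \<in> H_space \<alpha>" for f c N
  proof -
    let ?g = "\<lambda>x. f x - (\<Sum>k<N. c k * e k x)"
    have g: "w ?g m = w f m - T (trunc N (Y c)) m" if "1 \<le> m" for m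
      unfolding T_Y[OF that] using \<open>f \<in> H_space \<alpha>\<close> eL2
      by (simp add: w_def sine_coeff_diff_sum H right_diff_distrib sum_distrib_left mult_ac)
    have "summable (\<lambda>k. (cmod (w f (Suc k) - T (trunc N (Y c)) (Suc k)))\<^sup>2)"
      using that unfolding H by (intro summable_cmod_diff summable_T summable_trunc) auto
    then have "summable (\<lambda>k. (cmod (w ?g (Suc k)))\<^sup>2)" using g by simp
    then have "H_norm \<alpha> ?g = sqrt (\<Sum>k. (cmod (w ?g (Suc k)))\<^sup>2)"
      unfolding w_def by (rule H_norm_eq)
    then show ?thesis using g by simp
  qed
  \<comment> \<open>From here on convergence in H^\<alpha> is a statement about \<open>T\<close> and
    the sequence \<open>w f\<close> alone.\<close>
  have conv: "(\<lambda>N. H_norm \<alpha> (\<lambda>x. f x - (\<Sum>k<N. c k * e k x))) \<longlonglongrightarrow> 0 \<longleftrightarrow>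
      (\<lambda>N. \<Sum>k. (cmod (w f (Suc k) - T (trunc N (Y c)) (Suc k)))\<^sup>2) \<longlonglongrightarrow> 0" (is "_ \<longleftrightarrow> ?S \<longlonglongrightarrow> 0")
    if "f \<in> H_space \<alpha>" for f c
  proof -
    have nn: "0 \<le> ?S N" for N
      using that unfolding H by (intro suminf_nonneg summable_cmod_diff summable_T summable_trunc) auto
    have "?S \<longlonglongrightarrow> 0" if "(\<lambda>N. sqrt (?S N)) \<longlonglongrightarrow> 0"
      using tendsto_power[OF that, of 2] nn by simp
    moreover have "(\<lambda>N. sqrt (?S N)) \<longlonglongrightarrow> 0" if "?S \<longlonglongrightarrow> 0"
      using tendsto_real_sqrt[OF that] by simp
    ultimately show ?thesis unfolding norm[OF that] by blast
  qed
  show "schauder_basis (H_space \<alpha>) (H_norm \<alpha>)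
         (\<lambda>k x. complex_of_real (gp_u (Suc k) (\<mu> (Suc k)) x))"
    unfolding schauder_basis_def e_def[symmetric]
  proof (intro conjI allI ballI)
    fix k show "e k \<in> H_space \<alpha>" by (rule eH)
  next
    fix f assume f: "f \<in> H_space \<alpha>"
    then have wf: "summable (\<lambda>k. (cmod (w f (Suc k)))\<^sup>2)" by (simp add: H)
    obtain y where y: "(\<lambda>N. \<Sum>k. (cmod (w f (Suc k) - T (trunc N y) (Suc k)))\<^sup>2) \<longlonglongrightarrow> 0"
      using expansion_ex[of "w f", OF wf] by blast
    show "\<exists>!c. (\<lambda>N. H_norm \<alpha> (\<lambda>x. f x - (\<Sum>k<N. c k * e k x))) \<longlonglongrightarrow> 0"
      unfolding conv[OF f]
    proof (rule ex1I)
      \<comment> \<open>Undoes the scaling and the index shift in \<open>Y\<close>, so that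
        \<open>Y c\<close> and \<open>y\<close> agree from index 1 on.\<close>
      define c where "c = (\<lambda>k. y (Suc k) / of_real (V (Suc k)))"
      have "T (trunc N (Y c)) (Suc k) = T (trunc N y) (Suc k)" for N k
        by (rule T_cong) (auto simp: trunc_def Y_def c_def V)
      then show "(\<lambda>N. \<Sum>k. (cmod (w f (Suc k) - T (trunc N (Y c)) (Suc k)))\<^sup>2) \<longlonglongrightarrow> 0"
        using y by simp
      fix c' assume c': "(\<lambda>N. \<Sum>k. (cmod (w f (Suc k) - T (trunc N (Y c')) (Suc k)))\<^sup>2) \<longlonglongrightarrow> 0"
      show "c' = c"
      proof
        fix k
        have "Y c' (Suc k) = y (Suc k)" by (rule expansion_unique[OF wf c' y]) simp
        then show "c' k = c k" using V[of "Suc k"] by (simp add: Y_def c_def field_simps)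
      qed
    qed
  qed
qed

end
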